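(* Let $\varepsilon>0$. The scaled semigeostrophic equation $$\partial_t\rho+\{\psi_\varepsilon[\rho],\rho\}=0,\qquad \det(I+\varepsilon D^2\psi_\varepsilon[\rho])=1+\varepsilon\rho,\qquad \int_{\mathbb{T}^2}\rho\,dx=\int_{\mathbb{T}^2}\psi_\varepsilon\,dx=0,$$ (on the perturbative branch $\varepsilon\|D^2\psi_\varepsilon\|_{L^\infty}\le\eta_0$) is the Hamiltonian flow generated by $\mathcal H_\varepsilon(\rho)=\frac{1}{2\varepsilon^2}W_2^2((1+\varepsilon\rho)\,dx,dx)$ with respect to the Lie--Poisson bracket $$\{F,G\}_{LP}(\rho)=\int_{\mathbb{T}^2}\rho\left\{\frac{\delta F}{\delta\rho},\frac{\delta G}{\delta\rho}\right\}dx .$$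
   Context: $\mathbb{T}^2=\mathbb{R}^2/\mathbb{Z}^2$ with unit volume; $\nabla^\perp f=(-\partial_2f,\partial_1f)$ and $\{f,g\}=\nabla^\perp f\cdot\nabla g$. $W_2$ is the quadratic Wasserstein distance for the flat-torus distance. For smooth mean-zero $\rho$ with $1+\varepsilon\rho>0$, $\psi_\varepsilon[\rho]$ is the periodic mean-zero function such that $P_\varepsilon=\frac{|x|^2}{2}+\varepsilon\psi_\varepsilon$ is convex, $\det D^2P_\varepsilon=1+\varepsilon\rho$, and $\nabla P_\varepsilon$ is the optimal map pushing $(1+\varepsilon\rho)dx$ to $dx$. $\eta_0>0$ is a fixed sufficiently small universal constant (so that in particular $\|\varepsilon\nabla\psi_\varepsilon\|_{L^\infty}<\frac12$ on the branch considered). The functional derivative $\delta F/\delta\rho$ is the function with $DF(\rho)[h]=\int\frac{\delta F}{\delta\rho}h\,dx$ for smooth mean-zero $h$ (defined up to an additive constant, which does not affect the bracket). A smooth curve $t\mapsto\rho(t)$ is a trajectory of the Hamiltonian flow generated by $\mathcal H$ if $\frac{d}{dt}F(\rho(t))=\{F,\mathcal H\}_{LP}(\rho(t))$ for the observables $F$; it is tested on the linear observables $F_f(\rho)=\int\rho f\,dx$, $f\in C^\infty(\mathbb{T}^2)$, for which $\delta F_f/\delta\rho=f$. The claim is that this condition is the equation $\partial_t\rho+\{\psi_\varepsilon[\rho],\rho\}=0$ (in distributions). *)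

theory Defs
  imports "HOL-Analysis.Analysis"
begin

section \<open>Smooth functions and differential operators on the plane\<close>

text \<open>
  \<open>Ck_on n S f\<close>: all iterated directional derivatives of \<open>f\<close> of order at most \<open>n\<close> exist and are
  continuous on the open set \<open>S\<close>.
\<close>

primrec Ck_on :: "nat \<Rightarrow> 'a::real_normed_vector set \<Rightarrow> ('a \<Rightarrow> 'b::real_normed_vector) \<Rightarrow> bool" where
  "Ck_on 0 S f \<longleftrightarrow> continuous_on S f"
| "Ck_on (Suc n) S f \<longleftrightarrow>
     (\<forall>x\<in>S. f differentiable (at x)) \<and>
     (\<forall>v. Ck_on n S (\<lambda>x. frechet_derivative f (at x) v))"

definition smooth_on :: "'a::real_normed_vector set \<Rightarrow> ('a \<Rightarrow> 'b::real_normed_vector) \<Rightarrow> bool" where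
  "smooth_on S f \<longleftrightarrow> (\<forall>n. Ck_on n S f)"

definition partial_deriv :: "2 \<Rightarrow> (real^2 \<Rightarrow> real) \<Rightarrow> real^2 \<Rightarrow> real" where
  "partial_deriv i f x = frechet_derivative f (at x) (axis i 1)"

definition gradient :: "(real^2 \<Rightarrow> real) \<Rightarrow> real^2 \<Rightarrow> real^2" where
  "gradient f x = (\<chi> i. partial_deriv i f x)"

definition perp_gradient :: "(real^2 \<Rightarrow> real) \<Rightarrow> real^2 \<Rightarrow> real^2" where
  "perp_gradient f x = vector [- partial_deriv 2 f x, partial_deriv 1 f x]"

definition hessian :: "(real^2 \<Rightarrow> real) \<Rightarrow> real^2 \<Rightarrow> real^2^2" where
  "hessian f x = (\<chi> i j. partial_deriv i (partial_deriv j f) x)"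

definition poisson :: "(real^2 \<Rightarrow> real) \<Rightarrow> (real^2 \<Rightarrow> real) \<Rightarrow> real^2 \<Rightarrow> real" where
  "poisson f g x = perp_gradient f x \<bullet> gradient g x"


section \<open>The flat torus\<close>

text \<open>
  The torus \<open>\<real>\<^sup>2/\<int>\<^sup>2\<close> is represented by the fundamental domain \<open>[0,1)\<^sup>2\<close> equipped with the
  quotient distance. Functions on the torus are \<open>\<int>\<^sup>2\<close>-periodic functions on the plane.
\<close>

definition int_lattice :: "(real^2) set" where
  "int_lattice = {k. \<forall>i. k $ i \<in> \<int>}"

definition fundamental_domain :: "(real^2) set" where
  "fundamental_domain = {x. \<forall>i. 0 \<le> x $ i \<and> x $ i < 1}"

definition torus_proj :: "real^2 \<Rightarrow> real^2" where
  "torus_proj x = (\<chi> i. frac (x $ i))"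

definition torus_dist :: "real^2 \<Rightarrow> real^2 \<Rightarrow> real" where
  "torus_dist x y = (INF k\<in>int_lattice. norm (x - y - k))"

definition torus_measure :: "(real^2) measure" where
  "torus_measure = restrict_space lborel fundamental_domain"

definition torus_integral :: "(real^2 \<Rightarrow> real) \<Rightarrow> real" where
  "torus_integral f = (\<integral>x. f x \<partial>torus_measure)"

definition periodic :: "(real^2 \<Rightarrow> real) \<Rightarrow> bool" where
  "periodic f \<longleftrightarrow> (\<forall>x. \<forall>k\<in>int_lattice. f (x + k) = f x)"

definition torus_smooth :: "(real^2 \<Rightarrow> real) \<Rightarrow> bool" where
  "torus_smooth f \<longleftrightarrow> periodic f \<and> smooth_on UNIV f"


section \<open>Quadratic optimal transport on the torus\<close>

definition couplings :: "(real^2) measure \<Rightarrow> (real^2) measure \<Rightarrow> ((real^2) \<times> (real^2)) measure set" where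
  "couplings \<mu> \<nu> =
     {\<gamma>. sets \<gamma> = sets (\<mu> \<Otimes>\<^sub>M \<nu>) \<and> distr \<gamma> \<mu> fst = \<mu> \<and> distr \<gamma> \<nu> snd = \<nu>}"

definition W2 :: "(real^2) measure \<Rightarrow> (real^2) measure \<Rightarrow> real" where
  "W2 \<mu> \<nu> = sqrt (INF \<gamma>\<in>couplings \<mu> \<nu>. \<integral>p. (torus_dist (fst p) (snd p))\<^sup>2 \<partial>\<gamma>)"

definition optimal_map :: "(real^2) measure \<Rightarrow> (real^2) measure \<Rightarrow> (real^2 \<Rightarrow> real^2) \<Rightarrow> bool" where
  "optimal_map \<mu> \<nu> T \<longleftrightarrow>
     T \<in> measurable \<mu> \<nu> \<and> distr \<mu> \<nu> T = \<nu> \<and>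
     (\<integral>x. (torus_dist x (T x))\<^sup>2 \<partial>\<mu>) = (W2 \<mu> \<nu>)\<^sup>2"


section \<open>Functionals and the Lie--Poisson bracket\<close>

definition is_functional_derivative ::
  "((real^2 \<Rightarrow> real) \<Rightarrow> real) \<Rightarrow> (real^2 \<Rightarrow> real) \<Rightarrow> (real^2 \<Rightarrow> real) \<Rightarrow> bool" where
  "is_functional_derivative F \<rho> g \<longleftrightarrow>
     torus_smooth g \<and>
     (\<forall>h. torus_smooth h \<and> torus_integral h = 0 \<longrightarrow>
        ((\<lambda>s. F (\<lambda>x. \<rho> x + s * h x)) has_real_derivative torus_integral (\<lambda>x. g x * h x)) (at 0))"

definition functionally_differentiable ::
  "((real^2 \<Rightarrow> real) \<Rightarrow> real) \<Rightarrow> (real^2 \<Rightarrow> real) \<Rightarrow> bool" where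
  "functionally_differentiable F \<rho> \<longleftrightarrow> (\<exists>g. is_functional_derivative F \<rho> g)"

text \<open>
  Functional derivatives are determined up to an additive constant only; the choice does not
  affect the bracket, which sees their gradients.
\<close>

definition functional_derivative ::
  "((real^2 \<Rightarrow> real) \<Rightarrow> real) \<Rightarrow> (real^2 \<Rightarrow> real) \<Rightarrow> real^2 \<Rightarrow> real" where
  "functional_derivative F \<rho> = (SOME g. is_functional_derivative F \<rho> g)"

definition lie_poisson ::
  "((real^2 \<Rightarrow> real) \<Rightarrow> real) \<Rightarrow> ((real^2 \<Rightarrow> real) \<Rightarrow> real) \<Rightarrow> (real^2 \<Rightarrow> real) \<Rightarrow> real" where
  "lie_poisson F G \<rho> =
     torus_integral (\<lambda>x. \<rho> x * poisson (functional_derivative F \<rho>) (functional_derivative G \<rho>) x)"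

definition linear_observable :: "(real^2 \<Rightarrow> real) \<Rightarrow> (real^2 \<Rightarrow> real) \<Rightarrow> real" where
  "linear_observable f \<rho> = torus_integral (\<lambda>x. \<rho> x * f x)"

definition smooth_curve :: "real set \<Rightarrow> (real \<Rightarrow> real^2 \<Rightarrow> real) \<Rightarrow> bool" where
  "smooth_curve I \<rho> \<longleftrightarrow>
     (\<forall>t\<in>I. periodic (\<rho> t)) \<and> smooth_on (I \<times> UNIV) (\<lambda>(t, x). \<rho> t x)"

definition hamiltonian_trajectory ::
  "((real^2 \<Rightarrow> real) \<Rightarrow> real) \<Rightarrow> real set \<Rightarrow> (real \<Rightarrow> real^2 \<Rightarrow> real) \<Rightarrow> bool" where
  "hamiltonian_trajectory H I \<rho> \<longleftrightarrow>
     (\<forall>f. torus_smooth f \<longrightarrow>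
       (\<forall>t\<in>I. ((\<lambda>s. linear_observable f (\<rho> s)) has_real_derivative
                 lie_poisson (linear_observable f) H (\<rho> t)) (at t)))"


section \<open>The scaled semigeostrophic equation\<close>

definition scaled_measure :: "real \<Rightarrow> (real^2 \<Rightarrow> real) \<Rightarrow> (real^2) measure" where
  "scaled_measure \<epsilon> \<rho> = density torus_measure (\<lambda>x. ennreal (1 + \<epsilon> * \<rho> x))"

definition sg_hamiltonian :: "real \<Rightarrow> (real^2 \<Rightarrow> real) \<Rightarrow> real" where
  "sg_hamiltonian \<epsilon> \<rho> = 1 / (2 * \<epsilon>\<^sup>2) * (W2 (scaled_measure \<epsilon> \<rho>) torus_measure)\<^sup>2"

definition admissible :: "real \<Rightarrow> (real^2 \<Rightarrow> real) \<Rightarrow> bool" where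
  "admissible \<epsilon> \<rho> \<longleftrightarrow> torus_smooth \<rho> \<and> torus_integral \<rho> = 0 \<and> (\<forall>x. 1 + \<epsilon> * \<rho> x > 0)"

definition convex_potential :: "real \<Rightarrow> (real^2 \<Rightarrow> real) \<Rightarrow> real^2 \<Rightarrow> real" where
  "convex_potential \<epsilon> \<psi> x = (norm x)\<^sup>2 / 2 + \<epsilon> * \<psi> x"

definition is_sg_potential :: "real \<Rightarrow> (real^2 \<Rightarrow> real) \<Rightarrow> (real^2 \<Rightarrow> real) \<Rightarrow> bool" where
  "is_sg_potential \<epsilon> \<rho> \<psi> \<longleftrightarrow>
     torus_smooth \<psi> \<and> torus_integral \<psi> = 0 \<and>
     convex_on UNIV (convex_potential \<epsilon> \<psi>) \<and>
     (\<forall>x. det (hessian (convex_potential \<epsilon> \<psi>) x) = 1 + \<epsilon> * \<rho> x) \<and>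
     optimal_map (scaled_measure \<epsilon> \<rho>) torus_measure
       (\<lambda>x. torus_proj (gradient (convex_potential \<epsilon> \<psi>) x))"

definition sg_potential :: "real \<Rightarrow> (real^2 \<Rightarrow> real) \<Rightarrow> real^2 \<Rightarrow> real" where
  "sg_potential \<epsilon> \<rho> = (THE \<psi>. is_sg_potential \<epsilon> \<rho> \<psi>)"

text \<open>
  The Hessian is measured in the Frobenius norm (the library norm of \<open>real^2^2\<close>); passing to another
  matrix norm only changes the universal constant \<open>\<eta>\<close>. For continuous periodic functions the
  pointwise bound is the \<open>L\<^sup>\<infinity>\<close> bound.
\<close>

definition on_perturbative_branch :: "real \<Rightarrow> real \<Rightarrow> (real^2 \<Rightarrow> real) \<Rightarrow> bool" where
  "on_perturbative_branch \<eta> \<epsilon> \<rho> \<longleftrightarrow>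
     admissible \<epsilon> \<rho> \<and>
     (\<exists>\<psi>. is_sg_potential \<epsilon> \<rho> \<psi> \<and> (\<forall>x. \<epsilon> * norm (hessian \<psi> x) \<le> \<eta>))"

definition sg_constraints :: "real \<Rightarrow> (real^2 \<Rightarrow> real) \<Rightarrow> bool" where
  "sg_constraints \<epsilon> \<rho> \<longleftrightarrow>
     (\<forall>x. det (mat 1 + \<epsilon> *\<^sub>R hessian (sg_potential \<epsilon> \<rho>) x) = 1 + \<epsilon> * \<rho> x) \<and>
     torus_integral \<rho> = 0 \<and> torus_integral (sg_potential \<epsilon> \<rho>) = 0"

text \<open>
  In the distributional form the equation holds in the space of distributions on the torus at
  every time of \<open>I\<close>.
\<close>

definition sg_solution_distr :: "real \<Rightarrow> real set \<Rightarrow> (real \<Rightarrow> real^2 \<Rightarrow> real) \<Rightarrow> bool" where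
  "sg_solution_distr \<epsilon> I \<rho> \<longleftrightarrow>
     (\<forall>t\<in>I. sg_constraints \<epsilon> (\<rho> t) \<and>
       (\<forall>f. torus_smooth f \<longrightarrow>
         torus_integral
           (\<lambda>x. (deriv (\<lambda>s. \<rho> s x) t + poisson (sg_potential \<epsilon> (\<rho> t)) (\<rho> t) x) * f x) = 0))"

definition sg_solution_classical :: "real \<Rightarrow> real set \<Rightarrow> (real \<Rightarrow> real^2 \<Rightarrow> real) \<Rightarrow> bool" where
  "sg_solution_classical \<epsilon> I \<rho> \<longleftrightarrow>
     (\<forall>t\<in>I. sg_constraints \<epsilon> (\<rho> t) \<and>
       (\<forall>x. deriv (\<lambda>s. \<rho> s x) t + poisson (sg_potential \<epsilon> (\<rho> t)) (\<rho> t) x = 0))"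

end

theory Submission
  imports Defs
begin

text \<open>
  The functional derivative of the Hamiltonian at \<open>\<rho>\<close> is \<open>-\<psi>\<close> (up to a constant). The Kantorovich dual
  of the transport problem, evaluated at the potentials \<open>-\<epsilon>\<psi>\<close> and its c-transform, bounds the cost of every perturbed
  density \<open>1 + \<epsilon>(\<rho> + s h)\<close> from below to first order in \<open>s\<close>. For the matching upper bound write
  \<open>h = \<partial>\<^sub>1V\<^sub>1 + \<partial>\<^sub>2V\<^sub>2\<close>, translate suitable parts of the density along the coordinate axes before applying the
  optimal map, and absorb the remaining \<open>o(s)\<close> discrepancy of the densities in a product coupling.
  Since every admissible potential is thus a functional derivative, the potential is unique. Finally
  \<open>\<integral>\<rho> {f, -\<psi>} = \<integral>\<rho> {\<psi>, f} = - \<integral>f {\<psi>, \<rho>}\<close> turns the bracket equation for linear observables into the weak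
  form of the equation, and testing with the residual itself gives the classical form.
\<close>

text \<open>The obstacle is the upper bound: for both signs of \<open>s\<close> a coupling with
  exactly the prescribed marginals is needed whose cost is right up to \<open>o(s)\<close>. Moving
  the density along the flow of a vector field would bring in Jacobians and inverse maps.
  Translating pieces of the density preserves Lebesgue measure, so the moved densities are explicit.
  Each piece moves along one axis only, so each \<open>V\<^sub>i\<close> needs just its own partial
  derivative and can be written down by integrating along lines. What remains is a continuous
  density error of size \<open>o(s)\<close>. As the density is bounded below by a positive constant,
  scaling the moved part by \<open>1 - \<omega>\<close>, with \<open>\<omega>\<close> proportional
  to \<open>\<eta> |s|\<close>, makes the remainder nonnegative, and the product coupling carries it
  at price at most \<open>2 \<omega>\<close>, because the squared torus distance is at most 2. Here
  \<open>\<eta>\<close> is arbitrary. The lower bound has no error term: the dual value of the fixed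
  potentials is affine in the density and exact at \<open>s = 0\<close>.\<close>

section \<open>Integration on the torus\<close>

lemma fundamental_domain_borel [measurable]: "fundamental_domain \<in> sets borel"
proof -
  have "fundamental_domain = (\<Inter>i. {x. 0 \<le> x $ i} \<inter> {x. x $ i < 1})"
    by (auto simp: fundamental_domain_def)
  also have "\<dots> \<in> sets borel"
    by measurable
  finally show ?thesis .
qed

lemma box_subset_fundamental_domain: "box 0 1 \<subseteq> fundamental_domain"
  by (auto simp: fundamental_domain_def mem_box_cart less_imp_le)

lemma fundamental_domain_subset_cbox: "fundamental_domain \<subseteq> cbox 0 1"
  by (auto simp: fundamental_domain_def mem_box_cart less_imp_le)

lemma space_torus_measure [simp]: "space torus_measure = fundamental_domain"
  by (simp add: torus_measure_def space_restrict_space)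

lemma sets_torus_measure: "A \<in> sets torus_measure \<longleftrightarrow> A \<in> sets borel \<and> A \<subseteq> fundamental_domain"
  unfolding torus_measure_def by (subst sets_restrict_space_iff) auto

lemma measurable_torus_measure1:
  "f \<in> borel \<rightarrow>\<^sub>M N \<Longrightarrow> f \<in> torus_measure \<rightarrow>\<^sub>M N"
  by (simp add: torus_measure_def measurable_restrict_space1)

lemma nn_integral_torus_measure:
  "(\<integral>\<^sup>+x. f x \<partial>torus_measure) = (\<integral>\<^sup>+x. f x * indicator fundamental_domain x \<partial>lborel)"
  unfolding torus_measure_def by (rule nn_integral_restrict_space) auto

lemma emeasure_unit_box: "emeasure lborel (box 0 (1::real^2)) = 1" "emeasure lborel (cbox 0 (1::real^2)) = 1"
proof -
  have "(1::real^2) \<bullet> b = 1" if "b \<in> Basis" for b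
    using that by (auto simp: Basis_vec_def inner_axis)
  then show "emeasure lborel (box 0 (1::real^2)) = 1" "emeasure lborel (cbox 0 (1::real^2)) = 1"
    by (auto simp: emeasure_lborel_box_eq emeasure_lborel_cbox_eq)
qed

lemma emeasure_fundamental_domain: "emeasure lborel fundamental_domain = 1"
  using emeasure_mono[OF box_subset_fundamental_domain, of lborel]
    emeasure_mono[OF fundamental_domain_subset_cbox, of lborel]
  by (auto simp: emeasure_unit_box)

lemma emeasure_torus_measure_space: "emeasure torus_measure fundamental_domain = 1"
  by (simp add: torus_measure_def emeasure_restrict_space emeasure_fundamental_domain)

interpretation torus: finite_measure torus_measure
  by (rule finite_measureI) (simp add: emeasure_torus_measure_space)

lemma torus_integral_const [simp]: "torus_integral (\<lambda>x. c) = c"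
  by (simp add: torus_integral_def measure_def emeasure_torus_measure_space)

lemma torus_proj_in [simp]: "torus_proj x \<in> fundamental_domain"
  by (simp add: torus_proj_def fundamental_domain_def frac_lt_1)

lemma torus_proj_id: "x \<in> fundamental_domain \<Longrightarrow> torus_proj x = x"
  by (simp add: torus_proj_def fundamental_domain_def vec_eq_iff frac_eq)

lemma torus_proj_diff_lattice: "x - torus_proj x \<in> int_lattice"
  by (simp add: torus_proj_def int_lattice_def frac_def)

lemma torus_proj_add_lattice: "k \<in> int_lattice \<Longrightarrow> torus_proj (x + k) = torus_proj x"
  by (simp add: torus_proj_def int_lattice_def vec_eq_iff frac_add frac_lt_1 iffD2[OF frac_eq_0_iff])

lemma lattice_neg: "k \<in> int_lattice \<Longrightarrow> - k \<in> int_lattice"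
  and lattice_0: "0 \<in> int_lattice"
  and lattice_axis: "axis i 1 \<in> int_lattice"
  by (auto simp: int_lattice_def axis_def)

lemma torus_proj_borel [measurable]: "torus_proj \<in> borel \<rightarrow>\<^sub>M borel"
proof (subst borel_measurable_euclidean_space, safe)
  fix b :: "real^2" assume "b \<in> Basis"
  then obtain i where b: "b = axis i 1" by (auto simp: Basis_vec_def)
  have "(\<lambda>x::real^2. frac (x $ i)) \<in> borel_measurable borel"
    unfolding frac_def by measurable
  then show "(\<lambda>x. torus_proj x \<bullet> b) \<in> borel_measurable borel"
    by (simp add: b inner_axis torus_proj_def)
qed

lemma torus_proj_measurable: "torus_proj \<in> borel \<rightarrow>\<^sub>M torus_measure"
  unfolding torus_measure_def by (rule measurable_restrict_space2) auto

lemma periodicD: "periodic f \<Longrightarrow> k \<in> int_lattice \<Longrightarrow> f (x + k) = f x"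
  by (simp add: periodic_def)

lemma periodic_proj: "periodic f \<Longrightarrow> f (torus_proj x) = f x"
  using periodicD[of f "x - torus_proj x" "torus_proj x"] torus_proj_diff_lattice[of x] by simp

lemma continuous_bounded_on_cbox:
  fixes f :: "real^2 \<Rightarrow> real"
  assumes "continuous_on UNIV f"
  obtains B where "0 < B" "\<And>x. x \<in> cbox 0 1 \<Longrightarrow> \<bar>f x\<bar> \<le> B"
proof -
  have "compact (f ` cbox 0 1)"
    by (intro compact_continuous_image continuous_on_subset[OF assms]) auto
  then have "bounded (f ` cbox 0 1)" by (rule compact_imp_bounded)
  then obtain B where "0 < B" "\<forall>y\<in>f ` cbox 0 1. norm y \<le> B" by (auto simp: bounded_pos)
  then show ?thesis using that[of B] by auto
qed

lemma continuous_periodic_bounded: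
  assumes "continuous_on UNIV f" "periodic f"
  obtains B where "0 < B" "\<And>x. \<bar>f x\<bar> \<le> B"
proof -
  obtain B where B: "0 < B" "\<And>x. x \<in> cbox 0 1 \<Longrightarrow> \<bar>f x\<bar> \<le> B"
    using continuous_bounded_on_cbox[OF assms(1)] by metis
  have "\<bar>f x\<bar> \<le> B" for x
    using B(2)[OF subsetD[OF fundamental_domain_subset_cbox torus_proj_in]] periodic_proj[OF assms(2), of x]
    by metis
  then show ?thesis using that B(1) by blast
qed

lemma continuous_periodic_attains_inf:
  assumes "continuous_on UNIV f" "periodic f"
  obtains x0 where "\<And>x. f x0 \<le> f x"
proof -
  have "\<exists>x0\<in>cbox 0 1. \<forall>x\<in>cbox 0 1. f x0 \<le> f x"
    by (intro continuous_attains_inf continuous_on_subset[OF assms(1)])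
      (auto simp: interval_ne_empty_cart)
  then show ?thesis
    using that fundamental_domain_subset_cbox periodic_proj[OF assms(2)] torus_proj_in
    by (metis subsetD)
qed

lemma continuous_periodic_uniform:
  assumes cont: "continuous_on UNIV f" and per: "periodic f" and "e > 0"
  obtains d where "d > 0" "\<And>x y. norm (x - y) < d \<Longrightarrow> \<bar>f x - f y\<bar> < e"
proof -
  \<comment> \<open>A lattice shift puts \<open>x\<close> into the unit cell; the margin of width 1
    then keeps the equally shifted \<open>y\<close> in the compact square as soon as the two points
    are closer than 1.\<close>
  let ?K = "cbox (-1) 2 :: (real^2) set"
  have "uniformly_continuous_on ?K f"
    by (intro compact_uniformly_continuous continuous_on_subset[OF cont]) auto
  then obtain d where d: "d > 0" "\<And>x y. x \<in> ?K \<Longrightarrow> y \<in> ?K \<Longrightarrow> dist y x < d \<Longrightarrow> dist (f y) (f x) < e"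
    using \<open>e > 0\<close> unfolding uniformly_continuous_on_def by meson
  have "\<bar>f x - f y\<bar> < e" if "norm (x - y) < min d 1" for x y
  proof -
    define k where "k = torus_proj x - x"
    have k: "k \<in> int_lattice" using lattice_neg[OF torus_proj_diff_lattice[of x]] by (simp add: k_def)
    have comp: "\<bar>(x - y) $ i\<bar> < 1" for i
      using component_le_norm_cart[of "x - y" i] that by simp
    have xk: "x + k \<in> fundamental_domain" by (simp add: k_def)
    have "(- 1::real^2) $ i \<le> (x + k) $ i \<and> (x + k) $ i \<le> 2 $ i"
         "(- 1::real^2) $ i \<le> (y + k) $ i \<and> (y + k) $ i \<le> 2 $ i" for i
    proof -
      have "0 \<le> (x + k) $ i" "(x + k) $ i < 1" using xk by (auto simp: fundamental_domain_def)
      then show "(- 1::real^2) $ i \<le> (x + k) $ i \<and> (x + k) $ i \<le> 2 $ i"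
         "(- 1::real^2) $ i \<le> (y + k) $ i \<and> (y + k) $ i \<le> 2 $ i"
        using comp[of i] by (auto simp: abs_less_iff)
    qed
    then have 1: "x + k \<in> ?K" and 2: "y + k \<in> ?K"
      unfolding mem_box_cart by blast+
    have "dist (f (x + k)) (f (y + k)) < e"
      using d(2)[OF 2 1] that by (simp add: dist_norm)
    then show ?thesis using periodicD[OF per k] by (simp add: dist_norm)
  qed
  then show ?thesis using that[of "min d 1"] d(1) by simp
qed

lemma torus_integrable:
  fixes f :: "real^2 \<Rightarrow> real"
  assumes "continuous_on UNIV f"
  shows "integrable torus_measure f"
proof -
  obtain B where B: "\<And>x. x \<in> cbox 0 1 \<Longrightarrow> \<bar>f x\<bar> \<le> B"
    using continuous_bounded_on_cbox[OF assms] by metis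
  show ?thesis
    by (rule torus.integrable_const_bound[where B=B])
      (use B fundamental_domain_subset_cbox in
        \<open>auto intro!: measurable_torus_measure1 borel_measurable_continuous_onI assms AE_I2\<close>)
qed

text \<open>The half-open cell and the closed square differ by a null set. The closed square gives
  access to results on Henstock-Kurzweil integrals: exchange of integrals of continuous functions,
  the Leibniz rule, and the vanishing of nonnegative continuous integrands.\<close>

lemma torus_integral_eq_integral:
  assumes "continuous_on UNIV f"
  shows "torus_integral f = integral (cbox 0 1) f"
proof -
  have ci: "set_integrable lborel (cbox 0 1) f"
    unfolding set_integrable_def by (rule borel_integrable_compact) (auto intro: continuous_on_subset[OF assms])
  have "emeasure lborel (cbox 0 (1::real^2) - box 0 1) = 0"
    by (subst emeasure_Diff) (auto simp: emeasure_unit_box box_subset_cbox)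
  then have "cbox 0 (1::real^2) - box 0 1 \<in> null_sets lborel" by auto
  then have ae: "AE x in lborel. x \<notin> cbox 0 (1::real^2) - box 0 1" by (rule AE_not_in)
  have "torus_integral f = (\<integral>x. indicator fundamental_domain x *\<^sub>R f x \<partial>lborel)"
    unfolding torus_integral_def torus_measure_def by (rule integral_restrict_space) auto
  also have "\<dots> = (\<integral>x. indicator (cbox 0 1) x *\<^sub>R f x \<partial>lborel)"
  proof (rule integral_cong_AE)
    show "AE x in lborel. indicator fundamental_domain x *\<^sub>R f x = indicator (cbox 0 1) x *\<^sub>R f x"
      using ae box_subset_fundamental_domain fundamental_domain_subset_cbox
      by (auto elim!: eventually_mono simp: indicator_def)
  qed (use borel_measurable_continuous_onI[OF assms] in auto)
  also have "\<dots> = integral (cbox 0 1) f"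
    using set_borel_integral_eq_integral(2)[OF ci] by (simp add: set_lebesgue_integral_def)
  finally show ?thesis .
qed

section \<open>Lattice tiling and translation invariance of the torus measure\<close>

lemma countable_lattice: "countable int_lattice"
proof -
  have "int_lattice \<subseteq> (\<lambda>(a, b). vector [real_of_int a, real_of_int b]) ` UNIV"
  proof
    fix k :: "real^2" assume "k \<in> int_lattice"
    then obtain a b where "k $ 1 = of_int a" "k $ 2 = of_int b"
      by (auto simp: int_lattice_def) (metis Ints_cases)
    then have "k = vector [real_of_int a, real_of_int b]" by (simp add: vec_eq_iff forall_2)
    then show "k \<in> (\<lambda>(a, b). vector [real_of_int a, real_of_int b]) ` UNIV" by auto
  qed
  then show ?thesis by (rule countable_subset) auto
qed

text \<open>The translates of the half-open cell tile the plane: only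
  \<open>k = x - torus_proj x\<close> puts \<open>x - k\<close> into the cell. Written as an
  integral over counting measure, the sum can be exchanged with Lebesgue integrals.\<close>

lemma lattice_tiling: "(\<integral>\<^sup>+k. indicator fundamental_domain (x - k) \<partial>count_space int_lattice) = (1::ennreal)"
proof -
  let ?k = "x - torus_proj x"
  have eq: "x - k \<in> fundamental_domain \<longleftrightarrow> k = ?k" if "k \<in> int_lattice" for k
    using torus_proj_add_lattice[OF lattice_neg[OF that], of x] torus_proj_id[of "x - k"] torus_proj_in[of x]
    by force
  have "(\<integral>\<^sup>+k. indicator fundamental_domain (x - k) \<partial>count_space int_lattice)
      = (\<integral>\<^sup>+k. indicator {?k} k \<partial>count_space int_lattice)"
    using eq by (intro nn_integral_cong) (auto simp: indicator_def)
  also have "\<dots> = 1"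
    using torus_proj_diff_lattice[of x] by (subst nn_integral_indicator) auto
  finally show ?thesis .
qed

lemma nn_integral_lborel_translation:
  fixes f :: "real^2 \<Rightarrow> ennreal"
  assumes [measurable]: "f \<in> borel_measurable borel"
  shows "(\<integral>\<^sup>+x. f (x + v) \<partial>lborel) = (\<integral>\<^sup>+x. f x \<partial>lborel)"
proof -
  have "distr lborel borel ((+) v) = lborel"
    by (rule lborel_distr_plus)
  then have "(\<integral>\<^sup>+x. f x \<partial>lborel) = (\<integral>\<^sup>+x. f x \<partial>distr lborel borel ((+) v))" by simp
  also have "\<dots> = (\<integral>\<^sup>+x. f (v + x) \<partial>lborel)" by (subst nn_integral_distr) auto
  finally show ?thesis by (simp add: add.commute)
qed

text \<open>Both sides equal the integral over all \<open>x\<close> and lattice points \<open>k\<close> with \<open>x - v\<close> and \<open>x - k\<close>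
  in the fundamental domain.\<close>

lemma nn_integral_torus_translation:
  fixes f :: "real^2 \<Rightarrow> ennreal"
  assumes [measurable]: "f \<in> borel_measurable borel"
    and per: "\<And>x k. k \<in> int_lattice \<Longrightarrow> f (x + k) = f x"
  shows "(\<integral>\<^sup>+x. f (x + v) \<partial>torus_measure) = (\<integral>\<^sup>+x. f x \<partial>torus_measure)"
proof -
  let ?D = "indicator fundamental_domain :: real^2 \<Rightarrow> ennreal"
  note c = nn_integral_count_space_nn_integral[OF countable_lattice]
  have "(\<integral>\<^sup>+x. f (x + v) \<partial>torus_measure) = (\<integral>\<^sup>+x. f ((x - v) + v) * ?D (x - v) \<partial>lborel)"
    unfolding nn_integral_torus_measure
    using nn_integral_lborel_translation[of "\<lambda>x. f (x + v) * ?D x" "-v"] by simp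
  also have "\<dots> = (\<integral>\<^sup>+x. (\<integral>\<^sup>+k. f x * ?D (x - v) * ?D (x - k) \<partial>count_space int_lattice) \<partial>lborel)"
    by (simp add: nn_integral_cmult lattice_tiling)
  also have "\<dots> = (\<integral>\<^sup>+k. (\<integral>\<^sup>+x. f x * ?D (x - v) * ?D (x - k) \<partial>lborel) \<partial>count_space int_lattice)"
    by (rule c) measurable
  also have "\<dots> = (\<integral>\<^sup>+k. (\<integral>\<^sup>+x. f x * ?D (x + k - v) * ?D x \<partial>lborel) \<partial>count_space int_lattice)"
  proof (rule nn_integral_cong)
    fix k assume "k \<in> space (count_space int_lattice)"
    then have k: "k \<in> int_lattice" by simp
    have "(\<integral>\<^sup>+x. f x * ?D (x - v) * ?D (x - k) \<partial>lborel)
        = (\<integral>\<^sup>+x. f (x + k) * ?D (x + k - v) * ?D (x + k - k) \<partial>lborel)"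
      by (rule nn_integral_lborel_translation[symmetric]) measurable
    then show "(\<integral>\<^sup>+x. f x * ?D (x - v) * ?D (x - k) \<partial>lborel) = (\<integral>\<^sup>+x. f x * ?D (x + k - v) * ?D x \<partial>lborel)"
      by (simp add: per[OF k])
  qed
  also have "\<dots> = (\<integral>\<^sup>+x. (\<integral>\<^sup>+k. f x * ?D (x + k - v) * ?D x \<partial>count_space int_lattice) \<partial>lborel)"
    by (rule c[symmetric]) measurable
  also have "\<dots> = (\<integral>\<^sup>+x. f x * ?D x \<partial>lborel)"
  proof (rule nn_integral_cong)
    fix x
    have bij: "bij_betw uminus int_lattice int_lattice"
      by (rule bij_betwI[of _ _ _ uminus]) (auto simp: lattice_neg)
    have "(\<integral>\<^sup>+k. ?D (x + k - v) \<partial>count_space int_lattice) = (\<integral>\<^sup>+k. ?D ((x - v) - k) \<partial>count_space int_lattice)"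
      using nn_integral_bij_count_space[OF bij, of "\<lambda>k. ?D (x + k - v)"] by (simp add: algebra_simps)
    then have "(\<integral>\<^sup>+k. ?D (x + k - v) \<partial>count_space int_lattice) = 1" by (simp add: lattice_tiling)
    then have "f x * ?D x * (\<integral>\<^sup>+k. ?D (x + k - v) \<partial>count_space int_lattice) = f x * ?D x" by simp
    moreover have "f x * ?D x * (\<integral>\<^sup>+k. ?D (x + k - v) \<partial>count_space int_lattice)
      = (\<integral>\<^sup>+k. f x * ?D x * ?D (x + k - v) \<partial>count_space int_lattice)"
      by (rule nn_integral_cmult[symmetric]) simp
    ultimately show "(\<integral>\<^sup>+k. f x * ?D (x + k - v) * ?D x \<partial>count_space int_lattice) = f x * ?D x"
      by (simp add: ac_simps)
  qed
  finally show ?thesis by (simp add: nn_integral_torus_measure)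
qed

text \<open>An indicator of a subset of the cell is not periodic; composing it with
  \<open>torus_proj\<close> makes it so, and inside the cell this changes nothing.\<close>

lemma torus_distr_translation: "distr torus_measure torus_measure (\<lambda>x. torus_proj (x + v)) = torus_measure"
proof (rule measure_eqI)
  fix A assume "A \<in> sets (distr torus_measure torus_measure (\<lambda>x. torus_proj (x + v)))"
  then have A: "A \<in> sets torus_measure" by simp
  then have [measurable]: "A \<in> sets borel" by (simp add: sets_torus_measure)
  have m: "(\<lambda>x. torus_proj (x + v)) \<in> torus_measure \<rightarrow>\<^sub>M torus_measure"
    by (rule measurable_torus_measure1, rule measurable_compose[OF _ torus_proj_measurable]) measurable
  have "emeasure (distr torus_measure torus_measure (\<lambda>x. torus_proj (x + v))) A
    = (\<integral>\<^sup>+x. indicator A x \<partial>distr torus_measure torus_measure (\<lambda>x. torus_proj (x + v)))"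
    using A by simp
  also have "\<dots> = (\<integral>\<^sup>+x. indicator A (torus_proj (x + v)) \<partial>torus_measure)"
    using A by (intro nn_integral_distr m) auto
  also have "\<dots> = (\<integral>\<^sup>+x. indicator A (torus_proj x) \<partial>torus_measure)"
    by (rule nn_integral_torus_translation[where f="\<lambda>x. indicator A (torus_proj x)"])
      (auto simp: torus_proj_add_lattice)
  also have "\<dots> = (\<integral>\<^sup>+x. indicator A x \<partial>torus_measure)"
    by (intro nn_integral_cong) (simp add: torus_proj_id)
  also have "\<dots> = emeasure torus_measure A" using A by simp
  finally show "emeasure (distr torus_measure torus_measure (\<lambda>x. torus_proj (x + v))) A = emeasure torus_measure A" .
qed simp

lemma torus_integral_translation:
  assumes [measurable]: "f \<in> borel_measurable borel" and "periodic f"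
  shows "torus_integral (\<lambda>x. f (x + v)) = torus_integral f"
proof -
  have m: "(\<lambda>x. torus_proj (x + v)) \<in> torus_measure \<rightarrow>\<^sub>M torus_measure"
    by (rule measurable_torus_measure1, rule measurable_compose[OF _ torus_proj_measurable]) measurable
  have "torus_integral f = (\<integral>x. f x \<partial>distr torus_measure torus_measure (\<lambda>x. torus_proj (x + v)))"
    by (simp add: torus_integral_def torus_distr_translation)
  also have "\<dots> = (\<integral>x. f (torus_proj (x + v)) \<partial>torus_measure)"
    by (intro integral_distr m measurable_torus_measure1) measurable
  finally show ?thesis by (simp add: periodic_proj[OF assms(2)] torus_integral_def)
qed

section \<open>Smooth periodic functions\<close>

lemma Ck_on_SucD: "Ck_on (Suc n) S f \<Longrightarrow> Ck_on n S f"
proof (induction n arbitrary: f)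
  case 0
  then show ?case
    by (auto intro!: continuous_at_imp_continuous_on differentiable_imp_continuous_within)
next
  case (Suc n)
  have "Ck_on n S (\<lambda>x. frechet_derivative f (at x) v)" for v
    using Suc.prems by (intro Suc.IH) simp
  then show ?case using Suc.prems by simp
qed

lemma Ck_on_const: "Ck_on n S (\<lambda>x. c)"
  by (induction n arbitrary: c) (auto simp: frechet_derivative_const)

lemma Ck_on_add:
  "Ck_on n UNIV f \<Longrightarrow> Ck_on n UNIV g \<Longrightarrow> Ck_on n UNIV (\<lambda>x. f x + g x)"
proof (induction n arbitrary: f g)
  case 0
  then show ?case by (auto intro: continuous_on_add)
next
  case (Suc n)
  then have d: "f differentiable at x" "g differentiable at x" for x by auto
  have "frechet_derivative (\<lambda>x. f x + g x) (at x) v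
      = frechet_derivative f (at x) v + frechet_derivative g (at x) v" for x v
    using has_derivative_add[OF d(1)[unfolded frechet_derivative_works] d(2)[unfolded frechet_derivative_works], of x]
    by (metis frechet_derivative_at)
  then show ?case using Suc d by simp
qed

lemma frechet_derivative_times:
  fixes f g :: "'a::real_normed_vector \<Rightarrow> real"
  assumes "f differentiable at x" "g differentiable at x"
  shows "frechet_derivative (\<lambda>x. f x * g x) (at x) v
      = f x * frechet_derivative g (at x) v + frechet_derivative f (at x) v * g x"
  using has_derivative_mult[OF assms(1)[unfolded frechet_derivative_works] assms(2)[unfolded frechet_derivative_works]]
  by (metis frechet_derivative_at)

lemma Ck_on_mult:
  fixes f g :: "'a::real_normed_vector \<Rightarrow> real"
  shows "Ck_on n UNIV f \<Longrightarrow> Ck_on n UNIV g \<Longrightarrow> Ck_on n UNIV (\<lambda>x. f x * g x)"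
proof (induction n arbitrary: f g)
  case 0
  then show ?case by (auto intro: continuous_on_mult)
next
  case (Suc n)
  then have d: "f differentiable at x" "g differentiable at x" for x by auto
  have "Ck_on n UNIV f" "Ck_on n UNIV g" using Suc.prems Ck_on_SucD by blast+
  then show ?case using Suc d
    by (auto simp: frechet_derivative_times intro!: Ck_on_add)
qed

lemma torus_smooth_const: "torus_smooth (\<lambda>x. c)"
  by (simp add: torus_smooth_def periodic_def smooth_on_def Ck_on_const)

lemma torus_smooth_add: "torus_smooth f \<Longrightarrow> torus_smooth g \<Longrightarrow> torus_smooth (\<lambda>x. f x + g x)"
  by (simp add: torus_smooth_def periodic_def smooth_on_def Ck_on_add)

lemma torus_smooth_mult: "torus_smooth f \<Longrightarrow> torus_smooth g \<Longrightarrow> torus_smooth (\<lambda>x. f x * g x)"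
  by (simp add: torus_smooth_def periodic_def smooth_on_def Ck_on_mult)

lemma torus_smooth_uminus: "torus_smooth f \<Longrightarrow> torus_smooth (\<lambda>x. - f x)"
  using torus_smooth_mult[OF torus_smooth_const[of "-1"], of f] by simp

lemma torus_smooth_diff: "torus_smooth f \<Longrightarrow> torus_smooth g \<Longrightarrow> torus_smooth (\<lambda>x. f x - g x)"
  using torus_smooth_add[OF _ torus_smooth_uminus, of f g] by simp

lemma torus_smooth_periodic: "torus_smooth f \<Longrightarrow> periodic f"
  by (simp add: torus_smooth_def)

lemma torus_smooth_continuous: "torus_smooth f \<Longrightarrow> continuous_on UNIV f"
  by (metis torus_smooth_def smooth_on_def Ck_on.simps(1))

lemma torus_smooth_differentiable: "torus_smooth f \<Longrightarrow> f differentiable at x"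
  by (metis torus_smooth_def smooth_on_def Ck_on.simps(2) UNIV_I)

lemma torus_smooth_has_derivative:
  "torus_smooth f \<Longrightarrow> (f has_derivative frechet_derivative f (at x)) (at x)"
  using torus_smooth_differentiable frechet_derivative_works by blast

lemma torus_smooth_partial:
  assumes "torus_smooth f"
  shows "torus_smooth (partial_deriv i f)"
proof -
  have "frechet_derivative f (at (x + k)) = frechet_derivative f (at x)" if "k \<in> int_lattice" for x k
  proof -
    have "((\<lambda>y. f (y + k)) has_derivative frechet_derivative f (at (x + k))) (at x)"
      using torus_smooth_has_derivative[OF assms, of "x + k"]
      by (rule has_derivative_compose[of "\<lambda>y. y + k" "\<lambda>y. y" x UNIV f, rotated, unfolded o_def])
        (auto intro!: derivative_eq_intros)
    then have "(f has_derivative frechet_derivative f (at (x + k))) (at x)"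
      using periodicD[OF torus_smooth_periodic[OF assms] that] by simp
    then show ?thesis by (rule frechet_derivative_at)
  qed
  moreover have "Ck_on n UNIV (partial_deriv i f)" for n
  proof -
    have "Ck_on (Suc n) UNIV f" using assms by (simp only: torus_smooth_def smooth_on_def)
    then show ?thesis by (simp add: partial_deriv_def[abs_def])
  qed
  ultimately show ?thesis
    by (simp add: torus_smooth_def periodic_def smooth_on_def partial_deriv_def)
qed

lemmas torus_smooth_intros = torus_smooth_const torus_smooth_add torus_smooth_mult
  torus_smooth_uminus torus_smooth_diff torus_smooth_partial

lemma partial_deriv_add:
  "torus_smooth f \<Longrightarrow> torus_smooth g \<Longrightarrow>
    partial_deriv i (\<lambda>x. f x + g x) x = partial_deriv i f x + partial_deriv i g x"
  unfolding partial_deriv_def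
  by (metis (no_types) has_derivative_add torus_smooth_has_derivative frechet_derivative_at)

lemma partial_deriv_mult:
  "torus_smooth f \<Longrightarrow> torus_smooth g \<Longrightarrow>
    partial_deriv i (\<lambda>x. f x * g x) x = f x * partial_deriv i g x + partial_deriv i f x * g x"
  unfolding partial_deriv_def by (simp add: frechet_derivative_times torus_smooth_differentiable)

lemma partial_deriv_const: "partial_deriv i (\<lambda>x. c) x = 0"
  by (simp add: partial_deriv_def)

lemma partial_deriv_uminus:
  "torus_smooth f \<Longrightarrow> partial_deriv i (\<lambda>x. - f x) x = - partial_deriv i f x"
  using partial_deriv_mult[OF torus_smooth_const[of "-1"], of f i x] by (simp add: partial_deriv_const)

lemma poisson_eq:
  "poisson f g x = partial_deriv 1 f x * partial_deriv 2 g x - partial_deriv 2 f x * partial_deriv 1 g x"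
  by (simp add: poisson_def perp_gradient_def gradient_def inner_vec_def sum_2)

lemma torus_smooth_poisson:
  "torus_smooth f \<Longrightarrow> torus_smooth g \<Longrightarrow> torus_smooth (poisson f g)"
  unfolding poisson_eq[abs_def] by (intro torus_smooth_intros)

text \<open>A one-directional notion of derivative, made for the primitives that arise by
  integrating along lines: these are continuous and differentiable in that one direction, but not
  known to be Frechet differentiable.\<close>

definition has_partial :: "2 \<Rightarrow> (real^2 \<Rightarrow> real) \<Rightarrow> (real^2 \<Rightarrow> real) \<Rightarrow> bool" where
  "has_partial i f g \<longleftrightarrow> (\<forall>x. ((\<lambda>s. f (x + s *\<^sub>R axis i 1)) has_real_derivative g x) (at 0))"

lemma has_partialD:
  assumes "has_partial i f g"
  shows "((\<lambda>s. f (x + s *\<^sub>R axis i 1)) has_real_derivative g (x + t *\<^sub>R axis i 1)) (at t)"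
proof -
  have "((\<lambda>s. f ((x + t *\<^sub>R axis i 1) + s *\<^sub>R axis i 1)) has_real_derivative g (x + t *\<^sub>R axis i 1)) (at 0)"
    using assms by (simp add: has_partial_def)
  then show ?thesis
    using DERIV_shift[of "\<lambda>s. f (x + s *\<^sub>R axis i 1)" "g (x + t *\<^sub>R axis i 1)" 0 t]
    by (simp add: algebra_simps)
qed

lemma has_partial_smooth: "torus_smooth f \<Longrightarrow> has_partial i f (partial_deriv i f)"
  unfolding has_partial_def partial_deriv_def
proof
  fix x assume f: "torus_smooth f"
  let ?D = "frechet_derivative f (at x)"
  have "(f has_derivative ?D) (at (x + 0 *\<^sub>R axis i 1))"
    using torus_smooth_has_derivative[OF f, of x] by simp
  then have "((\<lambda>s. f (x + s *\<^sub>R axis i 1)) has_derivative (\<lambda>s. ?D (s *\<^sub>R axis i 1))) (at 0)"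
    by (rule has_derivative_compose[rotated]) (auto intro!: derivative_eq_intros)
  moreover have "?D (s *\<^sub>R axis i 1) = s * ?D (axis i 1)" for s
    using linear_scale[OF has_derivative_linear[OF torus_smooth_has_derivative[OF f]]] by simp
  ultimately show "((\<lambda>s. f (x + s *\<^sub>R axis i 1)) has_real_derivative ?D (axis i 1)) (at 0)"
    by (simp add: has_field_derivative_def mult.commute[of _ "?D (axis i 1)"])
qed

text \<open>The mean value theorem turns the error into a difference of values of \<open>g\<close>,
  which is uniformly continuous by periodicity. What matters is that \<open>d\<close> does not
  depend on \<open>x\<close>: the estimate can be integrated and can serve as a pointwise bound on
  densities.\<close>

lemma has_partial_uniform:
  assumes fg: "has_partial i f g" and g: "continuous_on UNIV g" "periodic g" and "e > 0"
  obtains d where "d > 0" "\<And>x t. \<bar>t\<bar> < d \<Longrightarrow> \<bar>f (x + t *\<^sub>R axis i 1) - f x - t * g x\<bar> \<le> e * \<bar>t\<bar>"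
proof -
  obtain d where d: "d > 0" "\<And>x y. norm (x - y) < d \<Longrightarrow> \<bar>g x - g y\<bar> < e"
    using continuous_periodic_uniform[OF g \<open>e > 0\<close>] by metis
  have "\<bar>f (x + t *\<^sub>R axis i 1) - f x - t * g x\<bar> \<le> e * \<bar>t\<bar>" if "\<bar>t\<bar> < d" for x t
  proof (cases "t = 0")
    case False
    have "\<exists>u. \<bar>u\<bar> < \<bar>t\<bar> \<and> f (x + t *\<^sub>R axis i 1) - f x = t * g (x + u *\<^sub>R axis i 1)"
    proof (cases "t > 0")
      case True
      from MVT2[OF this has_partialD[OF fg, of x]]
      obtain u where "0 < u" "u < t" "f (x + t *\<^sub>R axis i 1) - f x = t * g (x + u *\<^sub>R axis i 1)"
        by auto
      then show ?thesis by (intro exI[of _ u]) auto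
    next
      case False
      with \<open>t \<noteq> 0\<close> have "t < 0" by simp
      from MVT2[OF this has_partialD[OF fg, of x]]
      obtain u where "t < u" "u < 0" "f x - f (x + t *\<^sub>R axis i 1) = - t * g (x + u *\<^sub>R axis i 1)"
        by auto
      then show ?thesis by (intro exI[of _ u]) auto
    qed
    then obtain u where u: "\<bar>u\<bar> < \<bar>t\<bar>" "f (x + t *\<^sub>R axis i 1) - f x = t * g (x + u *\<^sub>R axis i 1)" by blast
    have "\<bar>g (x + u *\<^sub>R axis i 1) - g x\<bar> < e"
      using u(1) that by (intro d(2)) (simp add: norm_axis_1)
    then have "\<bar>t\<bar> * \<bar>g (x + u *\<^sub>R axis i 1) - g x\<bar> \<le> \<bar>t\<bar> * e" by (intro mult_left_mono) auto
    moreover have "f (x + t *\<^sub>R axis i 1) - f x - t * g x = t * (g (x + u *\<^sub>R axis i 1) - g x)"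
      using u(2) by (simp add: algebra_simps)
    ultimately show ?thesis by (simp add: abs_mult mult.commute)
  qed simp
  then show ?thesis using that d(1) by blast
qed

section \<open>Integration by parts and mixed derivatives\<close>

lemma continuous_on_shift:
  "continuous_on UNIV f \<Longrightarrow> continuous_on UNIV (\<lambda>x. f (x + v))" for f :: "real^2 \<Rightarrow> real"
  by (rule continuous_on_compose2[where g=f]) (auto intro!: continuous_intros)

lemma periodic_shift: "periodic f \<Longrightarrow> periodic (\<lambda>x. f (x + v))"
  unfolding periodic_def
proof (intro allI ballI)
  fix x k assume "\<forall>x. \<forall>k\<in>int_lattice. f (x + k) = f x" "k \<in> int_lattice"
  then have "f ((x + v) + k) = f (x + v)" by blast
  then show "f (x + k + v) = f (x + v)" by (simp add: ac_simps)
qed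

lemma periodic_add: "periodic f \<Longrightarrow> periodic g \<Longrightarrow> periodic (\<lambda>x. f x + g x)"
  and periodic_diff: "periodic f \<Longrightarrow> periodic g \<Longrightarrow> periodic (\<lambda>x. f x - g x)"
  and periodic_mult: "periodic f \<Longrightarrow> periodic g \<Longrightarrow> periodic (\<lambda>x. f x * g x)"
  by (simp_all add: periodic_def)

lemma torus_integral_add:
  "continuous_on UNIV f \<Longrightarrow> continuous_on UNIV g \<Longrightarrow>
    torus_integral (\<lambda>x. f x + g x) = torus_integral f + torus_integral g"
  unfolding torus_integral_def by (intro Bochner_Integration.integral_add torus_integrable)

lemma torus_integral_diff:
  "continuous_on UNIV f \<Longrightarrow> continuous_on UNIV g \<Longrightarrow>
    torus_integral (\<lambda>x. f x - g x) = torus_integral f - torus_integral g"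
  unfolding torus_integral_def by (intro Bochner_Integration.integral_diff torus_integrable)

lemma torus_integral_cmult: "torus_integral (\<lambda>x. c * f x) = c * torus_integral f"
  unfolding torus_integral_def by simp

lemma torus_integral_uminus: "torus_integral (\<lambda>x. - f x) = - torus_integral f"
  unfolding torus_integral_def by simp

lemma torus_integral_mono:
  "continuous_on UNIV f \<Longrightarrow> continuous_on UNIV g \<Longrightarrow> (\<And>x. f x \<le> g x) \<Longrightarrow> torus_integral f \<le> torus_integral g"
  unfolding torus_integral_def by (intro integral_mono torus_integrable)

lemma torus_integral_abs_le:
  assumes "continuous_on UNIV f" "\<And>x. \<bar>f x\<bar> \<le> c"
  shows "\<bar>torus_integral f\<bar> \<le> c"
proof -
  have "torus_integral f \<le> torus_integral (\<lambda>x. c)" "torus_integral (\<lambda>x. - c) \<le> torus_integral f"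
    by (rule torus_integral_mono; use assms in \<open>simp add: abs_le_iff minus_le_iff\<close>)+
  then show ?thesis by simp
qed

text \<open>By translation invariance the difference quotients of \<open>f\<close> have integral 0,
  and they converge uniformly to \<open>g\<close>.\<close>

lemma torus_integral_partial:
  assumes fg: "has_partial i f g" and f: "continuous_on UNIV f" "periodic f"
    and g: "continuous_on UNIV g" "periodic g"
  shows "torus_integral g = 0"
proof -
  have "\<bar>torus_integral g\<bar> \<le> e" if "e > 0" for e
  proof -
    obtain d where d: "d > 0" "\<And>x t. \<bar>t\<bar> < d \<Longrightarrow> \<bar>f (x + t *\<^sub>R axis i 1) - f x - t * g x\<bar> \<le> e * \<bar>t\<bar>"
      using has_partial_uniform[OF fg g \<open>e > 0\<close>] by metis
    define t where "t = d / 2"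
    have t: "0 < t" "\<bar>t\<bar> < d" using d(1) by (auto simp: t_def)
    have "torus_integral (\<lambda>x. f (x + t *\<^sub>R axis i 1)) = torus_integral f"
      by (rule torus_integral_translation) (auto intro: borel_measurable_continuous_onI f)
    then have "torus_integral (\<lambda>x. f (x + t *\<^sub>R axis i 1) - f x - t * g x) = - t * torus_integral g"
      using f(1) g(1) continuous_on_shift[OF f(1)] by (simp add: torus_integral_diff torus_integral_cmult continuous_intros)
    moreover have "\<bar>torus_integral (\<lambda>x. f (x + t *\<^sub>R axis i 1) - f x - t * g x)\<bar> \<le> e * \<bar>t\<bar>"
      by (intro torus_integral_abs_le d(2) t continuous_intros f(1) g(1) continuous_on_shift[OF f(1)])
    ultimately show ?thesis using t by (simp add: abs_mult)
  qed
  then have "\<bar>torus_integral g\<bar> \<le> 0" by (rule field_le_epsilon) simp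
  then show ?thesis by simp
qed

lemma has_partial_mult:
  "has_partial i f f' \<Longrightarrow> has_partial i g g' \<Longrightarrow> has_partial i (\<lambda>x. f x * g x) (\<lambda>x. f' x * g x + g' x * f x)"
  unfolding has_partial_def by (auto intro!: derivative_eq_intros)

lemma has_partial_shift: "has_partial i f g \<Longrightarrow> has_partial i (\<lambda>x. f (x + v)) (\<lambda>x. g (x + v))"
  unfolding has_partial_def
proof
  fix x assume "\<forall>x. ((\<lambda>s. f (x + s *\<^sub>R axis i 1)) has_real_derivative g x) (at 0)"
  then have "((\<lambda>s. f ((x + v) + s *\<^sub>R axis i 1)) has_real_derivative g (x + v)) (at 0)" by blast
  then show "((\<lambda>s. f (x + s *\<^sub>R axis i 1 + v)) has_real_derivative g (x + v)) (at 0)"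
    by (simp add: ac_simps)
qed

lemma has_partial_diff:
  "has_partial i f f' \<Longrightarrow> has_partial i g g' \<Longrightarrow> has_partial i (\<lambda>x. f x - g x) (\<lambda>x. f' x - g' x)"
  unfolding has_partial_def by (auto intro!: derivative_eq_intros)

lemma torus_integral_by_parts:
  assumes "has_partial i f f'" "has_partial i g g'"
    and c: "continuous_on UNIV f" "continuous_on UNIV f'" "continuous_on UNIV g" "continuous_on UNIV g'"
    and p: "periodic f" "periodic f'" "periodic g" "periodic g'"
  shows "torus_integral (\<lambda>x. f x * g' x) = - torus_integral (\<lambda>x. f' x * g x)"
proof -
  have "torus_integral (\<lambda>x. f' x * g x + g' x * f x) = 0"
    by (rule torus_integral_partial[OF has_partial_mult[OF assms(1,2)]])
      (intro continuous_intros periodic_add periodic_mult c p)+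
  then show ?thesis
    using c by (simp add: torus_integral_add continuous_intros mult.commute)
qed

text \<open>Symmetry of the mixed second derivatives in integrated form: replacing \<open>\<partial>\<^sub>1 f\<close> by a
  difference quotient, integration by parts only involves \<open>\<partial>\<^sub>2\<close>.\<close>

lemma torus_integral_mixed:
  assumes f: "torus_smooth f" and g: "torus_smooth g"
  shows "torus_integral (\<lambda>x. partial_deriv 1 f x * partial_deriv 2 g x)
       = torus_integral (\<lambda>x. partial_deriv 2 f x * partial_deriv 1 g x)" (is "?L = ?R")
proof -
  note smooth = f g torus_smooth_partial[OF f] torus_smooth_partial[OF g]
  note cont = smooth[THEN torus_smooth_continuous]
  note per = smooth[THEN torus_smooth_periodic]
  obtain A where A: "A > 0" "\<And>x. \<bar>partial_deriv 2 g x\<bar> \<le> A"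
    using continuous_periodic_bounded[OF cont(4) per(4), of 2] by metis
  obtain B where B: "B > 0" "\<And>x. \<bar>partial_deriv 2 f x\<bar> \<le> B"
    using continuous_periodic_bounded[OF cont(3) per(3), of 2] by metis
  have "\<bar>?L - ?R\<bar> \<le> e * (A + B)" if "e > 0" for e
  proof -
    obtain d1 where d1: "d1 > 0"
      "\<And>x t. \<bar>t\<bar> < d1 \<Longrightarrow> \<bar>f (x + t *\<^sub>R axis 1 1) - f x - t * partial_deriv 1 f x\<bar> \<le> e * \<bar>t\<bar>"
      using has_partial_uniform[OF has_partial_smooth[OF f, of 1] cont(3) per(3) \<open>e > 0\<close>] by metis
    obtain d2 where d2: "d2 > 0"
      "\<And>x t. \<bar>t\<bar> < d2 \<Longrightarrow> \<bar>g (x + t *\<^sub>R axis 1 1) - g x - t * partial_deriv 1 g x\<bar> \<le> e * \<bar>t\<bar>"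
      using has_partial_uniform[OF has_partial_smooth[OF g, of 1] cont(4) per(4) \<open>e > 0\<close>] by metis
    define t where "t = min d1 d2 / 2"
    have t: "0 < t" "\<bar>t\<bar> < d1" "\<bar>-t\<bar> < d2" using d1(1) d2(1) by (auto simp: t_def)
    define v where "v = t *\<^sub>R axis (1::2) (1::real)"
    note cs = cont cont[THEN continuous_on_shift]
    have "has_partial 2 (\<lambda>x. f (x + v) - f x) (\<lambda>x. partial_deriv 2 f (x + v) - partial_deriv 2 f x)"
      by (rule has_partial_diff[OF has_partial_shift[OF has_partial_smooth[OF f]] has_partial_smooth[OF f]])
    then have "torus_integral (\<lambda>x. (f (x + v) - f x) * partial_deriv 2 g x)
        = - torus_integral (\<lambda>x. (partial_deriv 2 f (x + v) - partial_deriv 2 f x) * g x)"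
      by (rule torus_integral_by_parts[OF _ has_partial_smooth[OF g]])
        (intro continuous_on_diff cs periodic_diff per per[THEN periodic_shift])+
    also have "\<dots> = torus_integral (\<lambda>x. partial_deriv 2 f x * g x)
        - torus_integral (\<lambda>x. partial_deriv 2 f (x + v) * g x)"
      by (simp add: left_diff_distrib torus_integral_diff continuous_intros cs)
    \<comment> \<open>Moving the shift from \<open>f\<close> to \<open>g\<close> leaves a backward
      difference of \<open>g\<close>, which is close to \<open>- t\<close> times its partial
      derivative in direction 1.\<close>
    also have "torus_integral (\<lambda>x. partial_deriv 2 f (x + v) * g x)
        = torus_integral (\<lambda>x. partial_deriv 2 f x * g (x + - v))"
      using torus_integral_translation[of "\<lambda>x. partial_deriv 2 f x * g (x + - v)" v]
        borel_measurable_continuous_onI[OF continuous_on_mult[OF cont(3) continuous_on_shift[OF cont(2), of "-v"]], of 2]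
        periodic_mult[OF per(3) periodic_shift[OF per(2), of "-v"], of 2]
      by simp
    finally have X: "torus_integral (\<lambda>x. (f (x + v) - f x) * partial_deriv 2 g x)
      = torus_integral (\<lambda>x. partial_deriv 2 f x * g x) - torus_integral (\<lambda>x. partial_deriv 2 f x * g (x + - v))" .
    note ci = continuous_on_mult continuous_on_diff continuous_on_add continuous_on_const continuous_on_minus
      cont(1,2) cont(3,4)[of 1] cont(3,4)[of 2] cont(1,2)[THEN continuous_on_shift]
    have "torus_integral (\<lambda>x. (f (x + v) - f x - t * partial_deriv 1 f x) * partial_deriv 2 g x)
      = torus_integral (\<lambda>x. (f (x + v) - f x) * partial_deriv 2 g x - t * (partial_deriv 1 f x * partial_deriv 2 g x))"
      by (simp add: algebra_simps)
    also have "\<dots> = torus_integral (\<lambda>x. (f (x + v) - f x) * partial_deriv 2 g x)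
        - torus_integral (\<lambda>x. t * (partial_deriv 1 f x * partial_deriv 2 g x))"
      by (rule torus_integral_diff) (intro ci)+
    finally have 1: "torus_integral (\<lambda>x. (f (x + v) - f x - t * partial_deriv 1 f x) * partial_deriv 2 g x)
      = torus_integral (\<lambda>x. (f (x + v) - f x) * partial_deriv 2 g x) - t * ?L"
      by (simp only: torus_integral_cmult)
    have 1: "\<bar>torus_integral (\<lambda>x. (f (x + v) - f x) * partial_deriv 2 g x) - t * ?L\<bar> \<le> e * t * A"
      unfolding 1[symmetric]
    proof (rule torus_integral_abs_le)
      show "\<bar>(f (x + v) - f x - t * partial_deriv 1 f x) * partial_deriv 2 g x\<bar> \<le> e * t * A" for x
        using mult_mono[OF d1(2)[OF t(2)] A(2)] t(1) \<open>e > 0\<close> by (simp add: abs_mult v_def)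
    qed (intro ci)
    have "torus_integral (\<lambda>x. partial_deriv 2 f x * (g (x + - v) - g x - (- t) * partial_deriv 1 g x))
      = torus_integral (\<lambda>x. (partial_deriv 2 f x * g (x + - v) - partial_deriv 2 f x * g x)
          + t * (partial_deriv 2 f x * partial_deriv 1 g x))"
      by (simp add: algebra_simps)
    also have "\<dots> = torus_integral (\<lambda>x. partial_deriv 2 f x * g (x + - v) - partial_deriv 2 f x * g x)
          + torus_integral (\<lambda>x. t * (partial_deriv 2 f x * partial_deriv 1 g x))"
      by (rule torus_integral_add) (intro ci)+
    also have "torus_integral (\<lambda>x. partial_deriv 2 f x * g (x + - v) - partial_deriv 2 f x * g x)
       = torus_integral (\<lambda>x. partial_deriv 2 f x * g (x + - v)) - torus_integral (\<lambda>x. partial_deriv 2 f x * g x)"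
      by (rule torus_integral_diff) (intro ci)+
    finally have 2: "torus_integral (\<lambda>x. partial_deriv 2 f x * (g (x + - v) - g x - (- t) * partial_deriv 1 g x))
      = torus_integral (\<lambda>x. partial_deriv 2 f x * g (x + - v))
       - torus_integral (\<lambda>x. partial_deriv 2 f x * g x) + t * ?R" by (simp only: torus_integral_cmult)
    have 2: "\<bar>torus_integral (\<lambda>x. partial_deriv 2 f x * g (x + - v))
       - torus_integral (\<lambda>x. partial_deriv 2 f x * g x) + t * ?R\<bar> \<le> B * (e * t)"
      unfolding 2[symmetric]
    proof (rule torus_integral_abs_le)
      show "\<bar>partial_deriv 2 f x * (g (x + - v) - g x - (- t) * partial_deriv 1 g x)\<bar> \<le> B * (e * t)" for x
        using mult_mono[OF B(2) d2(2)[OF t(3)]] t(1) \<open>e > 0\<close> B(1) by (simp add: abs_mult v_def)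
    qed (intro ci)
    have "\<bar>t * (?L - ?R)\<bar> \<le> e * t * A + B * (e * t)"
      using 1 2 X by (simp add: algebra_simps)
    also have "\<dots> = t * (e * (A + B))" by (simp add: algebra_simps)
    finally show ?thesis using t(1) by (simp add: abs_mult)
  qed
  then have "\<bar>?L - ?R\<bar> \<le> e" if "e > 0" for e
    using that A(1) B(1) \<open>\<And>e. e > 0 \<Longrightarrow> \<bar>?L - ?R\<bar> \<le> e * (A + B)\<close>[of "e / (A + B)"] by simp
  then have "\<bar>?L - ?R\<bar> \<le> 0" by (rule field_le_epsilon) simp
  then show ?thesis by simp
qed

lemma torus_integral_poisson:
  assumes "torus_smooth f" "torus_smooth g"
  shows "torus_integral (poisson f g) = 0"
  using torus_integral_mixed[OF assms] assms
  by (simp add: poisson_eq[abs_def] torus_integral_diff torus_smooth_continuous torus_smooth_intros)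

lemma poisson_mult_right:
  "torus_smooth f \<Longrightarrow> torus_smooth g \<Longrightarrow> torus_smooth h \<Longrightarrow>
    poisson f (\<lambda>x. g x * h x) x = g x * poisson f h x + poisson f g x * h x"
  by (simp add: poisson_eq partial_deriv_mult algebra_simps)

text \<open>A continuous nonnegative function with integral 0 vanishes on the closed square, and
  periodicity carries this to the plane. Testing a function against itself in this way gives
  uniqueness of functional derivatives and turns the weak equation into a pointwise one.\<close>

lemma torus_integral_square_eq_0:
  assumes c: "continuous_on UNIV f" and p: "periodic f" and 0: "torus_integral (\<lambda>x. f x * f x) = 0"
  shows "f x = 0"
proof -
  have c2: "continuous_on UNIV (\<lambda>x. f x * f x)" by (intro continuous_intros c)
  have "((\<lambda>x. f x * f x) has_integral 0) (cbox 0 1)"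
    using 0 integrable_continuous[OF continuous_on_subset[OF c2], of 0 1]
    by (simp add: torus_integral_eq_integral[OF c2] has_integral_iff)
  moreover have "box 0 (1::real^2) \<noteq> {}" by (simp add: interval_ne_empty_cart)
  ultimately have "f y * f y = 0" if "y \<in> cbox 0 1" for y
    using has_integral_0_cbox_imp_0[OF continuous_on_subset[OF c2] _ _ _ that] by simp
  then have "f (torus_proj x) * f (torus_proj x) = 0"
    using fundamental_domain_subset_cbox torus_proj_in by blast
  then show ?thesis by (simp add: periodic_proj[OF p])
qed

text \<open>Curves are smooth jointly in time and space, whereas test functions live at one time.
  Freezing \<open>t\<close> replaces a direction \<open>v\<close> by \<open>(0, v)\<close>, and the
  induction runs through such directions only.\<close>

lemma Ck_on_slice:
  assumes "t \<in> I"
  shows "Ck_on n (I \<times> UNIV) F \<Longrightarrow> Ck_on n UNIV (\<lambda>x. F (t, x))"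
proof (induction n arbitrary: F)
  case 0
  then have "continuous_on (I \<times> UNIV) F" by simp
  then have "continuous_on UNIV (\<lambda>x. F (t, x))"
    by (rule continuous_on_compose2) (use assms in \<open>auto intro!: continuous_intros\<close>)
  then show ?case by simp
next
  case (Suc n)
  have D: "((\<lambda>x. F (t, x)) has_derivative (\<lambda>v. frechet_derivative F (at (t, x)) (0, v))) (at x)" for x
  proof -
    have "(F has_derivative frechet_derivative F (at (t, x))) (at (t, x))"
      using Suc.prems assms frechet_derivative_works by auto
    then show ?thesis
      by (rule has_derivative_compose[rotated]) (auto intro!: derivative_eq_intros)
  qed
  have "frechet_derivative (\<lambda>x. F (t, x)) (at x) v = frechet_derivative F (at (t, x)) (0, v)" for x v
    using frechet_derivative_at[OF D] by metis
  moreover have "(\<lambda>x. F (t, x)) differentiable at x" for x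
    using D differentiable_def by blast
  moreover have "Ck_on n UNIV (\<lambda>x. frechet_derivative F (at (t, x)) (0, v))" for v
    using Suc.prems by (intro Suc.IH[of "\<lambda>z. frechet_derivative F (at z) (0, v)"]) simp
  ultimately show ?case by simp
qed

section \<open>Kantorovich duality\<close>

lemma frechet_derivative_eq_gradient:
  assumes "f differentiable at x"
  shows "frechet_derivative f (at x) v = gradient f x \<bullet> v"
proof -
  have lin: "linear (frechet_derivative f (at x))"
    using assms by (simp add: linear_frechet_derivative)
  have "frechet_derivative f (at x) v = frechet_derivative f (at x) (\<Sum>i\<in>UNIV. v $ i *\<^sub>R axis i 1)"
    by (simp add: basis_expansion scalar_mult_eq_scaleR[symmetric])
  also have "\<dots> = (\<Sum>i\<in>UNIV. v $ i * frechet_derivative f (at x) (axis i 1))"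
    by (simp add: linear_sum[OF lin] linear_scale[OF lin])
  also have "\<dots> = gradient f x \<bullet> v"
    by (simp add: inner_vec_def gradient_def partial_deriv_def mult.commute)
  finally show ?thesis .
qed

lemma has_derivative_convex_potential:
  assumes "torus_smooth \<psi>"
  shows "(convex_potential \<epsilon> \<psi> has_derivative (\<lambda>v. (x + \<epsilon> *\<^sub>R gradient \<psi> x) \<bullet> v)) (at x)"
proof -
  have "(\<psi> has_derivative (\<lambda>v. gradient \<psi> x \<bullet> v)) (at x)"
    using torus_smooth_has_derivative[OF assms, of x]
    unfolding frechet_derivative_eq_gradient[OF torus_smooth_differentiable[OF assms], abs_def] .
  moreover have "((\<lambda>x. (norm x)\<^sup>2 / 2) has_derivative (\<lambda>v. x \<bullet> v)) (at x)"
    unfolding power2_norm_eq_inner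
    by (auto intro!: derivative_eq_intros simp: inner_commute)
  ultimately have "((\<lambda>x. (norm x)\<^sup>2 / 2 + \<epsilon> * \<psi> x) has_derivative (\<lambda>v. x \<bullet> v + \<epsilon> * (gradient \<psi> x \<bullet> v))) (at x)"
    by (intro has_derivative_add has_derivative_mult_right)
  then show ?thesis by (simp add: convex_potential_def[abs_def] inner_simps)
qed

lemma partial_deriv_convex_potential:
  assumes "torus_smooth \<psi>"
  shows "partial_deriv i (convex_potential \<epsilon> \<psi>) x = x $ i + \<epsilon> * partial_deriv i \<psi> x"
proof -
  have "partial_deriv i (convex_potential \<epsilon> \<psi>) x = (x + \<epsilon> *\<^sub>R gradient \<psi> x) \<bullet> axis i 1"
    unfolding partial_deriv_def frechet_derivative_at[OF has_derivative_convex_potential[OF assms], symmetric] ..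
  then show ?thesis by (simp add: inner_axis gradient_def)
qed

lemma gradient_convex_potential:
  "torus_smooth \<psi> \<Longrightarrow> gradient (convex_potential \<epsilon> \<psi>) x = x + \<epsilon> *\<^sub>R gradient \<psi> x"
  by (simp add: vec_eq_iff gradient_def partial_deriv_convex_potential)

lemma hessian_convex_potential:
  assumes "torus_smooth \<psi>"
  shows "hessian (convex_potential \<epsilon> \<psi>) x = mat 1 + \<epsilon> *\<^sub>R hessian \<psi> x"
proof -
  have "partial_deriv i (\<lambda>x. x $ j + \<epsilon> * partial_deriv j \<psi> x) x
      = (if i = j then 1 else 0) + \<epsilon> * partial_deriv i (partial_deriv j \<psi>) x" for i j
  proof -
    let ?D = "frechet_derivative (partial_deriv j \<psi>) (at x)"
    have "((\<lambda>x. x $ j + \<epsilon> * partial_deriv j \<psi> x) has_derivative (\<lambda>v. v $ j + \<epsilon> * ?D v)) (at x)"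
      by (intro has_derivative_add has_derivative_mult_right torus_smooth_has_derivative
          torus_smooth_partial assms bounded_linear_imp_has_derivative bounded_linear_vec_nth)
    then show ?thesis
      unfolding partial_deriv_def[of i] by (simp add: frechet_derivative_at[symmetric] axis_def)
  qed
  then show ?thesis
    by (simp add: hessian_def vec_eq_iff mat_def partial_deriv_convex_potential[OF assms, abs_def])
qed

text \<open>Along the line from \<open>x\<close> through \<open>z\<close> this is the statement that
  a convex function of one variable lies above its tangent at 0, evaluated at 1.\<close>

lemma convex_tangent_below:
  fixes f :: "'a::real_normed_vector \<Rightarrow> real"
  assumes conv: "convex_on UNIV f" and D: "(f has_derivative D) (at x)"
  shows "f x + D (z - x) \<le> f z"
proof -
  let ?g = "\<lambda>t. f (x + t *\<^sub>R (z - x))"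
  have "convex_on UNIV ?g"
  proof (rule convex_onI)
    fix t a b :: real assume t: "0 < t" "t < 1"
    have "x + ((1 - t) *\<^sub>R a + t *\<^sub>R b) *\<^sub>R (z - x) = (1 - t) *\<^sub>R (x + a *\<^sub>R (z - x)) + t *\<^sub>R (x + b *\<^sub>R (z - x))"
      by (simp add: algebra_simps)
    then show "?g ((1 - t) *\<^sub>R a + t *\<^sub>R b) \<le> (1 - t) * ?g a + t * ?g b"
      using convex_onD[OF conv, of t] t by simp
  qed simp
  moreover have "(?g has_real_derivative D (z - x)) (at 0)"
  proof -
    have "(f has_derivative D) (at (x + 0 *\<^sub>R (z - x)))" using D by simp
    then have "(?g has_derivative (\<lambda>t. D (t *\<^sub>R (z - x)))) (at 0)"
      by (rule has_derivative_compose[rotated]) (auto intro!: derivative_eq_intros)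
    then show ?thesis
      by (simp add: has_field_derivative_def linear_scale[OF has_derivative_linear[OF D]] mult.commute[of _ "D (z - x)"])
  qed
  ultimately have "?g 1 - ?g 0 \<ge> D (z - x) * (1 - 0)"
    by (intro convex_on_imp_above_tangent[of UNIV]) auto
  then show ?thesis by simp
qed

section \<open>The torus distance and weak duality\<close>

lemma torus_dist_nonneg: "0 \<le> torus_dist x y"
  unfolding torus_dist_def using lattice_0 by (intro cINF_greatest) auto

lemma torus_dist_bdd: "bdd_below ((\<lambda>k. norm (x - y - k)) ` int_lattice)"
  by (rule bdd_belowI[of _ 0]) auto

lemma torus_dist_le: "k \<in> int_lattice \<Longrightarrow> torus_dist x y \<le> norm (x - y - k)"
  unfolding torus_dist_def by (intro cINF_lower torus_dist_bdd)

lemma torus_dist_sq_ge: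
  assumes "\<And>k. k \<in> int_lattice \<Longrightarrow> c \<le> (norm (x - y - k))\<^sup>2"
  shows "c \<le> (torus_dist x y)\<^sup>2"
proof -
  \<comment> \<open>The infimum is over norms, not over their squares, so the bound passes through a
    square root; \<open>max c 0\<close> covers negative \<open>c\<close>.\<close>
  have "sqrt (max c 0) \<le> torus_dist x y"
    unfolding torus_dist_def
  proof (rule cINF_greatest)
    fix k :: "real^2" assume "k \<in> int_lattice"
    then have "max c 0 \<le> (norm (x - y - k))\<^sup>2" using assms by simp
    then show "sqrt (max c 0) \<le> norm (x - y - k)" by (intro real_le_lsqrt) auto
  qed (use lattice_0 in auto)
  then have "(sqrt (max c 0))\<^sup>2 \<le> (torus_dist x y)\<^sup>2" by (intro power_mono) auto
  then show ?thesis by simp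
qed

text \<open>A crude bound by the diagonal of the unit square, from the lattice vector 0 alone. The
  constant 2 reappears as the price per unit mass of a product coupling.\<close>

lemma torus_dist_sq_le_2:
  assumes "x \<in> fundamental_domain" "y \<in> fundamental_domain"
  shows "(torus_dist x y)\<^sup>2 \<le> 2"
proof -
  have "(torus_dist x y)\<^sup>2 \<le> (norm (x - y))\<^sup>2"
    using torus_dist_le[OF lattice_0, of x y] by (intro power_mono torus_dist_nonneg) simp
  also have "\<dots> = (x $ 1 - y $ 1)\<^sup>2 + (x $ 2 - y $ 2)\<^sup>2"
    by (simp add: norm_vec_def L2_set_def sum_2)
  also have "\<dots> \<le> 1 + 1"
    using assms by (intro add_mono) (auto simp: fundamental_domain_def abs_square_le_1 abs_le_iff, (smt (verit))+)
  finally show ?thesis by simp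
qed

lemma torus_dist_less_iff: "torus_dist x y < c \<longleftrightarrow> (\<exists>k\<in>int_lattice. norm (x - y - k) < c)"
  unfolding torus_dist_def by (rule cINF_less_iff) (use lattice_0 torus_dist_bdd in auto)

text \<open>An infimum of continuous functions has open strict sublevel sets.\<close>

lemma torus_dist_measurable [measurable]:
  "(\<lambda>p. torus_dist (fst p) (snd p)) \<in> borel_measurable borel"
proof (rule borel_measurableI_less)
  fix a
  have "{p \<in> space borel. torus_dist (fst p) (snd p) < a} = (\<Union>k\<in>int_lattice. {p. norm (fst p - snd p - k) < a})"
    by (auto simp: torus_dist_less_iff)
  also have "open \<dots>"
    by (intro open_UN ballI open_Collect_less continuous_intros)
  finally show "{p \<in> space borel. torus_dist (fst p) (snd p) < a} \<in> sets borel" by simp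
qed

lemma measurable_torus_pair:
  assumes "f \<in> borel \<rightarrow>\<^sub>M N"
  shows "f \<in> torus_measure \<Otimes>\<^sub>M torus_measure \<rightarrow>\<^sub>M N"
proof -
  have "(\<lambda>x. x) \<in> torus_measure \<rightarrow>\<^sub>M borel" by (rule measurable_torus_measure1) simp
  then have "(\<lambda>p. (fst p, snd p)) \<in> torus_measure \<Otimes>\<^sub>M torus_measure \<rightarrow>\<^sub>M borel \<Otimes>\<^sub>M borel"
    by measurable
  then have "(\<lambda>p. p) \<in> torus_measure \<Otimes>\<^sub>M torus_measure \<rightarrow>\<^sub>M borel"
    by (simp add: borel_prod)
  from measurable_compose[OF this assms] show ?thesis by simp
qed

text \<open>An infimum of nonnegative costs over a nonempty set is nonnegative, so squaring undoes
  the square root. Nonemptiness has to be supplied by an explicit coupling.\<close>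

lemma W2_sq:
  assumes "couplings \<mu> \<nu> \<noteq> {}"
  shows "(W2 \<mu> \<nu>)\<^sup>2 = (INF \<gamma>\<in>couplings \<mu> \<nu>. \<integral>p. (torus_dist (fst p) (snd p))\<^sup>2 \<partial>\<gamma>)"
  unfolding W2_def using assms by (intro real_sqrt_pow2 cINF_greatest) auto

lemma W2_sq_le:
  assumes "\<gamma> \<in> couplings \<mu> \<nu>"
  shows "(W2 \<mu> \<nu>)\<^sup>2 \<le> (\<integral>p. (torus_dist (fst p) (snd p))\<^sup>2 \<partial>\<gamma>)"
proof -
  have "couplings \<mu> \<nu> \<noteq> {}" using assms by auto
  then show ?thesis
    unfolding W2_sq[OF \<open>couplings \<mu> \<nu> \<noteq> {}\<close>]
    by (intro cINF_lower assms bdd_belowI[of _ 0]) auto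
qed

text \<open>Weak Kantorovich duality: integrate the pointwise inequality against the coupling and
  split by marginals. The coupling has the finite total mass of its marginal \<open>\<mu>\<close>,
  so the bounded potentials and the bounded cost are integrable.\<close>

lemma coupling_dual_bound:
  fixes a b :: "real^2 \<Rightarrow> real"
  assumes \<gamma>: "\<gamma> \<in> couplings \<mu> \<nu>" and sets: "sets \<mu> = sets torus_measure" "sets \<nu> = sets torus_measure"
    and fin: "finite_measure \<mu>"
    and [measurable]: "a \<in> borel_measurable borel" "b \<in> borel_measurable borel"
    and bd: "\<And>x. \<bar>a x\<bar> \<le> A" "\<And>x. \<bar>b x\<bar> \<le> B"
    and ab: "\<And>x y. a x + b y \<le> (torus_dist x y)\<^sup>2"
  shows "(\<integral>x. a x \<partial>\<mu>) + (\<integral>y. b y \<partial>\<nu>) \<le> (\<integral>p. (torus_dist (fst p) (snd p))\<^sup>2 \<partial>\<gamma>)"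
proof -
  have s\<gamma>: "sets \<gamma> = sets (\<mu> \<Otimes>\<^sub>M \<nu>)" and d1: "distr \<gamma> \<mu> fst = \<mu>" and d2: "distr \<gamma> \<nu> snd = \<nu>"
    using \<gamma> by (auto simp: couplings_def)
  have s\<gamma>': "sets \<gamma> = sets (torus_measure \<Otimes>\<^sub>M torus_measure)"
    unfolding s\<gamma> by (rule sets_pair_measure_cong[OF sets])
  have sp: "space \<gamma> = fundamental_domain \<times> fundamental_domain"
    using sets_eq_imp_space_eq[OF s\<gamma>'] by (simp add: space_pair_measure)
  have m1: "fst \<in> \<gamma> \<rightarrow>\<^sub>M \<mu>" and m2: "snd \<in> \<gamma> \<rightarrow>\<^sub>M \<nu>"
    by (simp_all add: measurable_cong_sets[OF s\<gamma> refl])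
  have "emeasure \<gamma> (space \<gamma>) = emeasure (distr \<gamma> \<mu> fst) (space \<mu>)"
  proof -
    have "fst -` space \<mu> \<inter> space \<gamma> = space \<gamma>" using measurable_space[OF m1] by auto
    then show ?thesis by (simp add: emeasure_distr[OF m1])
  qed
  then have "emeasure \<gamma> (space \<gamma>) = emeasure \<mu> (space \<mu>)" by (simp add: d1)
  then interpret \<gamma>: finite_measure \<gamma>
    using finite_measure.emeasure_finite[OF fin] by (intro finite_measureI) simp
  have bm: "f \<in> borel_measurable borel \<Longrightarrow> f \<in> borel_measurable \<gamma>" for f :: "(real^2) \<times> (real^2) \<Rightarrow> real"
    unfolding measurable_cong_sets[OF s\<gamma>' refl] by (rule measurable_torus_pair)
  have ma: "a \<in> borel_measurable \<mu>" "b \<in> borel_measurable \<nu>"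
    unfolding measurable_cong_sets[OF sets(1) refl] measurable_cong_sets[OF sets(2) refl]
    by (rule measurable_torus_measure1, measurable)+
  have ia: "integrable \<gamma> (\<lambda>p. a (fst p))"
    by (rule \<gamma>.integrable_const_bound[where B=A])
      (simp add: bd, rule measurable_compose[OF m1 ma(1)])
  have ib: "integrable \<gamma> (\<lambda>p. b (snd p))"
    by (rule \<gamma>.integrable_const_bound[where B=B])
      (simp add: bd, rule measurable_compose[OF m2 ma(2)])
  have id: "integrable \<gamma> (\<lambda>p. (torus_dist (fst p) (snd p))\<^sup>2)"
  proof (rule \<gamma>.integrable_const_bound[where B=2])
    show "AE p in \<gamma>. norm ((torus_dist (fst p) (snd p))\<^sup>2) \<le> 2"
      by (rule AE_I2) (simp add: sp mem_Times_iff torus_dist_sq_le_2)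
  qed (rule bm, measurable)
  have "(\<integral>x. a x \<partial>\<mu>) = (\<integral>x. a x \<partial>distr \<gamma> \<mu> fst)" "(\<integral>y. b y \<partial>\<nu>) = (\<integral>y. b y \<partial>distr \<gamma> \<nu> snd)"
    by (simp_all add: d1 d2)
  then have "(\<integral>x. a x \<partial>\<mu>) + (\<integral>y. b y \<partial>\<nu>) = (\<integral>p. a (fst p) \<partial>\<gamma>) + (\<integral>p. b (snd p) \<partial>\<gamma>)"
    by (simp add: integral_distr[OF m1 ma(1)] integral_distr[OF m2 ma(2)])
  also have "\<dots> = (\<integral>p. a (fst p) + b (snd p) \<partial>\<gamma>)"
    by (rule Bochner_Integration.integral_add[OF ia ib, symmetric])
  also have "\<dots> \<le> (\<integral>p. (torus_dist (fst p) (snd p))\<^sup>2 \<partial>\<gamma>)"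
    by (intro integral_mono id Bochner_Integration.integrable_add ia ib ab)
  finally show ?thesis .
qed

text \<open>With \<open>P = |x|^2/2 + f\<close> this is \<open>|y|^2/2\<close> minus the Legendre
  transform of \<open>P\<close> at \<open>y\<close>. The cost is the one of the plane; for periodic
  \<open>f\<close> the infimum over all \<open>x\<close> already includes the lattice translates. In
  the usual sign convention it is the transform of \<open>- f\<close>.\<close>

definition c_transform :: "(real^2 \<Rightarrow> real) \<Rightarrow> real^2 \<Rightarrow> real" where
  "c_transform f y = (INF x. (norm (x - y))\<^sup>2 / 2 + f x)"

context
  fixes f :: "real^2 \<Rightarrow> real" and B :: real
  assumes f: "continuous_on UNIV f" "periodic f" and B: "\<And>x. \<bar>f x\<bar> \<le> B"
begin

lemma c_transform_bdd: "bdd_below (range (\<lambda>x. (norm (x - y))\<^sup>2 / 2 + f x))"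
proof (rule bdd_belowI[of _ "-B"])
  fix u assume "u \<in> range (\<lambda>x. (norm (x - y))\<^sup>2 / 2 + f x)"
  then obtain x where "u = (norm (x - y))\<^sup>2 / 2 + f x" by auto
  then show "-B \<le> u" using B[of x] by (smt (verit) zero_le_power2 divide_nonneg_pos)
qed

lemma c_transform_le: "c_transform f y \<le> (norm (x - y))\<^sup>2 / 2 + f x"
  unfolding c_transform_def by (intro cINF_lower c_transform_bdd) simp

lemma c_transform_less_iff: "c_transform f y < c \<longleftrightarrow> (\<exists>x. (norm (x - y))\<^sup>2 / 2 + f x < c)"
  using cINF_less_iff[OF UNIV_not_empty c_transform_bdd[of y]] by (simp add: c_transform_def)

lemma c_transform_bounded: "\<bar>c_transform f y\<bar> \<le> B"
proof -
  have "-B \<le> c_transform f y"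
    unfolding c_transform_def
  proof (rule cINF_greatest)
    show "-B \<le> (norm (x - y))\<^sup>2 / 2 + f x" for x
      using B[of x] by (smt (verit) zero_le_power2 divide_nonneg_pos)
  qed simp
  moreover have "c_transform f y \<le> B" using c_transform_le[of y y] B[of y] by simp
  ultimately show ?thesis by simp
qed

lemma c_transform_measurable: "c_transform f \<in> borel_measurable borel"
proof (rule borel_measurableI_less)
  fix a
  have "{y \<in> space borel. c_transform f y < a} = (\<Union>x. {y. (norm (x - y))\<^sup>2 / 2 + f x < a})"
    by (auto simp: c_transform_less_iff)
  also have "open \<dots>"
    by (intro open_UN ballI open_Collect_less continuous_on_add continuous_on_const
        continuous_on_divide continuous_on_power continuous_on_norm continuous_on_diff continuous_on_id) auto
  finally show "{y \<in> space borel. c_transform f y < a} \<in> sets borel" by simp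
qed

lemma c_transform_periodic: "periodic (c_transform f)"
  unfolding periodic_def
proof (intro allI ballI)
  \<comment> \<open>Replacing \<open>x\<close> by \<open>x + k\<close> in the infimum; applied to
    both \<open>k\<close> and \<open>- k\<close> the inequality becomes an equality.\<close>
  have le: "c_transform f (y + k) \<le> c_transform f y" if k: "k \<in> int_lattice" for y k
  proof -
    have "c_transform f (y + k) \<le> (norm (x - y))\<^sup>2 / 2 + f x" for x
      using c_transform_le[of "y + k" "x + k"] periodicD[OF f(2) k, of x] by simp
    then show ?thesis unfolding c_transform_def[of f y] by (intro cINF_greatest) auto
  qed
  fix y k :: "real^2" assume k: "k \<in> int_lattice"
  show "c_transform f (y + k) = c_transform f y"
    using le[OF k, of y] le[OF lattice_neg[OF k], of "y + k"] by simp
qed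

text \<open>The planar inequality is used at \<open>x - k\<close> for every lattice vector
  \<open>k\<close>; periodicity of \<open>f\<close> makes its left side independent of
  \<open>k\<close>, so it passes to the infimum that defines the torus distance.\<close>

lemma c_transform_dual: "c_transform f y - f x \<le> (torus_dist x y)\<^sup>2 / 2"
proof -
  have "2 * (c_transform f y - f x) \<le> (norm (x - y - k))\<^sup>2" if "k \<in> int_lattice" for k
  proof -
    have "c_transform f y \<le> (norm (x - k - y))\<^sup>2 / 2 + f (x + - k)"
      using c_transform_le[of y "x - k"] by simp
    also have "f (x + - k) = f x" using periodicD[OF f(2) lattice_neg[OF that]] .
    finally show ?thesis by (simp add: algebra_simps)
  qed
  then have "2 * (c_transform f y - f x) \<le> (torus_dist x y)\<^sup>2" by (rule torus_dist_sq_ge)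
  then show ?thesis by simp
qed

end

text \<open>This is where convexity enters. The tangent plane of the convex potential at
  \<open>x\<close> lies below it, which says exactly that for \<open>y\<close> the gradient at
  \<open>x\<close> the infimum is attained at \<open>x\<close>. The dual inequality thus holds with
  planar equality along the graph of the map.\<close>

lemma c_transform_gradient:
  assumes \<psi>: "torus_smooth \<psi>" and conv: "convex_on UNIV (convex_potential \<epsilon> \<psi>)"
  shows "c_transform (\<lambda>x. \<epsilon> * \<psi> x) (gradient (convex_potential \<epsilon> \<psi>) x)
       = (norm (\<epsilon> *\<^sub>R gradient \<psi> x))\<^sup>2 / 2 + \<epsilon> * \<psi> x"
proof -
  let ?y = "x + \<epsilon> *\<^sub>R gradient \<psi> x"
  have "(norm (x - ?y))\<^sup>2 / 2 + \<epsilon> * \<psi> x \<le> (norm (z - ?y))\<^sup>2 / 2 + \<epsilon> * \<psi> z" for z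
  proof -
    have "convex_potential \<epsilon> \<psi> x + ?y \<bullet> (z - x) \<le> convex_potential \<epsilon> \<psi> z"
      by (rule convex_tangent_below[OF conv has_derivative_convex_potential[OF \<psi>]])
    then show ?thesis
      unfolding convex_potential_def power2_norm_eq_inner
      by (simp add: inner_diff_left inner_diff_right inner_add_left inner_add_right inner_commute field_simps)
  qed
  then have "c_transform (\<lambda>x. \<epsilon> * \<psi> x) ?y = (norm (x - ?y))\<^sup>2 / 2 + \<epsilon> * \<psi> x"
    unfolding c_transform_def by (intro cInf_eq_minimum[OF rangeI]) blast
  then show ?thesis by (simp add: gradient_convex_potential[OF \<psi>])
qed

section \<open>Couplings of perturbed densities\<close>

text \<open>Couplings of perturbed densities are assembled from finitely many partial couplings, one
  for each piece of mass. They are added as set functions on the measurable sets of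
  \<open>M\<close>, which all summands are expected to share.\<close>

definition sum_measure :: "'i set \<Rightarrow> ('i \<Rightarrow> 'a measure) \<Rightarrow> 'a measure \<Rightarrow> 'a measure" where
  "sum_measure I \<gamma> M = measure_of (space M) (sets M) (\<lambda>A. \<Sum>i\<in>I. emeasure (\<gamma> i) A)"

lemma sets_sum_measure [simp]: "sets (sum_measure I \<gamma> M) = sets M"
  by (simp add: sum_measure_def sets.sigma_sets_eq sets.space_closed)

lemma emeasure_sum_measure:
  assumes "\<And>i. i \<in> I \<Longrightarrow> sets (\<gamma> i) = sets M" and A: "A \<in> sets M"
  shows "emeasure (sum_measure I \<gamma> M) A = (\<Sum>i\<in>I. emeasure (\<gamma> i) A)"
  unfolding sum_measure_def
proof (rule emeasure_measure_of_sigma[OF _ _ _ A])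
  show "countably_additive (sets M) (\<lambda>A. \<Sum>i\<in>I. emeasure (\<gamma> i) A)"
  proof (rule countably_additiveI)
    fix F :: "nat \<Rightarrow> _" assume F: "range F \<subseteq> sets M" "disjoint_family F"
    have "(\<Sum>n. \<Sum>i\<in>I. emeasure (\<gamma> i) (F n)) = (\<Sum>i\<in>I. \<Sum>n. emeasure (\<gamma> i) (F n))"
      by (rule suminf_sum) (rule summableI)
    also have "\<dots> = (\<Sum>i\<in>I. emeasure (\<gamma> i) (\<Union>n. F n))"
      using F assms(1) by (intro sum.cong refl suminf_emeasure) auto
    finally show "(\<Sum>n. \<Sum>i\<in>I. emeasure (\<gamma> i) (F n)) = (\<Sum>i\<in>I. emeasure (\<gamma> i) (\<Union>n. F n))" .
  qed
qed (auto simp: positive_def sets.sigma_algebra_axioms)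

lemma nn_integral_sum_measure:
  assumes sets: "\<And>i. i \<in> I \<Longrightarrow> sets (\<gamma> i) = sets M" and f: "f \<in> borel_measurable M"
  shows "(\<integral>\<^sup>+x. f x \<partial>sum_measure I \<gamma> M) = (\<Sum>i\<in>I. \<integral>\<^sup>+x. f x \<partial>\<gamma> i)"
  using f
proof (induction rule: borel_measurable_induct)
  have sp: "space (sum_measure I \<gamma> M) = space M" "\<And>i. i \<in> I \<Longrightarrow> space (\<gamma> i) = space M"
    using sets by (auto intro!: sets_eq_imp_space_eq)
  have meas: "u \<in> borel_measurable (sum_measure I \<gamma> M)" "\<And>i. i \<in> I \<Longrightarrow> u \<in> borel_measurable (\<gamma> i)"
    if "u \<in> borel_measurable M" for u :: "_ \<Rightarrow> ennreal"
    using that measurable_cong_sets[OF sets refl] measurable_cong_sets[OF sets_sum_measure refl] by blast+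
  {
    case (cong f g)
    have "(\<integral>\<^sup>+x. f x \<partial>sum_measure I \<gamma> M) = (\<integral>\<^sup>+x. g x \<partial>sum_measure I \<gamma> M)"
      using cong(3) by (intro nn_integral_cong) (simp add: sp)
    moreover have "(\<Sum>i\<in>I. \<integral>\<^sup>+x. f x \<partial>\<gamma> i) = (\<Sum>i\<in>I. \<integral>\<^sup>+x. g x \<partial>\<gamma> i)"
      using cong(3) by (intro sum.cong refl nn_integral_cong) (simp add: sp)
    ultimately show ?case using cong(4) by simp
  next
    case (set A)
    then show ?case by (simp add: sets emeasure_sum_measure)
  next
    case (mult u c)
    then show ?case by (simp add: nn_integral_cmult meas sum_distrib_left)
  next
    case (add u v)
    then show ?case by (simp add: nn_integral_add meas sum.distrib)
  next
    case (seq U)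
    have "(\<integral>\<^sup>+x. (SUP i. U i) x \<partial>N) = (SUP i. \<integral>\<^sup>+x. U i x \<partial>N)" if "\<And>i. U i \<in> borel_measurable N" for N
      using nn_integral_monotone_convergence_SUP[OF seq(3) that] by (simp add: image_comp)
    moreover have "(SUP n. \<Sum>i\<in>I. \<integral>\<^sup>+x. U n x \<partial>\<gamma> i) = (\<Sum>i\<in>I. SUP n. \<integral>\<^sup>+x. U n x \<partial>\<gamma> i)"
      using seq(3) by (intro ennreal_SUP_sum) (auto simp: mono_def le_fun_def intro!: nn_integral_mono)
    ultimately show ?case using seq by (simp add: meas)
  }
qed

text \<open>The piece with density \<open>q j\<close> starts at \<open>x + v j\<close> instead of
  \<open>x\<close> but keeps its destination \<open>T x\<close>. The source marginal is therefore
  the sum of the shifted pieces, while the target marginal does not see the shifts. After scaling by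
  \<open>1 - \<omega>\<close>, the product of \<open>r\<close> with the uniform measure supplies
  what is missing on both sides: \<open>r\<close> at the source and the fraction
  \<open>\<omega>\<close> of the target.\<close>

lemma perturbed_coupling:
  fixes J :: "'j set" and q :: "'j \<Rightarrow> real^2 \<Rightarrow> real" and v :: "'j \<Rightarrow> real^2" and T :: "real^2 \<Rightarrow> real^2"
  assumes T: "T \<in> torus_measure \<rightarrow>\<^sub>M torus_measure"
    and push: "distr (density torus_measure (\<lambda>x. ennreal (m0 x))) torus_measure T = torus_measure"
    and J: "finite J" and \<omega>: "0 \<le> \<omega>" "\<omega> \<le> 1"
    and q: "\<And>j. j \<in> J \<Longrightarrow> continuous_on UNIV (q j)" "\<And>j. j \<in> J \<Longrightarrow> periodic (q j)" "\<And>j x. j \<in> J \<Longrightarrow> 0 \<le> q j x"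
    and r: "continuous_on UNIV r" "\<And>x. 0 \<le> r x" "torus_integral r = \<omega>"
    and m0: "\<And>x. m0 x = (\<Sum>j\<in>J. q j x)"
    and m: "\<And>x. m x = (1 - \<omega>) * (\<Sum>j\<in>J. q j (x - v j)) + r x"
    and D: "\<And>j. j \<in> J \<Longrightarrow> continuous_on UNIV (D j)"
      "\<And>j x. j \<in> J \<Longrightarrow> x \<in> fundamental_domain \<Longrightarrow> (torus_dist (torus_proj (x + v j)) (T x))\<^sup>2 \<le> D j x"
  obtains \<gamma> where "\<gamma> \<in> couplings (density torus_measure (\<lambda>x. ennreal (m x))) torus_measure"
    "(\<integral>p. (torus_dist (fst p) (snd p))\<^sup>2 \<partial>\<gamma>) \<le> (1 - \<omega>) * (\<Sum>j\<in>J. torus_integral (\<lambda>x. q j x * D j x)) + 2 * \<omega>"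
proof -
  let ?\<tau> = torus_measure
  let ?P = "torus_measure \<Otimes>\<^sub>M torus_measure"
  define w where "w j x = ennreal ((1 - \<omega>) * q j x)" for j x
  define X where "X j x = torus_proj (x + v j)" for j x
  \<comment> \<open>The index \<open>None\<close> stands for the product part that carries
    \<open>r\<close>, the index \<open>Some j\<close> for the moved piece \<open>j\<close>, scaled
    by \<open>1 - \<omega>\<close>.\<close>
  define G where "G o' = (case o' of Some j \<Rightarrow> distr (density ?\<tau> (w j)) ?P (\<lambda>x. (X j x, T x))
      | None \<Rightarrow> density ?\<tau> (\<lambda>x. ennreal (r x)) \<Otimes>\<^sub>M ?\<tau>)" for o'
  define \<gamma> where "\<gamma> = sum_measure (insert None (Some ` J)) G ?P"
  let ?\<mu> = "density ?\<tau> (\<lambda>x. ennreal (m x))"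
  have qb: "q j \<in> borel_measurable borel" if "j \<in> J" for j
    by (rule borel_measurable_continuous_onI[OF q(1)[OF that]])
  have rb: "r \<in> borel_measurable borel" by (rule borel_measurable_continuous_onI[OF r(1)])
  have wb: "w j \<in> borel_measurable borel" if "j \<in> J" for j
    unfolding w_def[abs_def] using qb[OF that] by measurable
  have wm: "w j \<in> borel_measurable ?\<tau>" if "j \<in> J" for j
    by (rule measurable_torus_measure1[OF wb[OF that]])
  have rm: "(\<lambda>x. ennreal (r x)) \<in> borel_measurable ?\<tau>"
    by (rule measurable_torus_measure1) (use rb in measurable)
  have Xm: "X j \<in> ?\<tau> \<rightarrow>\<^sub>M ?\<tau>" for j
    unfolding X_def[abs_def]
    by (rule measurable_torus_measure1, rule measurable_compose[OF _ torus_proj_measurable]) measurable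
  have XTm: "(\<lambda>x. (X j x, T x)) \<in> ?\<tau> \<rightarrow>\<^sub>M ?P" for j
    using Xm T by measurable
  have XTd: "(\<lambda>x. (X j x, T x)) \<in> density ?\<tau> (w j) \<rightarrow>\<^sub>M ?P" for j
    using XTm by (simp add: measurable_cong_sets[OF sets_density refl])
  have setsG: "sets (G o') = sets ?P" for o'
    by (auto simp: G_def split: option.split intro!: sets_pair_measure_cong)
  have rI: "(\<integral>\<^sup>+x. ennreal (r x) \<partial>?\<tau>) = ennreal \<omega>"
    using nn_integral_eq_integral[OF torus_integrable[OF r(1)]] r(2,3) by (simp add: torus_integral_def)
  have finr: "finite_measure (density ?\<tau> (\<lambda>x. ennreal (r x)))"
  proof (rule finite_measureI)
    have "emeasure (density ?\<tau> (\<lambda>x. ennreal (r x))) (space ?\<tau>) = (\<integral>\<^sup>+x. ennreal (r x) \<partial>?\<tau>)"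
      by (subst emeasure_density[OF rm sets.top]) (auto intro!: nn_integral_cong)
    then show "emeasure (density ?\<tau> (\<lambda>x. ennreal (r x))) (space (density ?\<tau> (\<lambda>x. ennreal (r x)))) \<noteq> \<infinity>"
      by (simp add: rI)
  qed
  interpret pr: pair_sigma_finite "density ?\<tau> (\<lambda>x. ennreal (r x))" ?\<tau>
    by (intro pair_sigma_finite.intro finite_measure.axioms(1)[OF finr] torus.sigma_finite_measure_axioms)

  \<comment> \<open>Both marginals and the cost are read off from this one formula, by inserting
    indicators of either coordinate and the squared distance.\<close>
  have nn\<gamma>: "(\<integral>\<^sup>+p. f p \<partial>\<gamma>) = (\<integral>\<^sup>+x. ennreal (r x) * (\<integral>\<^sup>+y. f (x, y) \<partial>?\<tau>) \<partial>?\<tau>)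
      + (\<Sum>j\<in>J. \<integral>\<^sup>+x. w j x * f (X j x, T x) \<partial>?\<tau>)" if f: "f \<in> borel_measurable ?P" for f
  proof -
    have "(\<integral>\<^sup>+p. f p \<partial>\<gamma>) = (\<Sum>o'\<in>insert None (Some ` J). \<integral>\<^sup>+p. f p \<partial>G o')"
      unfolding \<gamma>_def by (rule nn_integral_sum_measure[OF setsG f])
    also have "\<dots> = (\<integral>\<^sup>+p. f p \<partial>G None) + (\<Sum>j\<in>J. \<integral>\<^sup>+p. f p \<partial>G (Some j))"
      using J by (simp add: sum.reindex)
    also have "(\<integral>\<^sup>+p. f p \<partial>G None) = (\<integral>\<^sup>+x. ennreal (r x) * (\<integral>\<^sup>+y. f (x, y) \<partial>?\<tau>) \<partial>?\<tau>)"
    proof -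
      have f': "f \<in> borel_measurable (density ?\<tau> (\<lambda>x. ennreal (r x)) \<Otimes>\<^sub>M ?\<tau>)"
        using f by (subst measurable_cong_sets[OF sets_pair_measure_cong[OF sets_density refl] refl])
      have "(\<integral>\<^sup>+p. f p \<partial>G None) = (\<integral>\<^sup>+x. (\<integral>\<^sup>+y. f (x, y) \<partial>?\<tau>) \<partial>density ?\<tau> (\<lambda>x. ennreal (r x)))"
        by (simp add: G_def torus.nn_integral_fst[OF f'])
      also have "\<dots> = (\<integral>\<^sup>+x. ennreal (r x) * (\<integral>\<^sup>+y. f (x, y) \<partial>?\<tau>) \<partial>?\<tau>)"
        by (rule nn_integral_density[OF rm torus.borel_measurable_nn_integral_fst[OF f]])
      finally show ?thesis .
    qed
    also have "(\<Sum>j\<in>J. \<integral>\<^sup>+p. f p \<partial>G (Some j)) = (\<Sum>j\<in>J. \<integral>\<^sup>+x. w j x * f (X j x, T x) \<partial>?\<tau>)"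
    proof (rule sum.cong[OF refl])
      fix j assume "j \<in> J"
      have "(\<integral>\<^sup>+p. f p \<partial>G (Some j)) = (\<integral>\<^sup>+x. f (X j x, T x) \<partial>density ?\<tau> (w j))"
        unfolding G_def option.case by (rule nn_integral_distr[OF XTd]) (use f in simp)
      also have "\<dots> = (\<integral>\<^sup>+x. w j x * f (X j x, T x) \<partial>?\<tau>)"
        by (rule nn_integral_density[OF wm[OF \<open>j \<in> J\<close>] measurable_compose[OF XTm f]])
      finally show "(\<integral>\<^sup>+p. f p \<partial>G (Some j)) = (\<integral>\<^sup>+x. w j x * f (X j x, T x) \<partial>?\<tau>)" .
    qed
    finally show ?thesis .
  qed
  have sets\<gamma>: "sets \<gamma> = sets ?P" by (simp add: \<gamma>_def)
  have m1: "fst \<in> \<gamma> \<rightarrow>\<^sub>M ?\<tau>" and m2: "snd \<in> \<gamma> \<rightarrow>\<^sub>M ?\<tau>"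
    unfolding measurable_cong_sets[OF sets\<gamma> refl] by measurable
  have marg1: "distr \<gamma> ?\<mu> fst = ?\<mu>"
  proof (rule measure_eqI)
    fix A assume "A \<in> sets (distr \<gamma> ?\<mu> fst)"
    then have A: "A \<in> sets ?\<tau>" by simp
    then have [measurable]: "A \<in> sets borel" by (simp add: sets_torus_measure)
    have m1': "fst \<in> \<gamma> \<rightarrow>\<^sub>M ?\<mu>" using m1 by (simp add: measurable_cong_sets[OF refl sets_density])
    have "emeasure (distr \<gamma> ?\<mu> fst) A = (\<integral>\<^sup>+p. indicator A (fst p) \<partial>\<gamma>)"
      using A nn_integral_distr[OF m1', of "indicator A"] by simp
    also have "\<dots> = (\<integral>\<^sup>+x. ennreal (r x) * indicator A x \<partial>?\<tau>) + (\<Sum>j\<in>J. \<integral>\<^sup>+x. w j x * indicator A (X j x) \<partial>?\<tau>)"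
      using A by (subst nn\<gamma>) (auto simp: emeasure_torus_measure_space)
    also have "(\<Sum>j\<in>J. \<integral>\<^sup>+x. w j x * indicator A (X j x) \<partial>?\<tau>) = (\<Sum>j\<in>J. \<integral>\<^sup>+x. w j (x - v j) * indicator A x \<partial>?\<tau>)"
    proof (rule sum.cong[OF refl])
      fix j assume j: "j \<in> J"
      note [measurable] = wb[OF j]
      \<comment> \<open>Translation invariance moves the shift from the point onto the density; the
        indicator is composed with \<open>torus_proj\<close> so that the integrand is
        periodic.\<close>
      have "(\<integral>\<^sup>+x. w j (x + v j - v j) * indicator A (torus_proj (x + v j)) \<partial>?\<tau>)
          = (\<integral>\<^sup>+x. w j (x - v j) * indicator A (torus_proj x) \<partial>?\<tau>)"
      proof (rule nn_integral_torus_translation[where f="\<lambda>x. w j (x - v j) * indicator A (torus_proj x)"])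
        fix x k :: "real^2" assume k: "k \<in> int_lattice"
        have "q j ((x - v j) + k) = q j (x - v j)" by (rule periodicD[OF q(2)[OF j] k])
        then have "w j (x + k - v j) = w j (x - v j)" by (simp add: w_def algebra_simps)
        then show "w j (x + k - v j) * indicator A (torus_proj (x + k)) = w j (x - v j) * indicator A (torus_proj x)"
          by (simp add: torus_proj_add_lattice[OF k])
      qed measurable
      also have "\<dots> = (\<integral>\<^sup>+x. w j (x - v j) * indicator A x \<partial>?\<tau>)"
        by (intro nn_integral_cong) (simp add: torus_proj_id)
      finally show "(\<integral>\<^sup>+x. w j x * indicator A (X j x) \<partial>?\<tau>) = (\<integral>\<^sup>+x. w j (x - v j) * indicator A x \<partial>?\<tau>)"
        by (simp add: X_def)
    qed
    also have "(\<integral>\<^sup>+x. ennreal (r x) * indicator A x \<partial>?\<tau>) + (\<Sum>j\<in>J. \<integral>\<^sup>+x. w j (x - v j) * indicator A x \<partial>?\<tau>)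
       = (\<integral>\<^sup>+x. ennreal (r x) * indicator A x + (\<Sum>j\<in>J. w j (x - v j) * indicator A x) \<partial>?\<tau>)"
    proof -
      have w': "(\<lambda>x. w j (x - v j) * indicator A x) \<in> borel_measurable ?\<tau>" if "j \<in> J" for j
        by (rule measurable_torus_measure1) (use wb[OF that] in measurable)
      have r': "(\<lambda>x. ennreal (r x) * indicator A x) \<in> borel_measurable ?\<tau>"
        by (rule measurable_torus_measure1) (use rb in measurable)
      show ?thesis
        by (simp add: nn_integral_add[OF r' borel_measurable_sum[OF w']] nn_integral_sum[OF w'])
    qed
    also have "\<dots> = (\<integral>\<^sup>+x. ennreal (m x) * indicator A x \<partial>?\<tau>)"
    proof (rule nn_integral_cong)
      fix x
      have "(\<Sum>j\<in>J. w j (x - v j)) = ennreal (\<Sum>j\<in>J. (1 - \<omega>) * q j (x - v j))"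
        unfolding w_def using q(3) \<omega> by (intro sum_ennreal) auto
      then have "ennreal (r x) + (\<Sum>j\<in>J. w j (x - v j)) = ennreal (m x)"
        using r(2) q(3) \<omega> by (simp add: m sum_distrib_left[symmetric] ennreal_plus[symmetric] sum_nonneg add.commute
            del: ennreal_plus)
      then show "ennreal (r x) * indicator A x + (\<Sum>j\<in>J. w j (x - v j) * indicator A x) = ennreal (m x) * indicator A x"
        by (simp add: sum_distrib_right[symmetric] distrib_right[symmetric])
    qed
    also have "\<dots> = emeasure ?\<mu> A"
    proof -
      have "m = (\<lambda>x. (1 - \<omega>) * (\<Sum>j\<in>J. q j (x - v j)) + r x)" using m by auto
      moreover have "(\<lambda>x. (1 - \<omega>) * (\<Sum>j\<in>J. q j (x - v j)) + r x) \<in> borel_measurable borel"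
      proof -
        have "(\<lambda>x. q j (x - v j)) \<in> borel_measurable borel" if "j \<in> J" for j
          using qb[OF that] by measurable
        then have "(\<lambda>x. \<Sum>j\<in>J. q j (x - v j)) \<in> borel_measurable borel"
          by (rule borel_measurable_sum)
        then show ?thesis using rb by measurable
      qed
      ultimately have "(\<lambda>x. ennreal (m x)) \<in> borel_measurable borel" by simp
      from emeasure_density[OF measurable_torus_measure1[OF this] A] show ?thesis by simp
    qed
    finally show "emeasure (distr \<gamma> ?\<mu> fst) A = emeasure ?\<mu> A" .
  qed simp

  \<comment> \<open>The unshifted pieces add up to \<open>(1 - \<omega>) m0\<close>, which
    \<open>T\<close> pushes to \<open>1 - \<omega>\<close> times the uniform measure by
    \<open>push\<close>; the product part adds \<open>\<omega>\<close> times it.\<close>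
  have marg2: "distr \<gamma> ?\<tau> snd = ?\<tau>"
  proof (rule measure_eqI)
    fix A assume "A \<in> sets (distr \<gamma> ?\<tau> snd)"
    then have A: "A \<in> sets ?\<tau>" by simp
    have TA: "(\<lambda>x. indicator A (T x) :: ennreal) \<in> borel_measurable ?\<tau>"
      using T A by measurable
    have "emeasure (distr \<gamma> ?\<tau> snd) A = (\<integral>\<^sup>+p. indicator A (snd p) \<partial>\<gamma>)"
      using A nn_integral_distr[OF m2, of "indicator A"] by simp
    also have "\<dots> = (\<integral>\<^sup>+x. ennreal (r x) * emeasure ?\<tau> A \<partial>?\<tau>) + (\<Sum>j\<in>J. \<integral>\<^sup>+x. w j x * indicator A (T x) \<partial>?\<tau>)"
      using A by (subst nn\<gamma>) auto
    also have "(\<integral>\<^sup>+x. ennreal (r x) * emeasure ?\<tau> A \<partial>?\<tau>) = ennreal \<omega> * emeasure ?\<tau> A"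
      by (simp add: nn_integral_multc[OF rm] rI)
    also have "(\<Sum>j\<in>J. \<integral>\<^sup>+x. w j x * indicator A (T x) \<partial>?\<tau>) = (\<integral>\<^sup>+x. (\<Sum>j\<in>J. w j x * indicator A (T x)) \<partial>?\<tau>)"
      by (rule nn_integral_sum[symmetric]) (use wm TA in measurable)
    also have "\<dots> = (\<integral>\<^sup>+x. ennreal (1 - \<omega>) * (ennreal (m0 x) * indicator A (T x)) \<partial>?\<tau>)"
    proof (rule nn_integral_cong)
      fix x
      have "(\<Sum>j\<in>J. w j x) = ennreal (\<Sum>j\<in>J. (1 - \<omega>) * q j x)"
        unfolding w_def using q(3) \<omega> by (intro sum_ennreal) auto
      also have "\<dots> = ennreal (1 - \<omega>) * ennreal (m0 x)"
        using \<omega> q(3) by (simp add: m0 sum_distrib_left[symmetric] ennreal_mult sum_nonneg)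
      finally show "(\<Sum>j\<in>J. w j x * indicator A (T x)) = ennreal (1 - \<omega>) * (ennreal (m0 x) * indicator A (T x))"
        by (simp add: sum_distrib_right[symmetric] mult.assoc)
    qed
    also have "\<dots> = ennreal (1 - \<omega>) * emeasure ?\<tau> A"
    proof -
      have "m0 = (\<lambda>x. \<Sum>j\<in>J. q j x)" using m0 by auto
      then have "m0 \<in> borel_measurable borel" using qb by (auto intro!: borel_measurable_sum)
      then have m0m: "(\<lambda>x. ennreal (m0 x)) \<in> borel_measurable ?\<tau>"
        by (intro measurable_torus_measure1) measurable
      have pull: "(\<integral>\<^sup>+x. ennreal (1 - \<omega>) * (ennreal (m0 x) * indicator A (T x)) \<partial>?\<tau>)
         = ennreal (1 - \<omega>) * (\<integral>\<^sup>+x. ennreal (m0 x) * indicator A (T x) \<partial>?\<tau>)"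
        by (rule nn_integral_cmult) (use m0m TA in measurable)
      have T': "T \<in> density ?\<tau> (\<lambda>x. ennreal (m0 x)) \<rightarrow>\<^sub>M ?\<tau>"
        using T by (simp add: measurable_cong_sets[OF sets_density refl])
      have "(\<integral>\<^sup>+x. ennreal (m0 x) * indicator A (T x) \<partial>?\<tau>)
          = (\<integral>\<^sup>+x. indicator A (T x) \<partial>density ?\<tau> (\<lambda>x. ennreal (m0 x)))"
        by (rule nn_integral_density[OF m0m TA, symmetric])
      also have "\<dots> = (\<integral>\<^sup>+y. indicator A y \<partial>distr (density ?\<tau> (\<lambda>x. ennreal (m0 x))) ?\<tau> T)"
        using A by (intro nn_integral_distr[OF T', symmetric]) simp
      also have "\<dots> = emeasure ?\<tau> A" unfolding push using A by simp
      finally show ?thesis by (simp only: pull)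
    qed
    also have "ennreal \<omega> * emeasure ?\<tau> A + \<dots> = emeasure ?\<tau> A"
      using \<omega> by (simp add: distrib_right[symmetric] ennreal_plus[symmetric] del: ennreal_plus)
    finally show "emeasure (distr \<gamma> ?\<tau> snd) A = emeasure ?\<tau> A" .
  qed simp

  have mem: "\<gamma> \<in> couplings ?\<mu> ?\<tau>"
    unfolding couplings_def using marg1 marg2
    by (simp add: sets\<gamma> sets_pair_measure_cong[OF sets_density refl])

  let ?c = "\<lambda>p. (torus_dist (fst p) (snd p))\<^sup>2"
  let ?C = "(1 - \<omega>) * (\<Sum>j\<in>J. torus_integral (\<lambda>x. q j x * D j x))"
  have cb: "?c \<in> borel_measurable borel" by measurable
  have cP: "(\<lambda>p. ennreal (?c p)) \<in> borel_measurable ?P"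
    by (rule measurable_torus_pair) measurable
  have D0: "0 \<le> D j x" if "j \<in> J" "x \<in> fundamental_domain" for j x
    using D(2)[OF that] by (rule order_trans[rotated]) simp
  have int0: "0 \<le> torus_integral (\<lambda>x. q j x * D j x)" if "j \<in> J" for j
    unfolding torus_integral_def using q(3) D0 that by (intro integral_nonneg_AE AE_I2) simp
  have "(\<integral>\<^sup>+p. ennreal (?c p) \<partial>\<gamma>) \<le> ennreal (2 * \<omega>) + (\<Sum>j\<in>J. ennreal ((1 - \<omega>) * torus_integral (\<lambda>x. q j x * D j x)))"
    unfolding nn\<gamma>[OF cP]
  proof (intro add_mono sum_mono)
    have "(\<integral>\<^sup>+x. ennreal (r x) * (\<integral>\<^sup>+y. ennreal (?c (x, y)) \<partial>?\<tau>) \<partial>?\<tau>) \<le> (\<integral>\<^sup>+x. ennreal (r x) * 2 \<partial>?\<tau>)"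
    proof (rule nn_integral_mono)
      fix x assume "x \<in> space ?\<tau>"
      then have "(\<integral>\<^sup>+y. ennreal (?c (x, y)) \<partial>?\<tau>) \<le> (\<integral>\<^sup>+y. 2 \<partial>?\<tau>)"
        using torus_dist_sq_le_2[of x] by (intro nn_integral_mono) (simp add: ennreal_le_iff[of 2, simplified])
      then show "ennreal (r x) * (\<integral>\<^sup>+y. ennreal (?c (x, y)) \<partial>?\<tau>) \<le> ennreal (r x) * 2"
        by (intro mult_left_mono) (auto simp: emeasure_torus_measure_space)
    qed
    also have "\<dots> = ennreal (2 * \<omega>)"
      using \<omega> by (simp add: nn_integral_multc[OF rm] rI ennreal_mult mult.commute)
    finally show "(\<integral>\<^sup>+x. ennreal (r x) * (\<integral>\<^sup>+y. ennreal (?c (x, y)) \<partial>?\<tau>) \<partial>?\<tau>) \<le> ennreal (2 * \<omega>)" .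
  next
    fix j assume j: "j \<in> J"
    have "(\<integral>\<^sup>+x. w j x * ennreal (?c (X j x, T x)) \<partial>?\<tau>) \<le> (\<integral>\<^sup>+x. ennreal ((1 - \<omega>) * (q j x * D j x)) \<partial>?\<tau>)"
    proof (rule nn_integral_mono)
      fix x assume "x \<in> space ?\<tau>"
      then have "?c (X j x, T x) \<le> D j x" using D(2)[OF j, of x] by (simp add: X_def)
      then show "w j x * ennreal (?c (X j x, T x)) \<le> ennreal ((1 - \<omega>) * (q j x * D j x))"
        using \<omega> q(3)[OF j, of x] unfolding w_def
        by (subst ennreal_mult[symmetric]) (auto intro!: ennreal_leI mult_left_mono simp: mult.assoc)
    qed
    also have "\<dots> = ennreal (\<integral>x. (1 - \<omega>) * (q j x * D j x) \<partial>?\<tau>)"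
    proof (rule nn_integral_eq_integral)
      show "integrable ?\<tau> (\<lambda>x. (1 - \<omega>) * (q j x * D j x))"
        by (intro torus_integrable continuous_on_mult continuous_on_const q(1) D(1) j)
      show "AE x in ?\<tau>. 0 \<le> (1 - \<omega>) * (q j x * D j x)"
        using \<omega> q(3)[OF j] D0[OF j] by (intro AE_I2) simp
    qed
    finally show "(\<integral>\<^sup>+x. w j x * ennreal (?c (X j x, T x)) \<partial>?\<tau>) \<le> ennreal ((1 - \<omega>) * torus_integral (\<lambda>x. q j x * D j x))"
      by (simp add: torus_integral_def)
  qed
  also have "\<dots> = ennreal (?C + 2 * \<omega>)"
  proof -
    have "(\<Sum>j\<in>J. ennreal ((1 - \<omega>) * torus_integral (\<lambda>x. q j x * D j x))) = ennreal ?C"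
      using \<omega> int0 by (subst sum_ennreal) (auto simp: sum_distrib_left)
    then show ?thesis
      using \<omega> int0 by (simp add: ennreal_plus[symmetric] sum_nonneg add.commute del: ennreal_plus)
  qed
  finally have le: "(\<integral>\<^sup>+p. ennreal (?c p) \<partial>\<gamma>) \<le> ennreal (?C + 2 * \<omega>)" .
  have "?c \<in> borel_measurable \<gamma>"
    unfolding measurable_cong_sets[OF sets\<gamma> refl] by (rule measurable_torus_pair[OF cb])
  then have "(\<integral>p. ?c p \<partial>\<gamma>) = enn2real (\<integral>\<^sup>+p. ennreal (?c p) \<partial>\<gamma>)"
    by (rule integral_eq_nn_integral) simp
  also have "\<dots> \<le> ?C + 2 * \<omega>"
    using le \<omega> int0 by (intro enn2real_leI) (auto intro!: add_nonneg_nonneg mult_nonneg_nonneg sum_nonneg)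
  finally show ?thesis using that[OF mem] by simp
qed

section \<open>Mean-zero functions as divergences\<close>

text \<open>The unit vectors generate the lattice; the induction over the integers runs upwards and
  downwards from 0.\<close>

lemma periodicI:
  assumes "\<And>i x. f (x + axis i 1) = f x"
  shows "periodic f"
  unfolding periodic_def
proof (intro allI ballI)
  have int: "f (x + of_int n *\<^sub>R axis i 1) = f x" for x i n
  proof (induction n rule: int_induct[where k=0])
    case (step1 n)
    then show ?case using assms[of "x + of_int n *\<^sub>R axis i 1" i] by (simp add: algebra_simps)
  next
    case (step2 n)
    then show ?case using assms[of "x + of_int (n - 1) *\<^sub>R axis i 1" i] by (simp add: algebra_simps)
  qed simp
  fix x k :: "real^2" assume "k \<in> int_lattice"
  then obtain n1 n2 where n: "k $ 1 = of_int n1" "k $ 2 = of_int n2"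
    by (auto simp: int_lattice_def) (metis Ints_cases)
  then have "k = of_int n1 *\<^sub>R axis 1 1 + of_int n2 *\<^sub>R axis 2 1"
    by (simp add: vec_eq_iff forall_2 axis_def)
  then show "f (x + k) = f x"
    using int[of "x + of_int n1 *\<^sub>R axis 1 1" n2 2] int[of x n1 1] by (simp add: add.assoc)
qed

text \<open>The oriented integral from 0, a primitive on the whole line rather than on a fixed
  interval, so that it can be shifted freely.\<close>

lemma primitive_on_line:
  fixes p :: "real \<Rightarrow> real"
  assumes p: "continuous_on UNIV p"
  obtains P where "\<And>s. (P has_real_derivative p s) (at s)"
    "\<And>a b. a \<le> b \<Longrightarrow> integral {a..b} p = P b - P a"
proof -
  define P where "P s = (if 0 \<le> s then integral {0..s} p else - integral {s..0} p)" for s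
  have int: "p integrable_on {a..b}" for a b
    by (rule integrable_continuous_interval[OF continuous_on_subset[OF p]]) simp
  have eq: "P s = integral {-N..s} p - integral {-N..0} p" if "-N \<le> s" "0 \<le> N" for N s
    using Henstock_Kurzweil_Integration.integral_combine[OF _ _ int, of "-N" 0 s]
      Henstock_Kurzweil_Integration.integral_combine[OF _ _ int, of "-N" s 0] that
    by (auto simp: P_def)
  have der: "(P has_real_derivative p s) (at s)" for s
  proof -
    \<comment> \<open>On the symmetric interval \<open>P\<close> differs from the integral starting
      at \<open>-N\<close> by a constant, and \<open>s\<close> is an interior point, so the
      one-interval derivative is a full derivative.\<close>
    define N where "N = \<bar>s\<bar> + 1"
    have "((\<lambda>u. integral {-N..u} p) has_real_derivative p s) (at s within {-N..N})"
      by (rule integral_has_real_derivative[OF continuous_on_subset[OF p]]) (auto simp: N_def)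
    then have "((\<lambda>u. integral {-N..u} p - integral {-N..0} p) has_real_derivative p s) (at s within {-N..N})"
      by (auto intro!: derivative_eq_intros)
    then have "(P has_real_derivative p s) (at s within {-N..N})"
      by (rule has_field_derivative_transform_within[OF _ zero_less_one]) (use eq[of N] in \<open>auto simp: N_def\<close>)
    moreover have "s \<in> interior {-N..N}"
      using abs_ge_self[of s] abs_ge_minus_self[of s] unfolding N_def interior_atLeastAtMost_real by simp
    ultimately show ?thesis by (simp only: at_within_interior[of s "{-N..N}"])
  qed
  have "integral {a..b} p = P b - P a" if "a \<le> b" for a b
    using fundamental_theorem_of_calculus[OF that, of P p] der
    by (intro integral_unique) (auto simp: has_real_derivative_iff_has_vector_derivative[symmetric] intro: has_field_derivative_at_within)
  with der show ?thesis by (rule that)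
qed

text \<open>The mean over a closed line of the torus in direction \<open>i\<close>. It is the
  obstruction to a periodic primitive in that direction.\<close>

definition line_average :: "2 \<Rightarrow> (real^2 \<Rightarrow> real) \<Rightarrow> real^2 \<Rightarrow> real" where
  "line_average i f x = integral {0..1} (\<lambda>t. f (x + t *\<^sub>R axis i 1))"

lemma continuous_on_line: "continuous_on UNIV f \<Longrightarrow> continuous_on UNIV (\<lambda>t. f (x + t *\<^sub>R e))"
  for f :: "real^2 \<Rightarrow> real"
  by (erule continuous_on_compose2) (auto intro!: continuous_intros)

lemma continuous_line_average:
  assumes "continuous_on UNIV f"
  shows "continuous_on UNIV (line_average i f)"
proof -
  have "continuous_on (UNIV \<times> cbox 0 1) (\<lambda>(x, t). f (x + t *\<^sub>R axis i 1))"
    unfolding split_beta by (rule continuous_on_compose2[OF assms]) (auto intro!: continuous_intros)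
  from integral_continuous_on_param[OF this] show ?thesis
    by (simp add: line_average_def[abs_def])
qed

lemma periodic_line_average: "periodic f \<Longrightarrow> periodic (line_average i f)"
  unfolding periodic_def line_average_def
proof (intro allI ballI)
  fix x k assume f: "\<forall>x. \<forall>k\<in>int_lattice. f (x + k) = f x" and "k \<in> int_lattice"
  then have "f (x + t *\<^sub>R axis i 1 + k) = f (x + t *\<^sub>R axis i 1)" for t
    by blast
  then have "f (x + k + t *\<^sub>R axis i 1) = f (x + t *\<^sub>R axis i 1)" for t
    by (simp add: add.assoc add.commute[of k])
  then show "integral {0..1} (\<lambda>t. f (x + k + t *\<^sub>R axis i 1)) = integral {0..1} (\<lambda>t. f (x + t *\<^sub>R axis i 1))"
    by simp
qed

text \<open>In terms of a primitive \<open>P\<close> along the line the average is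
  \<open>P (s + 1) - P s\<close>, whose derivative in \<open>s\<close> vanishes by
  periodicity.\<close>

lemma line_average_shift:
  assumes f: "continuous_on UNIV f" "periodic f"
  shows "line_average i f (x + s *\<^sub>R axis i 1) = line_average i f x"
proof -
  obtain P where P: "\<And>s. (P has_real_derivative f (x + s *\<^sub>R axis i 1)) (at s)"
    "\<And>a b. a \<le> b \<Longrightarrow> integral {a..b} (\<lambda>t. f (x + t *\<^sub>R axis i 1)) = P b - P a"
    using primitive_on_line[OF continuous_on_line[OF f(1), of x "axis i 1"]] by metis
  have avg: "line_average i f (x + s *\<^sub>R axis i 1) = P (s + 1) - P s" for s
  proof -
    have "((\<lambda>t. P (t + s)) has_vector_derivative f (x + (t + s) *\<^sub>R axis i 1)) (at t within {0..1})" for t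
      using DERIV_shift[of P _ t s] P(1)[of "t + s"]
      by (auto simp: has_real_derivative_iff_has_vector_derivative[symmetric] intro: has_field_derivative_at_within)
    then have "((\<lambda>t. f (x + (t + s) *\<^sub>R axis i 1)) has_integral P (1 + s) - P (0 + s)) {0..1}"
      by (intro fundamental_theorem_of_calculus) auto
    moreover have "(\<lambda>t. f (x + s *\<^sub>R axis i 1 + t *\<^sub>R axis i 1)) = (\<lambda>t. f (x + (t + s) *\<^sub>R axis i 1))"
      by (simp add: algebra_simps)
    ultimately show ?thesis
      by (simp add: line_average_def integral_unique add.commute[of 1 s])
  qed
  have "((\<lambda>s. P (s + 1) - P s) has_real_derivative 0) (at s)" for s
  proof -
    have "f (x + (s + 1) *\<^sub>R axis i 1) = f (x + s *\<^sub>R axis i 1)"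
      using periodicD[OF f(2) lattice_axis, of "x + s *\<^sub>R axis i 1" i] by (simp add: algebra_simps)
    moreover have "((\<lambda>s. P (s + 1)) has_real_derivative f (x + (s + 1) *\<^sub>R axis i 1)) (at s)"
      using DERIV_shift[of P _ s 1] P(1)[of "s + 1"] by simp
    ultimately show ?thesis
      using DERIV_diff[OF _ P(1)[of s]] by fastforce
  qed
  then have "P (s + 1) - P s = P (0 + 1) - P 0" by (intro DERIV_isconst_all) auto
  then show ?thesis using avg[of s] avg[of 0] by simp
qed

text \<open>Exchange the two integrals; for each fixed \<open>t\<close> the inner one is the
  integral of a translate of \<open>f\<close>.\<close>

lemma torus_integral_line_average:
  assumes f: "continuous_on UNIV f" "periodic f"
  shows "torus_integral (line_average i f) = torus_integral f"
proof -
  have c: "continuous_on (cbox (0, 0) (1, 1)) (\<lambda>(x, t). f (x + t *\<^sub>R axis i 1))"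
    unfolding split_beta by (rule continuous_on_compose2[OF f(1)]) (auto intro!: continuous_intros)
  have "torus_integral (line_average i f) = integral (cbox 0 1) (\<lambda>x. integral (cbox 0 1) (\<lambda>t. f (x + t *\<^sub>R axis i 1)))"
    unfolding torus_integral_eq_integral[OF continuous_line_average[OF f(1)]]
    unfolding line_average_def[abs_def] by simp
  also have "\<dots> = integral (cbox 0 1) (\<lambda>t. integral (cbox 0 1) (\<lambda>x. f (x + t *\<^sub>R axis i 1)))"
    by (rule integral_swap_continuous[OF c])
  also have "\<dots> = integral (cbox 0 (1::real)) (\<lambda>t. torus_integral f)"
  proof (rule integral_cong)
    fix t :: real
    show "integral (cbox 0 1) (\<lambda>x. f (x + t *\<^sub>R axis i 1)) = torus_integral f"
      using torus_integral_translation[OF borel_measurable_continuous_onI[OF f(1)] f(2), of "t *\<^sub>R axis i 1"]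
      by (simp add: torus_integral_eq_integral continuous_on_shift[OF f(1)])
  qed
  finally show ?thesis by simp
qed

text \<open>Integration along direction \<open>i\<close> starting where the coordinate
  \<open>x $ i\<close> is 0. The zero line average makes the result periodic in direction
  \<open>i\<close>; in the other direction periodicity is inherited from \<open>k\<close>.\<close>

lemma periodic_primitive:
  assumes k: "continuous_on UNIV k" "periodic k" and avg: "\<And>x. line_average i k x = 0"
  obtains V where "continuous_on UNIV V" "periodic V" "has_partial i V k"
proof -
  \<comment> \<open>The integral of \<open>k\<close> over the coordinate range from 0 to
    \<open>x $ i\<close>, rescaled to the unit interval: at parameter \<open>u\<close> the point has
    \<open>i\<close>-th coordinate \<open>u * x $ i\<close>. A domain of integration independent of
    \<open>x\<close> gives continuity in \<open>x\<close>, and negative coordinates need no separate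
    case.\<close>
  define V where "V x = x $ i * integral (cbox 0 1) (\<lambda>u. k (x + ((u - 1) * x $ i) *\<^sub>R axis i 1))" for x
  have "continuous_on (UNIV \<times> cbox 0 1) (\<lambda>(x, u). k (x + ((u - 1) * x $ i) *\<^sub>R axis i 1))"
    unfolding split_beta by (rule continuous_on_compose2[OF k(1)]) (auto intro!: continuous_intros)
  from integral_continuous_on_param[OF this] have cont: "continuous_on UNIV V"
    unfolding V_def[abs_def] by (intro continuous_intros) auto
  \<comment> \<open>On the line through \<open>x\<close> the function \<open>V\<close> is a
    primitive of \<open>k\<close> up to a constant; \<open>- x $ i\<close> is the parameter at which
    the coordinate vanishes. The substitution \<open>?l\<close> below runs from that parameter at
    \<open>u = 0\<close> to \<open>s\<close> at \<open>u = 1\<close>.\<close>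
  have on_line: "\<exists>P. (\<forall>s. (P has_real_derivative k (x + s *\<^sub>R axis i 1)) (at s)) \<and>
      (\<forall>s. V (x + s *\<^sub>R axis i 1) = P s - P (- x $ i)) \<and> P 1 = P 0" for x
  proof -
    obtain P where P: "\<And>s. (P has_real_derivative k (x + s *\<^sub>R axis i 1)) (at s)"
      "\<And>a b. a \<le> b \<Longrightarrow> integral {a..b} (\<lambda>t. k (x + t *\<^sub>R axis i 1)) = P b - P a"
      using primitive_on_line[OF continuous_on_line[OF k(1), of x "axis i 1"]] by metis
    have "V (x + s *\<^sub>R axis i 1) = P s - P (- x $ i)" for s
    proof -
      let ?l = "\<lambda>u. s + (u - 1) * (x $ i + s)"
      have "((\<lambda>u. P (?l u)) has_vector_derivative (x $ i + s) * k (x + ?l u *\<^sub>R axis i 1)) (at u within {0..1})" for u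
      proof -
        have "(?l has_real_derivative (x $ i + s)) (at u)" by (auto intro!: derivative_eq_intros)
        from DERIV_chain2[OF P(1) this]
        show ?thesis
          by (auto simp: has_real_derivative_iff_has_vector_derivative[symmetric] mult.commute intro: has_field_derivative_at_within)
      qed
      then have "((\<lambda>u. (x $ i + s) * k (x + ?l u *\<^sub>R axis i 1)) has_integral P (?l 1) - P (?l 0)) {0..1}"
        by (intro fundamental_theorem_of_calculus) auto
      moreover have "x + s *\<^sub>R axis i 1 + ((u - 1) * (x $ i + s)) *\<^sub>R axis i 1 = x + ?l u *\<^sub>R axis i 1" for u
        by (simp add: algebra_simps)
      moreover have "(x + s *\<^sub>R axis i 1) $ i = x $ i + s" by (simp add: axis_def)
      ultimately have "V (x + s *\<^sub>R axis i 1) = P (?l 1) - P (?l 0)"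
        by (simp only: V_def integral_mult_right[symmetric] interval_cbox[symmetric] integral_unique)
      then show ?thesis by simp
    qed
    moreover have "P 1 = P 0"
      using P(2)[of 0 1] avg[of x] by (simp add: line_average_def)
    ultimately show ?thesis using P(1) by blast
  qed
  have hp: "has_partial i V k"
    unfolding has_partial_def
  proof
    fix x
    obtain P where P: "\<And>s. (P has_real_derivative k (x + s *\<^sub>R axis i 1)) (at s)"
      "\<And>s. V (x + s *\<^sub>R axis i 1) = P s - P (- x $ i)" using on_line[of x] by blast
    show "((\<lambda>s. V (x + s *\<^sub>R axis i 1)) has_real_derivative k x) (at 0)"
      unfolding P(2) using P(1)[of 0] by (auto intro!: derivative_eq_intros)
  qed
  have per: "periodic V"
  proof (rule periodicI)
    fix x :: "real^2" and j :: 2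
    show "V (x + axis j 1) = V x"
    proof (cases "j = i")
      case True
      obtain P where "\<And>s. V (x + s *\<^sub>R axis i 1) = P s - P (- x $ i)" "P 1 = P 0" using on_line[of x] by blast
      from this(1)[of 1] this(1)[of 0] this(2) show ?thesis by (simp add: True)
    next
      case False
      have "k (x + axis j 1 + c *\<^sub>R axis i 1) = k (x + c *\<^sub>R axis i 1)" for c
        using periodicD[OF k(2) lattice_axis, of "x + c *\<^sub>R axis i 1" j] by (simp add: ac_simps)
      then show ?thesis using False by (simp add: V_def axis_def[of j])
    qed
  qed
  show ?thesis by (rule that[OF cont per hp])
qed

text \<open>Split \<open>h\<close> into its average \<open>a\<close> along direction 1 and the rest
  \<open>k\<close>. The rest has zero averages in direction 1, hence a periodic primitive there. The
  function \<open>a\<close> depends on the coordinate 2 only, so its average in direction 2 is a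
  constant, namely the integral of \<open>h\<close>, which is 0; hence \<open>a\<close> has a
  periodic primitive in direction 2.\<close>

lemma mean_zero_eq_divergence:
  assumes h: "continuous_on UNIV h" "periodic h" "torus_integral h = 0"
  obtains V g :: "2 \<Rightarrow> real^2 \<Rightarrow> real" where
    "\<And>i. continuous_on UNIV (V i)" "\<And>i. periodic (V i)"
    "\<And>i. continuous_on UNIV (g i)" "\<And>i. periodic (g i)"
    "\<And>i. has_partial i (V i) (g i)" "\<And>x. h x = g 1 x + g 2 x"
proof -
  define a where "a = line_average 1 h"
  define k where "k x = h x - a x" for x
  have a: "continuous_on UNIV a" "periodic a"
    unfolding a_def by (intro continuous_line_average periodic_line_average h)+
  have k: "continuous_on UNIV k" "periodic k"
    unfolding k_def[abs_def] by (intro continuous_on_diff periodic_diff a h)+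
  have int: "f integrable_on {0..1}" if "continuous_on UNIV f" for f :: "real \<Rightarrow> real"
    by (rule integrable_continuous_interval[OF continuous_on_subset[OF that]]) simp
  have "line_average 1 k x = 0" for x
  proof -
    have "line_average 1 k x = line_average 1 h x - line_average 1 a x"
      unfolding line_average_def k_def
      by (intro Henstock_Kurzweil_Integration.integral_diff int continuous_on_line h a)
    also have "line_average 1 a x = integral {0..1} (\<lambda>t::real. a x)"
      unfolding line_average_def[of 1 a] by (simp add: a_def line_average_shift[OF h(1,2)])
    finally show ?thesis by (simp add: a_def)
  qed
  then obtain V1 where V1: "continuous_on UNIV V1" "periodic V1" "has_partial 1 V1 k"
    using periodic_primitive[OF k] by metis
  have "line_average 2 a x = 0" for x
  proof -
    have "a (y + s *\<^sub>R axis 1 1 + t *\<^sub>R axis 2 1) = a (y + t *\<^sub>R axis 2 1)" for y s t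
      using line_average_shift[OF h(1,2), of 1 "y + t *\<^sub>R axis 2 1" s] by (simp add: a_def ac_simps)
    then have s1: "line_average 2 a (y + s *\<^sub>R axis 1 1) = line_average 2 a y" for y s
      unfolding line_average_def[of 2 a] by simp
    \<comment> \<open>Averaging in direction 2 removes the dependence on coordinate 2, and
      \<open>s1\<close> removes the one on coordinate 1.\<close>
    have const: "line_average 2 a y = line_average 2 a 0" for y
    proof -
      have "y = 0 + (y $ 1) *\<^sub>R axis 1 1 + (y $ 2) *\<^sub>R axis 2 1"
        by (simp add: vec_eq_iff forall_2 axis_def)
      then have "line_average 2 a y = line_average 2 a ((0 + (y $ 1) *\<^sub>R axis 1 1) + (y $ 2) *\<^sub>R axis 2 1)"
        by (rule arg_cong)
      also have "\<dots> = line_average 2 a 0"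
        by (simp only: line_average_shift[OF a] s1)
      finally show ?thesis .
    qed
    have "torus_integral a = torus_integral (line_average 2 a)"
      by (rule torus_integral_line_average[OF a, symmetric])
    also have "line_average 2 a = (\<lambda>y. line_average 2 a 0)" using const by (rule ext)
    finally have "torus_integral a = line_average 2 a 0" by simp
    moreover have "torus_integral a = 0"
      unfolding a_def torus_integral_line_average[OF h(1,2)] by (rule h(3))
    ultimately show ?thesis using const[of x] by simp
  qed
  then obtain V2 where V2: "continuous_on UNIV V2" "periodic V2" "has_partial 2 V2 a"
    using periodic_primitive[OF a] by metis
  have two: "i = 1 \<or> i = 2" for i :: 2 by (rule exhaust_2)
  show ?thesis
  proof (rule that[of "\<lambda>i. if i = 1 then V1 else V2" "\<lambda>i. if i = 1 then k else a"])
    fix i :: 2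
    show "has_partial i (if i = 1 then V1 else V2) (if i = 1 then k else a)"
      using V1(3) V2(3) two[of i] by auto
  qed (use V1 V2 a k in \<open>auto simp: k_def\<close>)
qed

section \<open>First variation of the transport cost\<close>

lemma torus_dist_proj_le: "torus_dist (torus_proj a) (torus_proj b) \<le> norm (a - b)"
proof -
  let ?k = "(b - torus_proj b) - (a - torus_proj a)"
  have "?k \<in> int_lattice"
    using torus_proj_diff_lattice[of a] torus_proj_diff_lattice[of b] by (auto simp: int_lattice_def)
  from torus_dist_le[OF this, of "torus_proj a" "torus_proj b"] show ?thesis by simp
qed

lemma scaled_measure_integral:
  assumes "\<rho> \<in> borel_measurable borel" "\<And>x. 0 \<le> 1 + \<epsilon> * \<rho> x" "f \<in> borel_measurable borel"
  shows "(\<integral>x. f x \<partial>scaled_measure \<epsilon> \<rho>) = torus_integral (\<lambda>x. (1 + \<epsilon> * \<rho> x) * f x)"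
proof -
  have "(\<lambda>x. 1 + \<epsilon> * \<rho> x) \<in> borel_measurable borel" using assms(1) by measurable
  from integral_density[OF measurable_torus_measure1[OF assms(3)] measurable_torus_measure1[OF this] AE_I2] assms(2)
  show ?thesis by (simp add: scaled_measure_def torus_integral_def)
qed

lemma finite_measure_scaled_measure:
  assumes "continuous_on UNIV \<rho>"
  shows "finite_measure (scaled_measure \<epsilon> \<rho>)"
proof (rule finite_measureI)
  have c: "continuous_on UNIV (\<lambda>x. 1 + \<epsilon> * \<rho> x)" by (intro continuous_intros assms)
  have m: "(\<lambda>x. ennreal (1 + \<epsilon> * \<rho> x)) \<in> borel_measurable torus_measure"
    by (intro measurable_torus_measure1) (use borel_measurable_continuous_onI[OF c] in measurable)
  have "emeasure (scaled_measure \<epsilon> \<rho>) (space torus_measure) = (\<integral>\<^sup>+x. ennreal (1 + \<epsilon> * \<rho> x) \<partial>torus_measure)"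
    unfolding scaled_measure_def by (subst emeasure_density[OF m sets.top]) (auto intro!: nn_integral_cong)
  also have "\<dots> \<le> (\<integral>\<^sup>+x. ennreal (norm (1 + \<epsilon> * \<rho> x)) \<partial>torus_measure)"
    by (intro nn_integral_mono ennreal_leI) simp
  also have "\<dots> < \<infinity>"
    using torus_integrable[OF c] unfolding integrable_iff_bounded by blast
  finally show "emeasure (scaled_measure \<epsilon> \<rho>) (space (scaled_measure \<epsilon> \<rho>)) \<noteq> \<infinity>"
    by (simp add: scaled_measure_def)
qed

text \<open>The mean squared displacement of the planar map
  \<open>x + \<epsilon> \<nabla>\<psi>\<close>. That it equals the squared Wasserstein distance
  comes out of the upper and lower bounds at \<open>s = 0\<close>.\<close>

definition transport_cost :: "real \<Rightarrow> (real^2 \<Rightarrow> real) \<Rightarrow> (real^2 \<Rightarrow> real) \<Rightarrow> real" where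
  "transport_cost \<epsilon> \<rho> \<psi> = torus_integral (\<lambda>x. (1 + \<epsilon> * \<rho> x) * (norm (\<epsilon> *\<^sub>R gradient \<psi> x))\<^sup>2)"

lemma continuous_on_gradient: "torus_smooth \<psi> \<Longrightarrow> continuous_on UNIV (gradient \<psi>)"
  unfolding gradient_def[abs_def]
  by (intro continuous_on_vec_lambda torus_smooth_continuous torus_smooth_partial)

text \<open>Kantorovich duality with the potentials \<open>-2\<epsilon>\<psi>\<close> and twice the c-transform of \<open>\<epsilon>\<psi>\<close>; they are
  optimal for \<open>\<rho>\<close> and merely admissible for \<open>\<rho>'\<close>.\<close>

lemma transport_lower_bound:
  assumes pot: "is_sg_potential \<epsilon> \<rho> \<psi>" and adm: "admissible \<epsilon> \<rho>"
    and \<rho>': "continuous_on UNIV \<rho>'" "\<And>x. 0 \<le> 1 + \<epsilon> * \<rho>' x"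
    and \<gamma>: "\<gamma> \<in> couplings (scaled_measure \<epsilon> \<rho>') torus_measure"
  shows "transport_cost \<epsilon> \<rho> \<psi> - 2 * \<epsilon>\<^sup>2 * torus_integral (\<lambda>x. \<psi> x * (\<rho>' x - \<rho> x))
    \<le> (\<integral>p. (torus_dist (fst p) (snd p))\<^sup>2 \<partial>\<gamma>)"
proof -
  have \<psi>: "torus_smooth \<psi>" and conv: "convex_on UNIV (convex_potential \<epsilon> \<psi>)"
    and opt: "optimal_map (scaled_measure \<epsilon> \<rho>) torus_measure (\<lambda>x. torus_proj (gradient (convex_potential \<epsilon> \<psi>) x))"
    using pot by (auto simp: is_sg_potential_def)
  have \<rho>: "torus_smooth \<rho>" "\<And>x. 0 \<le> 1 + \<epsilon> * \<rho> x" using adm by (auto simp: admissible_def less_imp_le)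
  define f where "f x = \<epsilon> * \<psi> x" for x
  have f: "torus_smooth f" unfolding f_def[abs_def] by (intro torus_smooth_intros \<psi>)
  note cf = torus_smooth_continuous[OF f] and pf = torus_smooth_periodic[OF f]
  obtain B where B: "\<And>x. \<bar>f x\<bar> \<le> B" using continuous_periodic_bounded[OF cf pf] by metis
  note K = c_transform_bounded[OF cf pf B] c_transform_measurable[OF cf pf B]
    c_transform_periodic[OF cf pf B] c_transform_dual[OF cf pf B]
  let ?K = "c_transform f" and ?G = "\<lambda>x. (norm (\<epsilon> *\<^sub>R gradient \<psi> x))\<^sup>2"
  have cG: "continuous_on UNIV ?G"
    by (intro continuous_on_power continuous_on_norm continuous_on_scaleR continuous_on_const continuous_on_gradient \<psi>)
  define T where "T x = torus_proj (gradient (convex_potential \<epsilon> \<psi>) x)" for x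
  have T: "T \<in> scaled_measure \<epsilon> \<rho> \<rightarrow>\<^sub>M torus_measure" "distr (scaled_measure \<epsilon> \<rho>) torus_measure T = torus_measure"
    using opt by (simp_all add: optimal_map_def T_def[abs_def])
  have KT: "?K (T x) = ?G x / 2 + f x" for x
    unfolding T_def periodic_proj[OF K(3)] using c_transform_gradient[OF \<psi> conv, of x] by (simp add: f_def[abs_def])
  \<comment> \<open>The target integral is pulled back through \<open>T\<close> to the source, where
    \<open>KT\<close> makes the c-transform explicit.\<close>
  have "torus_integral ?K = (\<integral>y. ?K y \<partial>distr (scaled_measure \<epsilon> \<rho>) torus_measure T)"
    by (simp add: T(2) torus_integral_def)
  also have "\<dots> = (\<integral>x. ?K (T x) \<partial>scaled_measure \<epsilon> \<rho>)"
    by (intro integral_distr T(1) measurable_torus_measure1 K(2))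
  also have "\<dots> = torus_integral (\<lambda>x. (1 + \<epsilon> * \<rho> x) * (?G x / 2 + f x))"
    unfolding KT
    by (intro scaled_measure_integral borel_measurable_continuous_onI torus_smooth_continuous[OF \<rho>(1)] \<rho>(2)
        continuous_on_add continuous_on_divide cG cf continuous_on_const) auto
  finally have IK: "torus_integral ?K = torus_integral (\<lambda>x. (1 + \<epsilon> * \<rho> x) * (?G x / 2 + f x))" .
  have "(\<integral>x. - 2 * f x \<partial>scaled_measure \<epsilon> \<rho>') + (\<integral>y. 2 * ?K y \<partial>torus_measure)
    \<le> (\<integral>p. (torus_dist (fst p) (snd p))\<^sup>2 \<partial>\<gamma>)"
  proof (rule coupling_dual_bound[OF \<gamma> _ refl finite_measure_scaled_measure[OF \<rho>'(1)], of _ _ "2 * B" "2 * B"])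
    show "\<bar>- 2 * f x\<bar> \<le> 2 * B" for x using B[of x] by simp
    show "\<bar>2 * ?K x\<bar> \<le> 2 * B" for x using K(1)[of x] by simp
    show "- 2 * f x + 2 * ?K y \<le> (torus_dist x y)\<^sup>2" for x y using K(4)[of y x] by simp
    show "(\<lambda>x. - 2 * f x) \<in> borel_measurable borel" using borel_measurable_continuous_onI[OF cf] by measurable
    show "(\<lambda>x. 2 * ?K x) \<in> borel_measurable borel" using K(2) by measurable
  qed (simp add: scaled_measure_def)
  also have "(\<integral>x. - 2 * f x \<partial>scaled_measure \<epsilon> \<rho>') = torus_integral (\<lambda>x. (1 + \<epsilon> * \<rho>' x) * (- 2 * f x))"
    by (intro scaled_measure_integral borel_measurable_continuous_onI \<rho>' continuous_on_mult cf continuous_on_const)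
  also have "(\<integral>y. 2 * ?K y \<partial>torus_measure) = torus_integral (\<lambda>x. 2 * ((1 + \<epsilon> * \<rho> x) * (?G x / 2 + f x)))"
    unfolding torus_integral_cmult IK[symmetric] by (simp add: torus_integral_def)
  also have "torus_integral (\<lambda>x. (1 + \<epsilon> * \<rho>' x) * (- 2 * f x)) + torus_integral (\<lambda>x. 2 * ((1 + \<epsilon> * \<rho> x) * (?G x / 2 + f x)))
    = torus_integral (\<lambda>x. (1 + \<epsilon> * \<rho>' x) * (- 2 * f x) + 2 * ((1 + \<epsilon> * \<rho> x) * (?G x / 2 + f x)))"
    by (intro torus_integral_add[symmetric] continuous_on_mult continuous_on_add continuous_on_divide continuous_on_const
        cf cG torus_smooth_continuous[OF \<rho>(1)] \<rho>') auto
  \<comment> \<open>The terms \<open>2 f\<close> cancel up to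
    \<open>2 f \<epsilon> (\<rho> - \<rho>')\<close>, which with
    \<open>f = \<epsilon> \<psi>\<close> is the first variation.\<close>
  also have "(\<lambda>x. (1 + \<epsilon> * \<rho>' x) * (- 2 * f x) + 2 * ((1 + \<epsilon> * \<rho> x) * (?G x / 2 + f x)))
    = (\<lambda>x. (1 + \<epsilon> * \<rho> x) * ?G x - 2 * \<epsilon>\<^sup>2 * (\<psi> x * (\<rho>' x - \<rho> x)))"
    by (rule ext) (simp add: f_def algebra_simps power2_eq_square del: norm_scaleR)
  also have "torus_integral \<dots> = transport_cost \<epsilon> \<rho> \<psi> - torus_integral (\<lambda>x. 2 * \<epsilon>\<^sup>2 * (\<psi> x * (\<rho>' x - \<rho> x)))"
    unfolding transport_cost_def
    by (intro torus_integral_diff continuous_on_mult continuous_on_add continuous_on_diff continuous_on_const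
        torus_smooth_continuous[OF \<rho>(1)] torus_smooth_continuous[OF \<psi>] \<rho>' cG)
  finally show ?thesis by (simp only: torus_integral_cmult)
qed

text \<open>Writing \<open>h = \<partial>\<^sub>1V\<^sub>1 + \<partial>\<^sub>2V\<^sub>2\<close>, the part \<open>q\<^sub>j = d (B - V\<^sub>j)\<close> of the density \<open>1 + \<epsilon>\<rho>\<close> is translated by
  \<open>\<epsilon>s/d\<close> along the \<open>j\<close>-th axis, which changes the density by \<open>\<epsilon>s\<partial>\<^sub>jV\<^sub>j + o(s)\<close>; the error of order
  \<open>o(s)\<close> is corrected by mixing with a product measure.\<close>

lemma transport_upper_bound:
  assumes pot: "is_sg_potential \<epsilon> \<rho> \<psi>" and adm: "admissible \<epsilon> \<rho>" and \<epsilon>: "\<epsilon> > 0"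
    and h: "continuous_on UNIV h" "periodic h" "torus_integral h = 0" and \<eta>: "\<eta> > 0"
  obtains \<delta> where "\<delta> > 0" "\<And>s. \<bar>s\<bar> < \<delta> \<Longrightarrow>
    \<exists>\<gamma>\<in>couplings (scaled_measure \<epsilon> (\<lambda>x. \<rho> x + s * h x)) torus_measure.
      (\<integral>p. (torus_dist (fst p) (snd p))\<^sup>2 \<partial>\<gamma>)
        \<le> transport_cost \<epsilon> \<rho> \<psi> - 2 * \<epsilon>\<^sup>2 * s * torus_integral (\<lambda>x. \<psi> x * h x) + \<eta> * \<bar>s\<bar>"
proof -
  have \<psi>: "torus_smooth \<psi>"
    and opt: "optimal_map (scaled_measure \<epsilon> \<rho>) torus_measure (\<lambda>x. torus_proj (gradient (convex_potential \<epsilon> \<psi>) x))"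
    using pot by (auto simp: is_sg_potential_def)
  have \<rho>: "torus_smooth \<rho>" "torus_integral \<rho> = 0" "\<And>x. 0 < 1 + \<epsilon> * \<rho> x" using adm by (auto simp: admissible_def)
  note c\<psi> = torus_smooth_continuous[OF \<psi>] and p\<psi> = torus_smooth_periodic[OF \<psi>]
  note c\<rho> = torus_smooth_continuous[OF \<rho>(1)] and p\<rho> = torus_smooth_periodic[OF \<rho>(1)]
  define m0 where "m0 x = 1 + \<epsilon> * \<rho> x" for x
  have cm0: "continuous_on UNIV m0" unfolding m0_def[abs_def] by (intro continuous_intros c\<rho>)
  have pm0: "periodic m0" using p\<rho> by (simp add: periodic_def m0_def)
  have Im0: "torus_integral m0 = 1"
    unfolding m0_def[abs_def] using \<rho>(2)
    by (simp add: torus_integral_add continuous_intros c\<rho> torus_integral_cmult)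
  obtain c where c: "c > 0" "\<And>x. c \<le> m0 x"
    using continuous_periodic_attains_inf[OF cm0 pm0] \<rho>(3) by (metis m0_def)
  obtain V g where V: "\<And>i. continuous_on UNIV (V i)" "\<And>i. periodic (V i)"
    and g: "\<And>i. continuous_on UNIV (g i)" "\<And>i. periodic (g i)"
    and Vg: "\<And>i. has_partial i (V i) (g i)" and hg: "\<And>x. h x = g 1 x + g 2 x"
    using mean_zero_eq_divergence[OF h] by metis
  obtain B1 where B1: "B1 > 0" "\<And>x. \<bar>V 1 x\<bar> \<le> B1" using continuous_periodic_bounded[OF V] by metis
  obtain B2 where B2: "B2 > 0" "\<And>x. \<bar>V 2 x\<bar> \<le> B2" using continuous_periodic_bounded[OF V] by metis
  define B where "B = max B1 B2"
  have B: "B > 0" "\<bar>V i x\<bar> \<le> B" for i x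
    using B1(1) B2(1) B1(2)[of x] B2(2)[of x] exhaust_2[of i] by (auto simp: B_def)
  \<comment> \<open>As \<open>B - V i\<close> lies between 0 and \<open>2 B\<close>, each moved
    piece is at most \<open>c / 4\<close>. The two together take at most \<open>c / 2\<close>, and
    the part at rest, indexed by \<open>None\<close>, keeps at least \<open>c / 2\<close>.\<close>
  define d where "d = c / (8 * B)"
  have d: "d > 0" using c(1) B(1) by (simp add: d_def)
  define q where "q j x = (case j of Some i \<Rightarrow> d * (B - V i x) | None \<Rightarrow> m0 x - d * (B - V 1 x) - d * (B - V 2 x))" for j x
  have qS: "0 \<le> q (Some i) x" "q (Some i) x \<le> c / 4" for i x
  proof -
    have "0 \<le> B - V i x" "B - V i x \<le> 2 * B" using B(2)[of i x] by (auto simp: abs_le_iff)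
    then have "0 \<le> d * (B - V i x)" "d * (B - V i x) \<le> d * (2 * B)" using d by (auto intro: mult_left_mono)
    moreover have "d * (2 * B) = c / 4" using B(1) by (simp add: d_def)
    ultimately show "0 \<le> q (Some i) x" "q (Some i) x \<le> c / 4" by (simp_all add: q_def)
  qed
  have qN: "c / 2 \<le> q None x" for x
    using qS(2)[of 1 x] qS(2)[of 2 x] c(2)[of x] by (simp add: q_def)
  have q0: "0 \<le> q j x" for j x using qS qN[of x] c(1) by (cases j) (auto intro: order_trans)
  have cq: "continuous_on UNIV (q j)" for j
    unfolding q_def[abs_def] by (cases j) (auto intro!: continuous_intros V cm0)
  have pq: "periodic (q j)" for j
    using V(2) pm0 by (cases j) (simp_all add: q_def periodic_def)
  have sum_opt: "(\<Sum>j\<in>UNIV. F j) = F None + (F (Some 1) + F (Some 2))" for F :: "2 option \<Rightarrow> real"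
    by (simp add: UNIV_option_conv sum.reindex UNIV_2)
  have qsum: "m0 x = (\<Sum>j\<in>UNIV. q j x)" for x by (simp add: sum_opt) (simp add: q_def)

  define G where "G x = \<epsilon> *\<^sub>R gradient \<psi> x" for x
  define T where "T x = torus_proj (gradient (convex_potential \<epsilon> \<psi>) x)" for x
  have Tx: "T x = torus_proj (x + G x)" for x by (simp add: T_def G_def gradient_convex_potential[OF \<psi>])
  have T: "T \<in> torus_measure \<rightarrow>\<^sub>M torus_measure"
    "distr (density torus_measure (\<lambda>x. ennreal (m0 x))) torus_measure T = torus_measure"
    using opt by (simp_all add: optimal_map_def T_def[abs_def] scaled_measure_def m0_def[abs_def]
        measurable_cong_sets[OF sets_density refl])
  have cG: "continuous_on UNIV G" unfolding G_def[abs_def] by (intro continuous_intros continuous_on_gradient \<psi>)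

  define I where "I = torus_integral (\<lambda>x. \<psi> x * h x)"
  define E where "E = transport_cost \<epsilon> \<rho> \<psi>"
  \<comment> \<open>The constant \<open>B\<close> integrates to 0 against a derivative, so only
    \<open>- d * V i\<close> contributes, and integration by parts turns its sign.\<close>
  have part: "torus_integral (\<lambda>x. q (Some i) x * partial_deriv i \<psi> x) = d * torus_integral (\<lambda>x. g i x * \<psi> x)" for i
  proof -
    have cp: "continuous_on UNIV (partial_deriv i \<psi>)" and pp: "periodic (partial_deriv i \<psi>)"
      using torus_smooth_partial[OF \<psi>] torus_smooth_continuous torus_smooth_periodic by blast+
    have "torus_integral (\<lambda>x. V i x * partial_deriv i \<psi> x) = - torus_integral (\<lambda>x. g i x * \<psi> x)"
      by (rule torus_integral_by_parts[OF Vg has_partial_smooth[OF \<psi>]]) (intro V g c\<psi> p\<psi> cp pp)+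
    moreover have "torus_integral (partial_deriv i \<psi>) = 0"
      by (rule torus_integral_partial[OF has_partial_smooth[OF \<psi>]]) (intro c\<psi> p\<psi> cp pp)+
    moreover have "torus_integral (\<lambda>x. (d * B) * partial_deriv i \<psi> x - d * (V i x * partial_deriv i \<psi> x))
      = torus_integral (\<lambda>x. (d * B) * partial_deriv i \<psi> x) - torus_integral (\<lambda>x. d * (V i x * partial_deriv i \<psi> x))"
      by (intro torus_integral_diff continuous_on_mult continuous_on_const V cp)
    moreover have "(\<lambda>x. q (Some i) x * partial_deriv i \<psi> x)
        = (\<lambda>x. (d * B) * partial_deriv i \<psi> x - d * (V i x * partial_deriv i \<psi> x))"
      by (rule ext) (simp add: q_def algebra_simps)
    ultimately show ?thesis by (simp add: torus_integral_cmult)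
  qed
  have I_eq: "I = torus_integral (\<lambda>x. g 1 x * \<psi> x) + torus_integral (\<lambda>x. g 2 x * \<psi> x)"
  proof -
    have "(\<lambda>x. \<psi> x * h x) = (\<lambda>x. g 1 x * \<psi> x + g 2 x * \<psi> x)" by (rule ext) (simp add: hg algebra_simps)
    then show ?thesis unfolding I_def by (simp only:) (intro torus_integral_add continuous_on_mult g c\<psi>)
  qed
  define Q where "Q = torus_integral (q (Some 1)) + torus_integral (q (Some 2))"
  have Q: "0 \<le> Q"
    unfolding Q_def torus_integral_def using q0 by (intro add_nonneg_nonneg integral_nonneg_AE AE_I2) auto

  \<comment> \<open>Chosen so that the error of the two shifts,
    \<open>2 d \<kappa> |\<sigma>| = 2 \<kappa> \<epsilon> |s|\<close>, equals
    \<open>\<omega> c / 2\<close> for the \<open>\<omega>\<close> below.\<close>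
  define \<kappa> where "\<kappa> = \<eta> * c / (16 * \<epsilon>)"
  have \<kappa>: "\<kappa> > 0" using \<eta> c(1) \<epsilon> by (simp add: \<kappa>_def)
  obtain t1 where t1: "t1 > 0" "\<And>x t. \<bar>t\<bar> < t1 \<Longrightarrow> \<bar>V 1 (x + t *\<^sub>R axis 1 1) - V 1 x - t * g 1 x\<bar> \<le> \<kappa> * \<bar>t\<bar>"
    using has_partial_uniform[OF Vg g \<kappa>] by metis
  obtain t2 where t2: "t2 > 0" "\<And>x t. \<bar>t\<bar> < t2 \<Longrightarrow> \<bar>V 2 (x + t *\<^sub>R axis 2 1) - V 2 x - t * g 2 x\<bar> \<le> \<kappa> * \<bar>t\<bar>"
    using has_partial_uniform[OF Vg g \<kappa>] by metis
  \<comment> \<open>The entries secure in turn: shifts below \<open>t1\<close> and below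
    \<open>t2\<close>, \<open>\<omega> \<le> 1\<close>, and a quadratic term of at most half of
    \<open>\<eta> |s|\<close>. Adding 1 to \<open>Q\<close> keeps the denominator positive.\<close>
  define \<delta> where "\<delta> = min (min (t1 * d / \<epsilon>) (t2 * d / \<epsilon>)) (min (4 / \<eta>) (\<eta> * d\<^sup>2 / (2 * \<epsilon>\<^sup>2 * (Q + 1))))"
  have \<delta>: "\<delta> > 0" using t1(1) t2(1) d \<epsilon> \<eta> Q by (simp add: \<delta>_def)

  have "\<exists>\<gamma>\<in>couplings (scaled_measure \<epsilon> (\<lambda>x. \<rho> x + s * h x)) torus_measure.
      (\<integral>p. (torus_dist (fst p) (snd p))\<^sup>2 \<partial>\<gamma>) \<le> E - 2 * \<epsilon>\<^sup>2 * s * I + \<eta> * \<bar>s\<bar>" if s: "\<bar>s\<bar> < \<delta>" for s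
  proof -
    define \<sigma> where "\<sigma> = s * \<epsilon> / d"
    \<comment> \<open>The price \<open>2 \<omega>\<close> of the product part uses one half of the
      allowance \<open>\<eta> |s|\<close>; the other half is for the quadratic term in
      \<open>\<sigma>\<close>.\<close>
    define \<omega> where "\<omega> = \<eta> * \<bar>s\<bar> / 4"
    have d\<sigma>: "d * \<sigma> = s * \<epsilon>" using d by (simp add: \<sigma>_def)
    have abs\<sigma>: "\<bar>\<sigma>\<bar> = \<bar>s\<bar> * \<epsilon> / d" using d \<epsilon> by (simp add: \<sigma>_def abs_mult)
    have \<sigma>: "\<bar>- \<sigma>\<bar> < t1" "\<bar>- \<sigma>\<bar> < t2" using s d \<epsilon> by (simp_all add: abs\<sigma> \<delta>_def field_simps)
    have \<omega>: "0 \<le> \<omega>" "\<omega> \<le> 1" using s \<eta> by (simp_all add: \<omega>_def \<delta>_def field_simps)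
    define v where "v j = (case j of Some i \<Rightarrow> \<sigma> *\<^sub>R axis i (1::real) | None \<Rightarrow> 0)" for j :: "2 option"
    define m where "m x = 1 + \<epsilon> * (\<rho> x + s * h x)" for x
    define M where "M x = (\<Sum>j\<in>UNIV. q j (x - v j))" for x
    define r where "r x = m x - (1 - \<omega>) * M x" for x
    have cm: "continuous_on UNIV m" unfolding m_def[abs_def] by (intro continuous_intros c\<rho> h)
    have cqv: "continuous_on UNIV (\<lambda>x. q j (x - v j))" for j
      using continuous_on_shift[OF cq, of j "- v j"] by simp
    have cM: "continuous_on UNIV M" unfolding M_def[abs_def] by (intro continuous_on_sum cqv)
    have cr: "continuous_on UNIV r" unfolding r_def[abs_def] by (intro continuous_intros cm cM)
    have Mc: "c / 2 \<le> M x" for x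
      using qN[of x] q0[of "Some 1" "x - v (Some 1)"] q0[of "Some 2" "x - v (Some 2)"]
      by (simp add: M_def sum_opt) (simp add: v_def)
    \<comment> \<open>Shifting \<open>- d * V i\<close> by \<open>\<sigma>\<close> adds
      \<open>d \<sigma> g i\<close> up to the Taylor errors, and
      \<open>d \<sigma> = s \<epsilon>\<close> matches the perturbation exactly.\<close>
    have Mm: "\<bar>M x - m x\<bar> \<le> \<omega> * (c / 2)" for x
    proof -
      let ?e1 = "V 1 (x + (- \<sigma>) *\<^sub>R axis 1 1) - V 1 x - (- \<sigma>) * g 1 x"
      let ?e2 = "V 2 (x + (- \<sigma>) *\<^sub>R axis 2 1) - V 2 x - (- \<sigma>) * g 2 x"
      have "M x - m x = - d * ?e1 - d * ?e2 + (d * \<sigma> - s * \<epsilon>) * h x"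
        by (simp add: M_def sum_opt) (simp add: q_def v_def m_def m0_def hg algebra_simps)
      then have "M x - m x = - (d * ?e1) - d * ?e2" by (simp add: d\<sigma>)
      then have "\<bar>M x - m x\<bar> \<le> d * \<bar>?e1\<bar> + d * \<bar>?e2\<bar>"
        using abs_triangle_ineq4[of "- (d * ?e1)" "d * ?e2"] d by (simp add: abs_mult)
      also have "\<dots> \<le> d * (\<kappa> * \<bar>- \<sigma>\<bar>) + d * (\<kappa> * \<bar>- \<sigma>\<bar>)"
        using d by (intro add_mono mult_left_mono t1(2) t2(2) \<sigma>) auto
      also have "\<dots> = \<omega> * (c / 2)"
        using d \<epsilon> by (simp add: abs\<sigma> \<kappa>_def \<omega>_def field_simps)
      finally show ?thesis .
    qed
    \<comment> \<open>Since \<open>r = (m - M) + \<omega> M\<close>, the lower bound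
      \<open>c / 2\<close> on \<open>M\<close> outweighs the error of \<open>Mm\<close>.\<close>
    have r0: "0 \<le> r x" for x
    proof -
      have "\<omega> * (c / 2) \<le> \<omega> * M x" using Mc \<omega> by (intro mult_left_mono) auto
      with order_trans[OF abs_ge_self Mm[of x]] show ?thesis by (simp add: r_def algebra_simps)
    qed
    have Ir: "torus_integral r = \<omega>"
    proof -
      have "torus_integral m = torus_integral (\<lambda>x. m0 x + (\<epsilon> * s) * h x)"
        by (simp add: m_def[abs_def] m0_def algebra_simps)
      also have "\<dots> = torus_integral m0 + torus_integral (\<lambda>x. (\<epsilon> * s) * h x)"
        by (intro torus_integral_add cm0 continuous_on_mult continuous_on_const h)
      finally have "torus_integral m = 1" by (simp add: torus_integral_cmult Im0 h(3))
      moreover have "torus_integral M = 1"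
      proof -
        have "torus_integral M = (\<Sum>j\<in>UNIV. torus_integral (\<lambda>x. q j (x - v j)))"
          unfolding M_def[abs_def] torus_integral_def
          by (rule Bochner_Integration.integral_sum) (rule torus_integrable[OF cqv])
        also have "\<dots> = (\<Sum>j\<in>UNIV. torus_integral (q j))"
          using torus_integral_translation[OF borel_measurable_continuous_onI[OF cq] pq, of _ "- v _"] by simp
        also have "\<dots> = torus_integral (\<lambda>x. \<Sum>j\<in>UNIV. q j x)"
          unfolding torus_integral_def
          by (rule Bochner_Integration.integral_sum[symmetric]) (rule torus_integrable[OF cq])
        also have "\<dots> = 1" using Im0 by (simp add: qsum[symmetric])
        finally show ?thesis .
      qed
      moreover have "torus_integral r = torus_integral m - torus_integral (\<lambda>x. (1 - \<omega>) * M x)"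
        unfolding r_def[abs_def] by (intro torus_integral_diff cm cM continuous_on_mult continuous_on_const)
      ultimately show ?thesis by (simp add: torus_integral_cmult)
    qed
    \<comment> \<open>The planar displacement from \<open>x + v j\<close> to \<open>x + G x\<close>
      bounds the torus distance of the projections, and its square is an explicit quadratic in the
      shift whose cross term carries the first variation.\<close>
    define D where "D j x = (norm (v j - G x))\<^sup>2" for j x
    have cD: "continuous_on UNIV (D j)" for j unfolding D_def[abs_def] by (intro continuous_intros cG)
    have Dle: "(torus_dist (torus_proj (x + v j)) (T x))\<^sup>2 \<le> D j x" for j x
      unfolding D_def Tx
      using torus_dist_proj_le[of "x + v j" "x + G x"] by (intro power_mono torus_dist_nonneg) simp
    obtain \<gamma> where \<gamma>: "\<gamma> \<in> couplings (density torus_measure (\<lambda>x. ennreal (m x))) torus_measure"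
      and cost: "(\<integral>p. (torus_dist (fst p) (snd p))\<^sup>2 \<partial>\<gamma>)
        \<le> (1 - \<omega>) * (\<Sum>j\<in>UNIV. torus_integral (\<lambda>x. q j x * D j x)) + 2 * \<omega>"
      by (rule perturbed_coupling[where m=m, OF T finite_class.finite_UNIV \<omega> cq pq q0 cr r0 Ir qsum _ cD Dle])
        (auto simp: r_def M_def)
    have Deq: "D j x = (norm (v j))\<^sup>2 - 2 * (v j \<bullet> G x) + (norm (G x))\<^sup>2" for j x
      unfolding D_def power2_norm_eq_inner by (simp add: inner_diff_left inner_diff_right inner_commute)
    have vG: "v (Some i) \<bullet> G x = \<sigma> * (\<epsilon> * partial_deriv i \<psi> x)" "(norm (v (Some i)))\<^sup>2 = \<sigma>\<^sup>2" for i x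
      by (simp_all add: v_def G_def gradient_def inner_axis' norm_axis_1 power_mult_distrib)
    have cN: "continuous_on UNIV (\<lambda>x. (norm (G x))\<^sup>2)" by (intro continuous_intros cG)
    have S: "torus_integral (\<lambda>x. q (Some i) x * D (Some i) x)
      = \<sigma>\<^sup>2 * torus_integral (q (Some i)) - (2 * \<sigma> * \<epsilon> * d) * torus_integral (\<lambda>x. g i x * \<psi> x)
        + torus_integral (\<lambda>x. q (Some i) x * (norm (G x))\<^sup>2)" for i
    proof -
      have cp: "continuous_on UNIV (partial_deriv i \<psi>)"
        using torus_smooth_partial[OF \<psi>] torus_smooth_continuous by blast
      have "torus_integral (\<lambda>x. q (Some i) x * D (Some i) x)
        = torus_integral (\<lambda>x. (\<sigma>\<^sup>2 * q (Some i) x - (2 * \<sigma> * \<epsilon>) * (q (Some i) x * partial_deriv i \<psi> x))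
          + q (Some i) x * (norm (G x))\<^sup>2)"
        by (rule arg_cong[where f=torus_integral], rule ext) (simp add: Deq vG algebra_simps)
      also have "\<dots> = torus_integral (\<lambda>x. \<sigma>\<^sup>2 * q (Some i) x - (2 * \<sigma> * \<epsilon>) * (q (Some i) x * partial_deriv i \<psi> x))
          + torus_integral (\<lambda>x. q (Some i) x * (norm (G x))\<^sup>2)"
        by (intro torus_integral_add continuous_on_diff continuous_on_mult continuous_on_const cq cp cN)
      also have "torus_integral (\<lambda>x. \<sigma>\<^sup>2 * q (Some i) x - (2 * \<sigma> * \<epsilon>) * (q (Some i) x * partial_deriv i \<psi> x))
          = torus_integral (\<lambda>x. \<sigma>\<^sup>2 * q (Some i) x) - torus_integral (\<lambda>x. (2 * \<sigma> * \<epsilon>) * (q (Some i) x * partial_deriv i \<psi> x))"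
        by (intro torus_integral_diff continuous_on_mult continuous_on_const cq cp)
      finally show ?thesis by (simp add: torus_integral_cmult part)
    qed
    have N: "torus_integral (\<lambda>x. q None x * D None x) = torus_integral (\<lambda>x. q None x * (norm (G x))\<^sup>2)"
      by (simp add: D_def v_def)
    have Eq: "E = (\<Sum>j\<in>UNIV. torus_integral (\<lambda>x. q j x * (norm (G x))\<^sup>2))"
    proof -
      have "E = torus_integral (\<lambda>x. \<Sum>j\<in>UNIV. q j x * (norm (G x))\<^sup>2)"
        by (simp add: E_def transport_cost_def G_def[symmetric] sum_distrib_right[symmetric] qsum[symmetric] m0_def del: norm_scaleR)
      also have "\<dots> = (\<Sum>j\<in>UNIV. torus_integral (\<lambda>x. q j x * (norm (G x))\<^sup>2))"
        unfolding torus_integral_def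
        by (rule Bochner_Integration.integral_sum) (intro torus_integrable continuous_on_mult cq cN)
      finally show ?thesis .
    qed
    define C where "C = (\<Sum>j\<in>UNIV. torus_integral (\<lambda>x. q j x * D j x))"
    have "C = E + \<sigma>\<^sup>2 * Q - (2 * \<sigma> * \<epsilon> * d) * I"
      unfolding C_def Eq sum_opt S N Q_def I_eq by (simp add: algebra_simps)
    moreover have "(2 * \<sigma> * \<epsilon> * d) * I = 2 * \<epsilon>\<^sup>2 * s * I"
      using d\<sigma> by (simp add: power2_eq_square mult.commute mult.left_commute)
    ultimately have C: "C = E - 2 * \<epsilon>\<^sup>2 * s * I + \<sigma>\<^sup>2 * Q" by simp
    have C0: "0 \<le> C"
      unfolding C_def torus_integral_def using q0 by (intro sum_nonneg integral_nonneg_AE AE_I2) (simp add: D_def)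
    have "\<sigma>\<^sup>2 * Q \<le> \<eta> * \<bar>s\<bar> / 2"
    proof -
      have "\<bar>s\<bar> \<le> \<eta> * d\<^sup>2 / (2 * \<epsilon>\<^sup>2 * (Q + 1))" using s by (simp add: \<delta>_def)
      then have "\<bar>s\<bar> * (2 * \<epsilon>\<^sup>2 * (Q + 1)) \<le> \<eta> * d\<^sup>2" using \<epsilon> Q by (simp add: pos_le_divide_eq)
      then have "\<bar>s\<bar> * (\<bar>s\<bar> * (2 * \<epsilon>\<^sup>2 * (Q + 1))) \<le> \<bar>s\<bar> * (\<eta> * d\<^sup>2)" by (rule mult_left_mono) simp
      moreover have "\<sigma>\<^sup>2 * d\<^sup>2 = s\<^sup>2 * \<epsilon>\<^sup>2"
        using d\<sigma> by (metis power_mult_distrib mult.commute)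
      ultimately have "2 * (\<sigma>\<^sup>2 * d\<^sup>2 * (Q + 1)) \<le> \<bar>s\<bar> * \<eta> * d\<^sup>2"
        by (simp add: power2_eq_square algebra_simps)
      moreover have "2 * (\<sigma>\<^sup>2 * d\<^sup>2 * Q) \<le> 2 * (\<sigma>\<^sup>2 * d\<^sup>2 * (Q + 1))"
        by (simp add: mult_left_mono)
      ultimately have "(2 * (\<sigma>\<^sup>2 * Q)) * d\<^sup>2 \<le> (\<bar>s\<bar> * \<eta>) * d\<^sup>2" by (simp add: ac_simps)
      then have "2 * (\<sigma>\<^sup>2 * Q) \<le> \<bar>s\<bar> * \<eta>" by (rule mult_right_le_imp_le) (use d in simp)
      then show ?thesis by (simp add: mult.commute)
    qed
    moreover have "(1 - \<omega>) * C \<le> C" using C0 \<omega> by (simp add: mult_left_le_one_le)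
    ultimately have "(\<integral>p. (torus_dist (fst p) (snd p))\<^sup>2 \<partial>\<gamma>) \<le> E - 2 * \<epsilon>\<^sup>2 * s * I + \<eta> * \<bar>s\<bar>"
      using cost C by (simp add: C_def[symmetric] \<omega>_def)
    then show ?thesis using \<gamma> by (auto simp: scaled_measure_def m_def)
  qed
  then show ?thesis unfolding E_def I_def by (rule that[OF \<delta>])
qed

section \<open>Functional derivatives and the Hamiltonian flow\<close>

text \<open>The two bounds pin the squared distance to an affine function of \<open>s\<close> with
  error \<open>\<eta> |s|\<close> for arbitrary \<open>\<eta>\<close>, which is differentiability at
  0. Division by \<open>2 \<epsilon>^2\<close> leaves the slope \<open>- J\<close>.\<close>

lemma sg_hamiltonian_functional_derivative:
  assumes pot: "is_sg_potential \<epsilon> \<rho> \<psi>" and adm: "admissible \<epsilon> \<rho>" and \<epsilon>: "\<epsilon> > 0"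
  shows "is_functional_derivative (sg_hamiltonian \<epsilon>) \<rho> (\<lambda>x. - \<psi> x)"
  unfolding is_functional_derivative_def
proof (intro conjI allI impI)
  have \<psi>: "torus_smooth \<psi>" using pot by (simp add: is_sg_potential_def)
  show "torus_smooth (\<lambda>x. - \<psi> x)" by (rule torus_smooth_uminus[OF \<psi>])
  have \<rho>: "torus_smooth \<rho>" "\<And>x. 0 < 1 + \<epsilon> * \<rho> x" using adm by (auto simp: admissible_def)
  note c\<rho> = torus_smooth_continuous[OF \<rho>(1)] and p\<rho> = torus_smooth_periodic[OF \<rho>(1)]
  have "continuous_on UNIV (\<lambda>x. 1 + \<epsilon> * \<rho> x)" by (intro continuous_intros c\<rho>)
  moreover have "periodic (\<lambda>x. 1 + \<epsilon> * \<rho> x)" using p\<rho> by (simp add: periodic_def)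
  ultimately obtain c where c: "c > 0" "\<And>x. c \<le> 1 + \<epsilon> * \<rho> x"
    using continuous_periodic_attains_inf \<rho>(2) by metis
  fix h assume "torus_smooth h \<and> torus_integral h = 0"
  then have h: "continuous_on UNIV h" "periodic h" "torus_integral h = 0"
    by (auto simp: torus_smooth_continuous torus_smooth_periodic)
  obtain A where A: "A > 0" "\<And>x. \<bar>h x\<bar> \<le> A" using continuous_periodic_bounded[OF h(1,2)] by metis
  define \<Phi> where "\<Phi> s = (W2 (scaled_measure \<epsilon> (\<lambda>x. \<rho> x + s * h x)) torus_measure)\<^sup>2" for s
  define E where "E = transport_cost \<epsilon> \<rho> \<psi>"
  define J where "J = torus_integral (\<lambda>x. \<psi> x * h x)"
  have ex: "\<exists>\<delta>>0. \<forall>s. \<bar>s\<bar> < \<delta> \<longrightarrow> \<bar>\<Phi> s - (E - 2 * \<epsilon>\<^sup>2 * s * J)\<bar> \<le> \<eta> * \<bar>s\<bar>" if \<eta>: "\<eta> > 0" for \<eta>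
  proof -
    obtain \<delta> where \<delta>: "\<delta> > 0" "\<And>s. \<bar>s\<bar> < \<delta> \<Longrightarrow>
      \<exists>\<gamma>\<in>couplings (scaled_measure \<epsilon> (\<lambda>x. \<rho> x + s * h x)) torus_measure.
        (\<integral>p. (torus_dist (fst p) (snd p))\<^sup>2 \<partial>\<gamma>) \<le> E - 2 * \<epsilon>\<^sup>2 * s * J + \<eta> * \<bar>s\<bar>"
      by (rule transport_upper_bound[OF pot adm \<epsilon> h \<eta>, folded E_def J_def]) (rule that)
    \<comment> \<open>The second entry of the minimum keeps the perturbed density nonnegative, as
      the dual bound requires.\<close>
    have "\<bar>\<Phi> s - (E - 2 * \<epsilon>\<^sup>2 * s * J)\<bar> \<le> \<eta> * \<bar>s\<bar>" if s: "\<bar>s\<bar> < min \<delta> (c / (\<epsilon> * A))" for s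
    proof -
      let ?\<rho> = "\<lambda>x. \<rho> x + s * h x"
      let ?C = "couplings (scaled_measure \<epsilon> ?\<rho>) torus_measure"
      have "\<bar>s\<bar> < \<delta>" using s by simp
      then obtain \<gamma> where \<gamma>: "\<gamma> \<in> ?C"
        "(\<integral>p. (torus_dist (fst p) (snd p))\<^sup>2 \<partial>\<gamma>) \<le> E - 2 * \<epsilon>\<^sup>2 * s * J + \<eta> * \<bar>s\<bar>"
        using \<delta>(2) by blast
      have up: "\<Phi> s \<le> E - 2 * \<epsilon>\<^sup>2 * s * J + \<eta> * \<bar>s\<bar>"
        unfolding \<Phi>_def using W2_sq_le[OF \<gamma>(1)] \<gamma>(2) by (rule order_trans)
      have pos: "0 \<le> 1 + \<epsilon> * ?\<rho> x" for x
      proof -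
        have "\<bar>\<epsilon> * (s * h x)\<bar> \<le> \<epsilon> * (\<bar>s\<bar> * A)"
          using \<epsilon> A(2)[of x] by (simp add: abs_mult mult_left_mono)
        also have "\<dots> = \<bar>s\<bar> * (\<epsilon> * A)" by simp
        also have "\<dots> \<le> c"
          using s \<epsilon> A(1) by (simp add: pos_less_divide_eq)
        finally have "- c \<le> \<epsilon> * (s * h x)" by (simp add: abs_le_iff)
        with c(2)[of x] show ?thesis by (simp add: distrib_left)
      qed
      have c\<rho>': "continuous_on UNIV ?\<rho>" by (intro continuous_intros c\<rho> h)
      have "?C \<noteq> {}" using \<gamma>(1) by blast
      have "(\<lambda>x. \<psi> x * (?\<rho> x - \<rho> x)) = (\<lambda>x. s * (\<psi> x * h x))" by (rule ext) simp
      then have J: "torus_integral (\<lambda>x. \<psi> x * (?\<rho> x - \<rho> x)) = s * J"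
        by (simp only: torus_integral_cmult J_def)
      have "E - 2 * \<epsilon>\<^sup>2 * (s * J) \<le> \<Phi> s"
        unfolding \<Phi>_def W2_sq[OF \<open>?C \<noteq> {}\<close>]
      proof (rule cINF_greatest[OF \<open>?C \<noteq> {}\<close>])
        fix \<gamma>' assume "\<gamma>' \<in> ?C"
        from transport_lower_bound[OF pot adm c\<rho>' pos this] J
        show "E - 2 * \<epsilon>\<^sup>2 * (s * J) \<le> (\<integral>p. (torus_dist (fst p) (snd p))\<^sup>2 \<partial>\<gamma>')"
          by (simp only: E_def)
      qed
      then have low: "E - 2 * \<epsilon>\<^sup>2 * s * J \<le> \<Phi> s" by (simp only: mult.assoc)
      have "0 \<le> \<eta> * \<bar>s\<bar>" using \<eta> by simp
      with up low show ?thesis by (intro abs_leI) linarith+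
    qed
    moreover have "min \<delta> (c / (\<epsilon> * A)) > 0" using \<delta>(1) c(1) \<epsilon> A(1) by simp
    ultimately show ?thesis by blast
  qed
  \<comment> \<open>At \<open>s = 0\<close> the error vanishes, which identifies the cost of the map
    with the squared Wasserstein distance.\<close>
  have \<Phi>0: "\<Phi> 0 = E"
  proof -
    have "\<bar>\<Phi> 0 - (E - 2 * \<epsilon>\<^sup>2 * 0 * J)\<bar> \<le> 1 * \<bar>0\<bar>" using ex[OF zero_less_one] by (metis abs_zero)
    then show ?thesis by simp
  qed
  have H: "sg_hamiltonian \<epsilon> (\<lambda>x. \<rho> x + s * h x) = \<Phi> s / (2 * \<epsilon>\<^sup>2)" for s
    by (simp add: sg_hamiltonian_def \<Phi>_def)
  have "((\<lambda>s. \<Phi> s / (2 * \<epsilon>\<^sup>2)) has_real_derivative - J) (at 0)"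
    unfolding has_field_derivative_iff
  proof (rule LIM_I)
    fix r :: real assume r: "0 < r"
    \<comment> \<open>The choice \<open>\<eta> = \<epsilon>^2 r\<close> becomes the error
      \<open>r / 2\<close> after division by \<open>2 \<epsilon>^2 |s|\<close>.\<close>
    obtain \<delta> where \<delta>: "\<delta> > 0" "\<And>s. \<bar>s\<bar> < \<delta> \<Longrightarrow> \<bar>\<Phi> s - (E - 2 * \<epsilon>\<^sup>2 * s * J)\<bar> \<le> (\<epsilon>\<^sup>2 * r) * \<bar>s\<bar>"
      using ex[of "\<epsilon>\<^sup>2 * r"] r \<epsilon> by auto
    have "\<bar>(\<Phi> s / (2 * \<epsilon>\<^sup>2) - \<Phi> 0 / (2 * \<epsilon>\<^sup>2)) / (s - 0) - - J\<bar> < r" if s: "s \<noteq> 0" "\<bar>s\<bar> < \<delta>" for s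
    proof -
      have "(\<Phi> s / (2 * \<epsilon>\<^sup>2) - \<Phi> 0 / (2 * \<epsilon>\<^sup>2)) / (s - 0) - - J = (\<Phi> s - (E - 2 * \<epsilon>\<^sup>2 * s * J)) / (2 * \<epsilon>\<^sup>2 * s)"
        using s(1) \<epsilon> by (simp add: \<Phi>0 field_simps)
      then have "\<bar>(\<Phi> s / (2 * \<epsilon>\<^sup>2) - \<Phi> 0 / (2 * \<epsilon>\<^sup>2)) / (s - 0) - - J\<bar>
          = \<bar>\<Phi> s - (E - 2 * \<epsilon>\<^sup>2 * s * J)\<bar> / (2 * \<epsilon>\<^sup>2 * \<bar>s\<bar>)"
        by (simp add: abs_mult)
      also have "\<dots> \<le> (\<epsilon>\<^sup>2 * r) * \<bar>s\<bar> / (2 * \<epsilon>\<^sup>2 * \<bar>s\<bar>)"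
        by (intro divide_right_mono \<delta>(2) s) simp
      also have "\<dots> = r / 2" using s(1) \<epsilon> by simp
      also have "\<dots> < r" using r by simp
      finally show ?thesis .
    qed
    then show "\<exists>\<delta>>0. \<forall>s. s \<noteq> 0 \<and> norm (s - 0) < \<delta> \<longrightarrow>
        norm ((\<Phi> s / (2 * \<epsilon>\<^sup>2) - \<Phi> 0 / (2 * \<epsilon>\<^sup>2)) / (s - 0) - - J) < r"
      using \<delta>(1) by (intro exI[of _ \<delta>]) auto
  qed
  moreover have "torus_integral (\<lambda>x. - \<psi> x * h x) = - J"
    unfolding J_def torus_integral_uminus[symmetric] by simp
  ultimately show "((\<lambda>s. sg_hamiltonian \<epsilon> (\<lambda>x. \<rho> x + s * h x)) has_real_derivative
      torus_integral (\<lambda>x. - \<psi> x * h x)) (at 0)"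
    by (simp only: H)
qed

text \<open>Only directions of mean zero are tested, so constants are invisible. The difference
  minus its mean is itself such a direction, and testing with it shows that its square has integral
  0.\<close>

lemma functional_derivative_unique:
  assumes g: "is_functional_derivative F \<rho> g" and g': "is_functional_derivative F \<rho> g'"
  obtains c where "g' = (\<lambda>x. g x + c)"
proof -
  define c where "c = torus_integral (\<lambda>x. g' x - g x)"
  define u where "u x = (g' x - g x) - c" for x
  have s: "torus_smooth g" "torus_smooth g'" using g g' by (auto simp: is_functional_derivative_def)
  have u: "torus_smooth u" unfolding u_def[abs_def] by (intro torus_smooth_intros s)
  note cont = s[THEN torus_smooth_continuous] torus_smooth_continuous[OF u]
  have u0: "torus_integral u = 0"
    unfolding u_def[abs_def] using cont(1,2) by (simp add: torus_integral_diff continuous_on_diff c_def)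
  have eq: "torus_integral (\<lambda>x. g x * u x) = torus_integral (\<lambda>x. g' x * u x)"
    using g g' u u0 unfolding is_functional_derivative_def by (blast intro: DERIV_unique)
  have "torus_integral (\<lambda>x. u x * u x) = torus_integral (\<lambda>x. (g' x * u x - g x * u x) - c * u x)"
    by (rule arg_cong[where f=torus_integral], rule ext) (simp add: u_def algebra_simps)
  also have "\<dots> = torus_integral (\<lambda>x. g' x * u x - g x * u x) - torus_integral (\<lambda>x. c * u x)"
    by (intro torus_integral_diff continuous_on_diff continuous_on_mult continuous_on_const cont)
  also have "torus_integral (\<lambda>x. g' x * u x - g x * u x) = torus_integral (\<lambda>x. g' x * u x) - torus_integral (\<lambda>x. g x * u x)"
    by (intro torus_integral_diff continuous_on_mult cont)
  finally have "torus_integral (\<lambda>x. u x * u x) = 0" by (simp add: eq torus_integral_cmult u0)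
  then have "u x = 0" for x
    by (rule torus_integral_square_eq_0[OF cont(3) torus_smooth_periodic[OF u]])
  then have "g' = (\<lambda>x. g x + c)" by (intro ext) (simp add: u_def algebra_simps)
  then show ?thesis by (rule that)
qed

text \<open>Uniqueness of the potential needs no theory of optimal maps: every potential is a functional
  derivative of the Hamiltonian.\<close>

lemma sg_potential_eq:
  assumes pot: "is_sg_potential \<epsilon> \<rho> \<psi>" and adm: "admissible \<epsilon> \<rho>" and \<epsilon>: "\<epsilon> > 0"
  shows "sg_potential \<epsilon> \<rho> = \<psi>"
  unfolding sg_potential_def
proof (rule the_equality[where P="is_sg_potential \<epsilon> \<rho>", OF pot])
  fix \<psi>' assume pot': "is_sg_potential \<epsilon> \<rho> \<psi>'"
  obtain c where "(\<lambda>x. - \<psi>' x) = (\<lambda>x. - \<psi> x + c)"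
    using functional_derivative_unique[OF sg_hamiltonian_functional_derivative[OF pot adm \<epsilon>]
        sg_hamiltonian_functional_derivative[OF pot' adm \<epsilon>]] by blast
  then have eq: "\<psi>' x = \<psi> x - c" for x by (metis add.inverse_inverse minus_add_distrib diff_conv_add_uminus)
  then have eq': "\<psi>' = (\<lambda>x. \<psi> x - c)" by blast
  have "torus_integral \<psi>' = torus_integral \<psi> - c"
    unfolding eq' using torus_smooth_continuous[of \<psi>] pot
    by (simp add: is_sg_potential_def torus_integral_diff)
  then have "c = 0" using pot pot' by (simp add: is_sg_potential_def)
  then show "\<psi>' = \<psi>" using eq' by simp
qed

lemma linear_observable_functional_derivative:
  assumes f: "torus_smooth f" and \<rho>: "continuous_on UNIV \<rho>"
  shows "is_functional_derivative (linear_observable f) \<rho> f"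
  unfolding is_functional_derivative_def
proof (intro conjI allI impI f)
  fix h assume h: "torus_smooth h \<and> torus_integral h = 0"
  note cont = \<rho> torus_smooth_continuous[OF f] torus_smooth_continuous[of h]
  have "linear_observable f (\<lambda>x. \<rho> x + s * h x) = linear_observable f \<rho> + s * torus_integral (\<lambda>x. f x * h x)" for s
  proof -
    have "linear_observable f (\<lambda>x. \<rho> x + s * h x) = torus_integral (\<lambda>x. \<rho> x * f x + s * (f x * h x))"
      unfolding linear_observable_def by (rule arg_cong[where f=torus_integral], rule ext) (simp add: algebra_simps)
    also have "\<dots> = torus_integral (\<lambda>x. \<rho> x * f x) + torus_integral (\<lambda>x. s * (f x * h x))"
      using h by (intro torus_integral_add continuous_on_mult continuous_on_const cont) auto
    finally show ?thesis by (simp add: torus_integral_cmult linear_observable_def)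
  qed
  then show "((\<lambda>s. linear_observable f (\<lambda>x. \<rho> x + s * h x)) has_real_derivative
      torus_integral (\<lambda>x. f x * h x)) (at 0)"
    by (auto intro!: derivative_eq_intros)
qed

text \<open>Replaces the arbitrary choice in \<open>functional_derivative\<close> by any derivative
  at hand, up to a constant.\<close>

lemma functional_derivative_eq:
  assumes "is_functional_derivative F \<rho> g"
  obtains c where "functional_derivative F \<rho> = (\<lambda>x. g x + c)"
proof -
  have "is_functional_derivative F \<rho> (functional_derivative F \<rho>)"
    unfolding functional_derivative_def by (rule someI[where P="is_functional_derivative F \<rho>", OF assms])
  from functional_derivative_unique[OF assms this] show ?thesis using that by blast
qed

lemma lie_poisson_linear_observable:
  assumes f: "torus_smooth f" and \<rho>: "torus_smooth \<rho>" and \<psi>: "torus_smooth \<psi>"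
    and H: "is_functional_derivative H \<rho> (\<lambda>x. - \<psi> x)"
  shows "lie_poisson (linear_observable f) H \<rho> = - torus_integral (\<lambda>x. poisson \<psi> \<rho> x * f x)"
proof -
  obtain c where c: "functional_derivative (linear_observable f) \<rho> = (\<lambda>x. f x + c)"
    using functional_derivative_eq[OF linear_observable_functional_derivative[OF f torus_smooth_continuous[OF \<rho>]]] by blast
  obtain c' where c': "functional_derivative H \<rho> = (\<lambda>x. - \<psi> x + c')"
    using functional_derivative_eq[OF H] by blast
  have p: "poisson (\<lambda>x. f x + c) (\<lambda>x. - \<psi> x + c') x = poisson \<psi> f x" for x
    by (simp only: poisson_eq partial_deriv_add[OF f torus_smooth_const] partial_deriv_uminus[OF \<psi>]
        partial_deriv_add[OF torus_smooth_uminus[OF \<psi>] torus_smooth_const] partial_deriv_const) simp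
  note cont = torus_smooth_mult[OF \<rho> torus_smooth_poisson[OF \<psi> f], THEN torus_smooth_continuous]
    torus_smooth_mult[OF torus_smooth_poisson[OF \<psi> \<rho>] f, THEN torus_smooth_continuous]
  \<comment> \<open>Integration by parts in bracket form: a bracket of smooth functions integrates
    to 0, and the Leibniz rule expands the bracket with the product.\<close>
  have "0 = torus_integral (poisson \<psi> (\<lambda>x. \<rho> x * f x))"
    by (rule torus_integral_poisson[symmetric]) (intro torus_smooth_mult \<psi> \<rho> f)+
  also have "poisson \<psi> (\<lambda>x. \<rho> x * f x) = (\<lambda>x. \<rho> x * poisson \<psi> f x + poisson \<psi> \<rho> x * f x)"
    by (rule ext) (rule poisson_mult_right[OF \<psi> \<rho> f])
  also have "torus_integral \<dots> = torus_integral (\<lambda>x. \<rho> x * poisson \<psi> f x) + torus_integral (\<lambda>x. poisson \<psi> \<rho> x * f x)"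
    by (rule torus_integral_add[OF cont])
  finally show ?thesis unfolding lie_poisson_def c c' p by simp
qed

section \<open>Time derivatives along smooth curves\<close>

context
  fixes I :: "real set" and \<rho> :: "real \<Rightarrow> real^2 \<Rightarrow> real"
  assumes curve: "smooth_curve I \<rho>" and I: "open I" "is_interval I"
begin

lemma has_time_derivative:
  assumes "t \<in> I"
  shows "((\<lambda>s. \<rho> s x) has_real_derivative frechet_derivative (\<lambda>(t, x). \<rho> t x) (at (t, x)) (1, 0)) (at t)"
proof -
  let ?F = "\<lambda>(t, x). \<rho> t x"
  have "Ck_on (Suc 0) (I \<times> UNIV) ?F" using curve unfolding smooth_curve_def smooth_on_def by blast
  then have "?F differentiable (at (t, x))" using assms unfolding Ck_on.simps by blast
  then have F: "(?F has_derivative frechet_derivative ?F (at (t, x))) (at (t, x))"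
    by (rule frechet_derivative_works[THEN iffD1])
  define D where "D = frechet_derivative ?F (at (t, x))"
  have D: "(?F has_derivative D) (at (t, x))" using F by (simp only: D_def)
  have lin: "linear D" using D by (rule has_derivative_linear)
  have chain: "((\<lambda>s. ?F (s, x)) has_derivative (\<lambda>s. D (s, 0))) (at t)"
    by (rule has_derivative_compose[where f="\<lambda>s. (s, x)" and f'="\<lambda>s. (s, 0)" and x=t, OF _ D])
      (rule has_derivative_Pair[OF has_derivative_ident has_derivative_const])
  have "D (s, 0) = D (1, 0) * s" for s
  proof -
    have "D (s *\<^sub>R (1, 0)) = s *\<^sub>R D (1, 0)" by (rule linear_scale[OF lin])
    then show ?thesis by (simp only: scaleR_Pair real_scaleR_def mult_1_left mult_1_right scaleR_zero_right mult.commute)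
  qed
  then have "(\<lambda>s. D (s, 0)) = (\<lambda>s. D (1, 0) * s)" by (rule ext)
  then have "((\<lambda>s. \<rho> s x) has_derivative (\<lambda>s. D (1, 0) * s)) (at t)"
    using chain by (simp only: prod.case)
  then show ?thesis unfolding has_field_derivative_def D_def .
qed

lemma time_derivative_eq:
  "t \<in> I \<Longrightarrow> deriv (\<lambda>s. \<rho> s x) t = frechet_derivative (\<lambda>(t, x). \<rho> t x) (at (t, x)) (1, 0)"
  by (rule DERIV_imp_deriv[OF has_time_derivative])

text \<open>Periodicity of \<open>\<rho> s\<close> is known for \<open>s\<close> in \<open>I\<close>
  only; as \<open>I\<close> is open, it holds near \<open>t\<close> and passes to the derivative.
  Smoothness is that of a time slice of the derivative in direction \<open>(1, 0)\<close>.\<close>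

lemma torus_smooth_time_derivative:
  assumes t: "t \<in> I"
  shows "torus_smooth (\<lambda>x. deriv (\<lambda>s. \<rho> s x) t)"
  unfolding torus_smooth_def
proof
  show "periodic (\<lambda>x. deriv (\<lambda>s. \<rho> s x) t)"
    unfolding periodic_def
  proof (intro allI ballI)
    fix x k :: "real^2" assume k: "k \<in> int_lattice"
    have "((\<lambda>s. \<rho> s (x + k)) has_real_derivative deriv (\<lambda>s. \<rho> s x) t) (at t)"
      by (rule has_field_derivative_transform_within_open[OF _ I(1) t, of "\<lambda>s. \<rho> s x"])
        (use has_time_derivative[OF t] time_derivative_eq[OF t] curve k in \<open>auto simp: smooth_curve_def periodic_def\<close>)
    then show "deriv (\<lambda>s. \<rho> s (x + k)) t = deriv (\<lambda>s. \<rho> s x) t" by (rule DERIV_imp_deriv)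
  qed
  have "Ck_on n (I \<times> UNIV) (\<lambda>z. frechet_derivative (\<lambda>(t, x). \<rho> t x) (at z) (1, 0))" for n
  proof -
    have "Ck_on (Suc n) (I \<times> UNIV) (\<lambda>(t, x). \<rho> t x)" using curve unfolding smooth_curve_def smooth_on_def by blast
    then show ?thesis unfolding Ck_on.simps by blast
  qed
  from Ck_on_slice[OF t this] show "smooth_on UNIV (\<lambda>x. deriv (\<lambda>s. \<rho> s x) t)"
    by (simp add: smooth_on_def time_derivative_eq[OF t])
qed

text \<open>Differentiation under the integral sign. The Leibniz rule works within a convex set of
  times, whence the interval; openness turns the derivative within \<open>I\<close> into a full
  one.\<close>

lemma linear_observable_time_derivative:
  assumes f: "torus_smooth f" and t: "t \<in> I"
  shows "((\<lambda>s. linear_observable f (\<rho> s)) has_real_derivative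
    torus_integral (\<lambda>x. deriv (\<lambda>s. \<rho> s x) t * f x)) (at t)"
proof -
  let ?F = "\<lambda>(t, x). \<rho> t x"
  let ?D = "\<lambda>s x. frechet_derivative ?F (at (s, x)) (1, 0)"
  have "Ck_on (Suc 0) (I \<times> UNIV) ?F" using curve unfolding smooth_curve_def smooth_on_def by blast
  then have cD: "continuous_on (I \<times> UNIV) (\<lambda>z. frechet_derivative ?F (at z) (1, 0))" unfolding Ck_on.simps by blast
  have c\<rho>: "continuous_on UNIV (\<rho> s)" if "s \<in> I" for s
  proof -
    have "Ck_on 0 (I \<times> UNIV) ?F" using curve unfolding smooth_curve_def smooth_on_def by blast
    from Ck_on_slice[OF that this] show ?thesis by simp
  qed
  note cf = torus_smooth_continuous[OF f]
  have "((\<lambda>s. integral (cbox 0 1) (\<lambda>x. \<rho> s x * f x)) has_real_derivative integral (cbox 0 1) (\<lambda>x. ?D t x * f x)) (at t within I)"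
  proof (rule leibniz_rule_field_derivative)
    fix s x assume "s \<in> I"
    then show "((\<lambda>s. \<rho> s x * f x) has_real_derivative ?D s x * f x) (at s within I)"
      by (rule has_field_derivative_at_within[OF DERIV_cmult_right[OF has_time_derivative]])
  next
    fix s assume "s \<in> I"
    then show "(\<lambda>x. \<rho> s x * f x) integrable_on cbox 0 1"
      by (rule integrable_continuous[OF continuous_on_subset[OF continuous_on_mult[OF c\<rho> cf]]]) simp
  next
    have "continuous_on (I \<times> cbox 0 1) (\<lambda>z. frechet_derivative ?F (at z) (1, 0) * f (snd z))"
      by (rule continuous_on_mult[OF continuous_on_subset[OF cD] continuous_on_compose2[OF cf continuous_on_snd[OF continuous_on_id]]]) auto
    then show "continuous_on (I \<times> cbox 0 1) (\<lambda>(s, x). ?D s x * f x)" by (simp add: split_beta)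
  qed (use t I is_interval_convex in auto)
  then have "((\<lambda>s. integral (cbox 0 1) (\<lambda>x. \<rho> s x * f x)) has_real_derivative
      torus_integral (\<lambda>x. deriv (\<lambda>s. \<rho> s x) t * f x)) (at t)"
    using torus_integral_eq_integral[OF continuous_on_mult[OF torus_smooth_continuous[OF torus_smooth_time_derivative[OF t]] cf]]
    by (simp add: at_within_open[OF t I(1)] time_derivative_eq[OF t])
  then show ?thesis
    by (rule has_field_derivative_transform_within_open[OF _ I(1) t])
      (simp add: linear_observable_def torus_integral_eq_integral continuous_on_mult c\<rho> cf)
qed

end

text \<open>By periodicity \<open>\<psi>\<close> takes equal values at distance 1, so by Rolle its
  derivative vanishes somewhere in that segment; from there the second derivative controls it over a
  length below 1.\<close>

lemma partial_deriv_bound: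
  assumes \<psi>: "torus_smooth \<psi>" and bd: "\<And>x. \<bar>partial_deriv i (partial_deriv i \<psi>) x\<bar> \<le> b"
  shows "\<bar>partial_deriv i \<psi> x\<bar> \<le> b"
proof -
  note d1 = has_partialD[OF has_partial_smooth[OF \<psi>, of i], of x]
    and d2 = has_partialD[OF has_partial_smooth[OF torus_smooth_partial[OF \<psi>, of i], of i], of x]
  obtain z where z: "0 < z" "z < 1" "partial_deriv i \<psi> (x + z *\<^sub>R axis i 1) = 0"
    using MVT2[OF zero_less_one d1] periodicD[OF torus_smooth_periodic[OF \<psi>] lattice_axis] by auto
  obtain y where "partial_deriv i \<psi> (x + z *\<^sub>R axis i 1) - partial_deriv i \<psi> (x + 0 *\<^sub>R axis i 1)
      = (z - 0) * partial_deriv i (partial_deriv i \<psi>) (x + y *\<^sub>R axis i 1)"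
    using MVT2[OF z(1) d2] by blast
  then have "partial_deriv i \<psi> x = - (z * partial_deriv i (partial_deriv i \<psi>) (x + y *\<^sub>R axis i 1))"
    using z(3) by simp
  then have "\<bar>partial_deriv i \<psi> x\<bar> = z * \<bar>partial_deriv i (partial_deriv i \<psi>) (x + y *\<^sub>R axis i 1)\<bar>"
    using z(1) by (simp add: abs_mult)
  also have "\<dots> \<le> 1 * b" using z bd by (intro mult_mono) auto
  finally show ?thesis by simp
qed

text \<open>The diagonal entries of the Hessian are at most its Frobenius norm, and the factor 2
  comes from summing the two components.\<close>

lemma gradient_bound:
  assumes \<psi>: "torus_smooth \<psi>" and \<epsilon>: "\<epsilon> > 0" and bd: "\<And>x. \<epsilon> * norm (hessian \<psi> x) \<le> b"
  shows "norm (\<epsilon> *\<^sub>R gradient \<psi> x) \<le> 2 * b"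
proof -
  have "\<bar>partial_deriv i (partial_deriv i \<psi>) y\<bar> \<le> b / \<epsilon>" for i y
  proof -
    have "\<bar>hessian \<psi> y $ i $ i\<bar> \<le> norm (hessian \<psi> y)"
      by (rule order_trans[OF component_le_norm_cart Finite_Cartesian_Product.norm_nth_le])
    also have "\<dots> \<le> b / \<epsilon>" using bd[of y] \<epsilon> by (simp add: field_simps)
    finally show ?thesis by (simp add: hessian_def)
  qed
  then have "\<bar>partial_deriv i \<psi> x\<bar> \<le> b / \<epsilon>" for i by (rule partial_deriv_bound[OF \<psi>])
  then have "\<epsilon> * \<bar>partial_deriv i \<psi> x\<bar> \<le> b" for i using \<epsilon> by (simp add: field_simps)
  then have "(\<Sum>i\<in>UNIV. \<bar>(\<epsilon> *\<^sub>R gradient \<psi> x) $ i\<bar>) \<le> (\<Sum>i\<in>(UNIV::2 set). b)"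
    using \<epsilon> by (intro sum_mono) (simp add: gradient_def abs_mult)
  then show ?thesis using norm_le_l1_cart[of "\<epsilon> *\<^sub>R gradient \<psi> x"] by simp
qed

theorem corollary3p2:
  shows "\<exists>\<eta>\<^sub>0>0. \<forall>\<epsilon>>0.
    (\<forall>\<rho>. on_perturbative_branch \<eta>\<^sub>0 \<epsilon> \<rho> \<longrightarrow>
       (\<forall>x. norm (\<epsilon> *\<^sub>R gradient (sg_potential \<epsilon> \<rho>) x) < 1/2) \<and>
       functionally_differentiable (sg_hamiltonian \<epsilon>) \<rho>) \<and>
    (\<forall>I \<rho>. open I \<and> is_interval I \<and> smooth_curve I \<rho> \<and>
            (\<forall>t\<in>I. on_perturbative_branch \<eta>\<^sub>0 \<epsilon> (\<rho> t)) \<longrightarrow>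
       (hamiltonian_trajectory (sg_hamiltonian \<epsilon>) I \<rho> \<longleftrightarrow> sg_solution_distr \<epsilon> I \<rho>) \<and>
       (hamiltonian_trajectory (sg_hamiltonian \<epsilon>) I \<rho> \<longleftrightarrow> sg_solution_classical \<epsilon> I \<rho>))"
proof (rule exI[of _ "1/8"], intro conjI allI impI)
  fix \<epsilon> :: real assume \<epsilon>: "\<epsilon> > 0"
  \<comment> \<open>The branch condition speaks of some potential; uniqueness transfers its
    properties to \<open>sg_potential\<close>.\<close>
  have branch: "admissible \<epsilon> \<rho>" "is_sg_potential \<epsilon> \<rho> (sg_potential \<epsilon> \<rho>)"
    "\<And>x. \<epsilon> * norm (hessian (sg_potential \<epsilon> \<rho>) x) \<le> 1/8"
    if \<rho>: "on_perturbative_branch (1/8) \<epsilon> \<rho>" for \<rho>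
  proof -
    obtain \<psi> where \<psi>: "admissible \<epsilon> \<rho>" "is_sg_potential \<epsilon> \<rho> \<psi>" "\<And>x. \<epsilon> * norm (hessian \<psi> x) \<le> 1/8"
      using \<rho> unfolding on_perturbative_branch_def by blast
    with sg_potential_eq[OF \<psi>(2,1) \<epsilon>] show "admissible \<epsilon> \<rho>" "is_sg_potential \<epsilon> \<rho> (sg_potential \<epsilon> \<rho>)"
      "\<And>x. \<epsilon> * norm (hessian (sg_potential \<epsilon> \<rho>) x) \<le> 1/8" by simp_all
  qed
  {
    fix \<rho> x assume "on_perturbative_branch (1/8) \<epsilon> \<rho>"
    note b = branch[OF this]
    \<comment> \<open>The constant 1/8 gives the gradient bound \<open>2 * 1/8 = 1/4\<close>, which
      is below 1/2.\<close>
    show "norm (\<epsilon> *\<^sub>R gradient (sg_potential \<epsilon> \<rho>) x) < 1/2"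
      using gradient_bound[OF _ \<epsilon> b(3), of x] b(2) by (simp add: is_sg_potential_def)
  next
    fix \<rho> assume "on_perturbative_branch (1/8) \<epsilon> \<rho>"
    from sg_hamiltonian_functional_derivative[OF branch(2,1)[OF this] \<epsilon>]
    show "functionally_differentiable (sg_hamiltonian \<epsilon>) \<rho>" by (auto simp: functionally_differentiable_def)
  }
  fix I \<rho>
  assume "open I \<and> is_interval I \<and> smooth_curve I \<rho> \<and> (\<forall>t\<in>I. on_perturbative_branch (1/8) \<epsilon> (\<rho> t))"
  then have I: "open I" "is_interval I" and curve: "smooth_curve I \<rho>"
    and br: "\<And>t. t \<in> I \<Longrightarrow> on_perturbative_branch (1/8) \<epsilon> (\<rho> t)" by auto
  define R where "R t x = deriv (\<lambda>s. \<rho> s x) t + poisson (sg_potential \<epsilon> (\<rho> t)) (\<rho> t) x" for t x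
  have smooth: "torus_smooth (\<rho> t)" "torus_smooth (sg_potential \<epsilon> (\<rho> t))" if "t \<in> I" for t
    using branch(1,2)[OF br[OF that]] by (auto simp: admissible_def is_sg_potential_def)
  have R: "torus_smooth (R t)" if "t \<in> I" for t
    unfolding R_def[abs_def]
    by (intro torus_smooth_add torus_smooth_time_derivative[OF curve I that] torus_smooth_poisson smooth[OF that])
  have constr: "sg_constraints \<epsilon> (\<rho> t)" if "t \<in> I" for t
    using branch(1,2)[OF br[OF that]] hessian_convex_potential[OF smooth(2)[OF that], of \<epsilon>]
    by (simp add: sg_constraints_def admissible_def is_sg_potential_def)
  \<comment> \<open>The equivalence holds for each test function and each time separately: the
    observable always has the derivative \<open>?D\<close>, the bracket is \<open>- ?P\<close>, and
    the residual tested with \<open>f\<close> is \<open>?D + ?P\<close>.\<close>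
  have ham: "((\<lambda>s. linear_observable f (\<rho> s)) has_real_derivative
      lie_poisson (linear_observable f) (sg_hamiltonian \<epsilon>) (\<rho> t)) (at t) \<longleftrightarrow> torus_integral (\<lambda>x. R t x * f x) = 0"
    if f: "torus_smooth f" and t: "t \<in> I" for f t
  proof -
    let ?D = "torus_integral (\<lambda>x. deriv (\<lambda>s. \<rho> s x) t * f x)"
    let ?P = "torus_integral (\<lambda>x. poisson (sg_potential \<epsilon> (\<rho> t)) (\<rho> t) x * f x)"
    have L: "lie_poisson (linear_observable f) (sg_hamiltonian \<epsilon>) (\<rho> t) = - ?P"
      by (intro lie_poisson_linear_observable f smooth[OF t] sg_hamiltonian_functional_derivative branch br t \<epsilon>)
    have "torus_integral (\<lambda>x. R t x * f x) = ?D + ?P"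
      unfolding R_def distrib_right
      by (intro torus_integral_add torus_smooth_continuous torus_smooth_mult f
          torus_smooth_time_derivative[OF curve I t] torus_smooth_poisson smooth[OF t])
    then have iff: "torus_integral (\<lambda>x. R t x * f x) = 0 \<longleftrightarrow> ?D = - ?P" by linarith
    note D = linear_observable_time_derivative[OF curve I f t]
    show ?thesis
      unfolding L iff
    proof
      assume "((\<lambda>s. linear_observable f (\<rho> s)) has_real_derivative - ?P) (at t)"
      with D show "?D = - ?P" by (rule DERIV_unique)
    next
      assume "?D = - ?P"
      from D[unfolded this] show "((\<lambda>s. linear_observable f (\<rho> s)) has_real_derivative - ?P) (at t)" .
    qed
  qed
  show distr: "hamiltonian_trajectory (sg_hamiltonian \<epsilon>) I \<rho> \<longleftrightarrow> sg_solution_distr \<epsilon> I \<rho>"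
    unfolding hamiltonian_trajectory_def sg_solution_distr_def R_def[symmetric] using ham constr by blast
  have zero: "R t x = 0" if "\<forall>f. torus_smooth f \<longrightarrow> torus_integral (\<lambda>x. R t x * f x) = 0" "t \<in> I" for t x
  proof -
    have "torus_integral (\<lambda>x. R t x * R t x) = 0" using that R by blast
    then show ?thesis
      by (rule torus_integral_square_eq_0[OF torus_smooth_continuous[OF R[OF that(2)]] torus_smooth_periodic[OF R[OF that(2)]]])
  qed
  have "sg_solution_distr \<epsilon> I \<rho> \<longleftrightarrow> sg_solution_classical \<epsilon> I \<rho>"
    unfolding sg_solution_distr_def sg_solution_classical_def R_def[symmetric]
  proof (intro ball_cong refl conj_cong iffI allI impI)
    fix t x assume "t \<in> I" "\<forall>f. torus_smooth f \<longrightarrow> torus_integral (\<lambda>x. R t x * f x) = 0"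
    then show "R t x = 0" by (rule zero[rotated])
  qed simp
  with distr show "hamiltonian_trajectory (sg_hamiltonian \<epsilon>) I \<rho> \<longleftrightarrow> sg_solution_classical \<epsilon> I \<rho>" by (rule trans)
qed simp

end
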